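(* Let $Z$ be a single-output Boolean circuit of cliquewidth $k$. Then there is a DNNF of $Z$ of size $O(9^{18k}k^2|Z|)$. Moreover, there is an algorithm that, given $Z$ and a clique decomposition of (the DAG of) $Z$ of width $k$, constructs such a DNNF in time $O(9^{18k}k^2|Z|)$.
   Context: Boolean circuits are over $\{\vee,\wedge,\neg\}$: input gates (variables), NOT gates (one input), AND/OR gates (positive fan-in), no constant gates in the given circuit; $|Z|$ is the number of gates; the DAG of $Z$ has an arc per wire. A clique decomposition of a directed graph is a rooted binary tree of vertex-labeled (by natural numbers) directed graphs built by: creating a single vertex with label $i$, disjoint union, $\eta_{i,j}$ (add all arcs from label-$i$ to label-$j$ vertices), $\rho_{i,j}$ (relabel $i$ to $j$); its width is the number of labels used; the cliquewidth of a circuit is the least width of a clique decomposition of its DAG. For a gate $g$, $Var(g)$ is the set of variables having a path to $g$. A circuit (which may use constant input gates true/false) is De Morgan if every NOT gate has a variable as its input, and decomposable if for any two in-neighbours $g_1,g_2$ of any AND gate, $Var(g_1)\cap Var(g_2)=\emptyset$. A DNNF is a decomposable De Morgan circuit; a DNNF of $Z$ is a DNNF computing the same Boolean function as $Z$. Size of a DNNF is its number of gates.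
   Formalization: In the algorithmic part the given clique decomposition is assumed to have at most c·k²|Z| nodes (any constant c, with the O-constant depending on c), because with arbitrarily many redundant relabelings no time bound in k and |Z| alone can hold. *)

theory Defs
  imports Main "Graph_Theory.Pair_Digraph"
begin

section \<open>Boolean circuits\<close>

text \<open>
  A circuit is a list of gates; a gate is identified with its position in the list, and the
  positions need not be in topological order. Every gate refers to the gates feeding it.
\<close>

datatype gate =
    GVar nat
  | GConst bool
  | GNot nat
  | GAnd "nat list"
  | GOr "nat list"

record circuit =
  gates :: "gate list"
  out_gate :: nat

fun gate_inputs :: "gate \<Rightarrow> nat list" where
  "gate_inputs (GVar x) = []"
| "gate_inputs (GConst b) = []"
| "gate_inputs (GNot h) = [h]"
| "gate_inputs (GAnd hs) = hs"
| "gate_inputs (GOr hs) = hs"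

definition circuit_size :: "circuit \<Rightarrow> nat" where
  "circuit_size Z = length (gates Z)"

definition circuit_dag :: "circuit \<Rightarrow> nat pair_pre_digraph" where
  "circuit_dag Z =
    \<lparr> pverts = {..<circuit_size Z},
      parcs = {(h, g). g < circuit_size Z \<and> h \<in> set (gate_inputs (gates Z ! g))} \<rparr>"

text \<open>
  A variable is an input gate, so no variable may occur at two different positions.
\<close>

definition circuit :: "circuit \<Rightarrow> bool" where
  "circuit Z \<longleftrightarrow>
     out_gate Z < circuit_size Z \<and>
     pair_wf_digraph (circuit_dag Z) \<and>
     acyclic (parcs (circuit_dag Z)) \<and>
     (\<forall>G \<in> set (gates Z). distinct (gate_inputs G)) \<and>
     GAnd [] \<notin> set (gates Z) \<and> GOr [] \<notin> set (gates Z) \<and>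
     (\<forall>g < circuit_size Z. \<forall>h < circuit_size Z. \<forall>x.
        gates Z ! g = GVar x \<and> gates Z ! h = GVar x \<longrightarrow> g = h)"

definition constant_free :: "circuit \<Rightarrow> bool" where
  "constant_free Z \<longleftrightarrow> (\<forall>b. GConst b \<notin> set (gates Z))"

definition circuit_vars :: "circuit \<Rightarrow> nat set" where
  "circuit_vars Z = {x. GVar x \<in> set (gates Z)}"

fun gate_fun :: "(nat \<Rightarrow> bool) \<Rightarrow> (nat \<Rightarrow> bool) \<Rightarrow> gate \<Rightarrow> bool" where
  "gate_fun \<alpha> v (GVar x) \<longleftrightarrow> \<alpha> x"
| "gate_fun \<alpha> v (GConst b) \<longleftrightarrow> b"
| "gate_fun \<alpha> v (GNot h) \<longleftrightarrow> \<not> v h"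
| "gate_fun \<alpha> v (GAnd hs) \<longleftrightarrow> (\<forall>h \<in> set hs. v h)"
| "gate_fun \<alpha> v (GOr hs) \<longleftrightarrow> (\<exists>h \<in> set hs. v h)"

inductive gate_value :: "circuit \<Rightarrow> (nat \<Rightarrow> bool) \<Rightarrow> nat \<Rightarrow> bool \<Rightarrow> bool"
  for Z :: circuit and \<alpha> :: "nat \<Rightarrow> bool" where
  "g < circuit_size Z \<Longrightarrow>
   (\<And>h. h \<in> set (gate_inputs (gates Z ! g)) \<Longrightarrow> gate_value Z \<alpha> h (v h)) \<Longrightarrow>
   gate_value Z \<alpha> g (gate_fun \<alpha> v (gates Z ! g))"

definition circuit_fun :: "circuit \<Rightarrow> (nat \<Rightarrow> bool) \<Rightarrow> bool" where
  "circuit_fun Z \<alpha> \<longleftrightarrow> gate_value Z \<alpha> (out_gate Z) True"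

lemma gate_fun_cong:
  "(\<And>h. h \<in> set (gate_inputs G) \<Longrightarrow> v h = w h) \<Longrightarrow> gate_fun \<alpha> v G = gate_fun \<alpha> w G"
  by (cases G) auto

lemma gate_value_unique:
  "gate_value Z \<alpha> g b \<Longrightarrow> gate_value Z \<alpha> g c \<Longrightarrow> b = c"
proof (induction arbitrary: c rule: gate_value.induct)
  case (1 g v)
  from 1(4) obtain w where c: "c = gate_fun \<alpha> w (gates Z ! g)"
    and w: "\<And>h. h \<in> set (gate_inputs (gates Z ! g)) \<Longrightarrow> gate_value Z \<alpha> h (w h)"
    by (rule gate_value.cases) iprover
  have "gate_fun \<alpha> v (gates Z ! g) = gate_fun \<alpha> w (gates Z ! g)"
  proof (rule gate_fun_cong)
    fix h assume h: "h \<in> set (gate_inputs (gates Z ! g))"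
    show "v h = w h" using 1(3)[OF h w[OF h]] .
  qed
  with c show ?case by simp
qed

lemma gate_value_total:
  assumes "circuit Z" "g < circuit_size Z"
  shows "\<exists>b. gate_value Z \<alpha> g b"
proof -
  let ?A = "parcs (circuit_dag Z)"
  have wfd: "pair_wf_digraph (circuit_dag Z)" and ac: "acyclic ?A"
    using assms by (auto simp: circuit_def)
  have "?A \<subseteq> {..<circuit_size Z} \<times> {..<circuit_size Z}"
    using pair_wf_digraph.in_arcsD1[OF wfd] pair_wf_digraph.in_arcsD2[OF wfd]
    by (auto simp: circuit_dag_def)
  then have "finite ?A" by (rule finite_subset) simp
  then have "wf ?A" using ac by (rule finite_acyclic_wf)
  then show ?thesis using assms(2)
  proof (induction g rule: wf_induct_rule)
    case (less g)
    have "\<exists>b. gate_value Z \<alpha> h b" if "h \<in> set (gate_inputs (gates Z ! g))" for h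
    proof -
      have "(h, g) \<in> ?A" using that less.prems by (simp add: circuit_dag_def)
      moreover from this have "h < circuit_size Z"
        using pair_wf_digraph.in_arcsD1[OF wfd] by (simp add: circuit_dag_def)
      ultimately show ?thesis using less.IH by blast
    qed
    then obtain v where
      "\<And>h. h \<in> set (gate_inputs (gates Z ! g)) \<Longrightarrow> gate_value Z \<alpha> h (v h)"
      by metis
    then show ?case using gate_value.intros[OF less.prems] by blast
  qed
qed


section \<open>DNNFs\<close>

definition gate_Var :: "circuit \<Rightarrow> nat \<Rightarrow> nat set" where
  "gate_Var Z g =
     {x. \<exists>h < circuit_size Z. gates Z ! h = GVar x \<and> (h, g) \<in> (parcs (circuit_dag Z))\<^sup>*}"

definition de_morgan :: "circuit \<Rightarrow> bool" where
  "de_morgan Z \<longleftrightarrow> (\<forall>h. GNot h \<in> set (gates Z) \<longrightarrow> (\<exists>x. gates Z ! h = GVar x))"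

definition decomposable :: "circuit \<Rightarrow> bool" where
  "decomposable Z \<longleftrightarrow>
     (\<forall>hs. GAnd hs \<in> set (gates Z) \<longrightarrow>
        (\<forall>g1 \<in> set hs. \<forall>g2 \<in> set hs. g1 \<noteq> g2 \<longrightarrow> gate_Var Z g1 \<inter> gate_Var Z g2 = {}))"

definition dnnf :: "circuit \<Rightarrow> bool" where
  "dnnf D \<longleftrightarrow> circuit D \<and> de_morgan D \<and> decomposable D"

definition dnnf_of :: "circuit \<Rightarrow> circuit \<Rightarrow> bool" where
  "dnnf_of D Z \<longleftrightarrow>
     dnnf D \<and> circuit_vars D \<subseteq> circuit_vars Z \<and> (\<forall>\<alpha>. circuit_fun D \<alpha> = circuit_fun Z \<alpha>)"


section \<open>Clique decompositions of directed graphs\<close>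

datatype 'a clique_dec =
    Create 'a nat
  | Disj_Union "'a clique_dec" "'a clique_dec"
  | Eta nat nat "'a clique_dec"
  | Rho nat nat "'a clique_dec"

fun dec_verts :: "'a clique_dec \<Rightarrow> 'a set" where
  "dec_verts (Create v i) = {v}"
| "dec_verts (Disj_Union S T) = dec_verts S \<union> dec_verts T"
| "dec_verts (Eta i j T) = dec_verts T"
| "dec_verts (Rho i j T) = dec_verts T"

fun dec_label :: "'a clique_dec \<Rightarrow> 'a \<Rightarrow> nat" where
  "dec_label (Create v i) u = i"
| "dec_label (Disj_Union S T) u = (if u \<in> dec_verts S then dec_label S u else dec_label T u)"
| "dec_label (Eta i j T) u = dec_label T u"
| "dec_label (Rho i j T) u = (if dec_label T u = i then j else dec_label T u)"

fun dec_arcs :: "'a clique_dec \<Rightarrow> 'a rel" where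
  "dec_arcs (Create v i) = {}"
| "dec_arcs (Disj_Union S T) = dec_arcs S \<union> dec_arcs T"
| "dec_arcs (Eta i j T) = dec_arcs T \<union>
     {(u, w). u \<in> dec_verts T \<and> w \<in> dec_verts T \<and> dec_label T u = i \<and> dec_label T w = j}"
| "dec_arcs (Rho i j T) = dec_arcs T"

fun unions_disjoint :: "'a clique_dec \<Rightarrow> bool" where
  "unions_disjoint (Create v i) \<longleftrightarrow> True"
| "unions_disjoint (Disj_Union S T) \<longleftrightarrow>
     dec_verts S \<inter> dec_verts T = {} \<and> unions_disjoint S \<and> unions_disjoint T"
| "unions_disjoint (Eta i j T) \<longleftrightarrow> unions_disjoint T"
| "unions_disjoint (Rho i j T) \<longleftrightarrow> unions_disjoint T"

definition clique_decomposition :: "'a clique_dec \<Rightarrow> 'a pair_pre_digraph \<Rightarrow> bool" where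
  "clique_decomposition T G \<longleftrightarrow>
     unions_disjoint T \<and> dec_verts T = pverts G \<and> dec_arcs T = parcs G"

fun dec_labels :: "'a clique_dec \<Rightarrow> nat set" where
  "dec_labels (Create v i) = {i}"
| "dec_labels (Disj_Union S T) = dec_labels S \<union> dec_labels T"
| "dec_labels (Eta i j T) = {i, j} \<union> dec_labels T"
| "dec_labels (Rho i j T) = {i, j} \<union> dec_labels T"

definition dec_width :: "'a clique_dec \<Rightarrow> nat" where
  "dec_width T = card (dec_labels T)"

fun dec_nodes :: "'a clique_dec \<Rightarrow> nat" where
  "dec_nodes (Create v i) = 1"
| "dec_nodes (Disj_Union S T) = dec_nodes S + dec_nodes T + 1"
| "dec_nodes (Eta i j T) = dec_nodes T + 1"
| "dec_nodes (Rho i j T) = dec_nodes T + 1"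

definition cliquewidth :: "'a pair_pre_digraph \<Rightarrow> nat" where
  "cliquewidth G = (LEAST k. \<exists>T. clique_decomposition T G \<and> dec_width T = k)"


section \<open>A machine model\<close>

text \<open>
  Algorithms are programs of a structured random access machine. Its memory consists of
  arrays of natural numbers, a scalar being the cell 0 of an array. As usual for unit-cost
  random access machines, the only arithmetic is addition and truncated subtraction (no
  multiplication). An expression used as a test counts as true if it is nonzero. Every
  operation, including every node of every evaluated expression, costs one time unit; the
  relation \<open>exec c s n t\<close> says that \<open>c\<close>, started in \<open>s\<close>, halts in \<open>t\<close> after \<open>n\<close> time units.
\<close>

type_synonym array = "string \<times> string"
type_synonym memory = "array \<Rightarrow> nat \<Rightarrow> nat"

datatype expr =
    Num nat
  | Load array expr
  | Plus expr expr
  | Minus expr expr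

datatype prog =
    Skip
  | Store array expr expr
  | Seq prog prog
  | Cond expr prog prog
  | While expr prog

fun expr_val :: "expr \<Rightarrow> memory \<Rightarrow> nat" where
  "expr_val (Num n) s = n"
| "expr_val (Load a e) s = s a (expr_val e s)"
| "expr_val (Plus e f) s = expr_val e s + expr_val f s"
| "expr_val (Minus e f) s = expr_val e s - expr_val f s"

fun expr_cost :: "expr \<Rightarrow> nat" where
  "expr_cost (Num n) = 1"
| "expr_cost (Load a e) = expr_cost e + 1"
| "expr_cost (Plus e f) = expr_cost e + expr_cost f + 1"
| "expr_cost (Minus e f) = expr_cost e + expr_cost f + 1"

inductive exec :: "prog \<Rightarrow> memory \<Rightarrow> nat \<Rightarrow> memory \<Rightarrow> bool" where
  exec_Skip: "exec Skip s 1 s"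
| exec_Store: "exec (Store a e f) s (expr_cost e + expr_cost f + 1)
     (s(a := (s a)(expr_val e s := expr_val f s)))"
| exec_Seq: "exec c s m t \<Longrightarrow> exec d t n u \<Longrightarrow> exec (Seq c d) s (m + n) u"
| exec_CondT: "expr_val e s \<noteq> 0 \<Longrightarrow> exec c s n t \<Longrightarrow> exec (Cond e c d) s (expr_cost e + 1 + n) t"
| exec_CondF: "expr_val e s = 0 \<Longrightarrow> exec d s n t \<Longrightarrow> exec (Cond e c d) s (expr_cost e + 1 + n) t"
| exec_WhileT: "expr_val e s \<noteq> 0 \<Longrightarrow> exec c s m t \<Longrightarrow> exec (While e c) t n u \<Longrightarrow>
     exec (While e c) s (expr_cost e + 1 + m + n) u"
| exec_WhileF: "expr_val e s = 0 \<Longrightarrow> exec (While e c) s (expr_cost e + 1) s"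

inductive_cases exec_SkipE: "exec Skip s n t"
inductive_cases exec_StoreE: "exec (Store a e f) s n t"
inductive_cases exec_SeqE: "exec (Seq c d) s n t"
inductive_cases exec_CondE: "exec (Cond e c d) s n t"
inductive_cases exec_WhileE: "exec (While e c) s n t"

lemma exec_deterministic:
  "exec c s m t \<Longrightarrow> exec c s n u \<Longrightarrow> m = n \<and> t = u"
proof (induction arbitrary: n u rule: exec.induct)
  case exec_Skip then show ?case by (auto elim: exec_SkipE)
next
  case exec_Store then show ?case by (auto elim: exec_StoreE)
next
  case (exec_Seq c s m t d n' v)
  from exec_Seq.prems obtain m1 n1 t1 where
    e: "n = m1 + n1" "exec c s m1 t1" "exec d t1 n1 u" by (rule exec_SeqE)
  from exec_Seq.IH(1)[OF e(2)] have "m = m1" "t = t1" by simp_all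
  with exec_Seq.IH(2) e show ?case by simp
next
  case (exec_CondT e s c n' t d)
  from exec_CondT.prems exec_CondT.hyps(1) obtain n1 where
    e: "n = expr_cost e + 1 + n1" "exec c s n1 u" by (auto elim: exec_CondE)
  from exec_CondT.IH[OF e(2)] e(1) show ?case by simp
next
  case (exec_CondF e s d n' t c)
  from exec_CondF.prems exec_CondF.hyps(1) obtain n1 where
    e: "n = expr_cost e + 1 + n1" "exec d s n1 u" by (auto elim: exec_CondE)
  from exec_CondF.IH[OF e(2)] e(1) show ?case by simp
next
  case (exec_WhileT e s c m t n' v)
  from exec_WhileT.prems exec_WhileT.hyps(1) obtain m1 n1 t1 where
    e: "n = expr_cost e + 1 + m1 + n1" "exec c s m1 t1" "exec (While e c) t1 n1 u"
    by (auto elim: exec_WhileE)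
  from exec_WhileT.IH(1)[OF e(2)] have "m = m1" "t = t1" by simp_all
  with exec_WhileT.IH(2) e show ?case by simp
next
  case (exec_WhileF e s c)
  then show ?case by (auto elim: exec_WhileE)
qed


section \<open>Memory layout of circuits and clique decompositions\<close>

text \<open>
  The in-neighbours of a gate form a contiguous block of a common array of wires. Kind and
  block of a gate are found in constant time from its position: a circuit may have more than
  linearly many wires, so that a time bound linear in the number of gates does not permit
  reading all of them.
\<close>

fun gate_kind :: "gate \<Rightarrow> nat" where
  "gate_kind (GVar x) = 0"
| "gate_kind (GConst b) = (if b then 2 else 1)"
| "gate_kind (GNot h) = 3"
| "gate_kind (GAnd hs) = 4"
| "gate_kind (GOr hs) = 5"

definition circuit_in_memory :: "string \<Rightarrow> memory \<Rightarrow> circuit \<Rightarrow> bool" where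
  "circuit_in_memory p s Z \<longleftrightarrow>
     s (p, ''size'') 0 = circuit_size Z \<and>
     s (p, ''output'') 0 = out_gate Z \<and>
     (\<forall>g < circuit_size Z.
        let G = gates Z ! g; hs = gate_inputs G in
        s (p, ''kind'') g = gate_kind G \<and>
        (\<forall>x. G = GVar x \<longrightarrow> s (p, ''var'') g = x) \<and>
        s (p, ''degree'') g = length hs \<and>
        (\<forall>l < length hs. s (p, ''wire'') (s (p, ''offset'') g + l) = hs ! l))"

text \<open>
  A clique decomposition is stored as the sequence of its nodes in postorder.
\<close>

fun postorder :: "nat clique_dec \<Rightarrow> (nat \<times> nat \<times> nat) list" where
  "postorder (Create v i) = [(0, v, i)]"
| "postorder (Disj_Union S T) = postorder S @ postorder T @ [(1, 0, 0)]"
| "postorder (Eta i j T) = postorder T @ [(2, i, j)]"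
| "postorder (Rho i j T) = postorder T @ [(3, i, j)]"

lemma length_postorder: "length (postorder T) = dec_nodes T"
  by (induction T) auto

definition dec_in_memory :: "string \<Rightarrow> memory \<Rightarrow> nat clique_dec \<Rightarrow> bool" where
  "dec_in_memory p s T \<longleftrightarrow>
     s (p, ''size'') 0 = dec_nodes T \<and>
     (\<forall>l < dec_nodes T.
        (s (p, ''op'') l, s (p, ''arg1'') l, s (p, ''arg2'') l) = postorder T ! l)"

definition initial_memory :: "circuit \<Rightarrow> nat clique_dec \<Rightarrow> memory \<Rightarrow> bool" where
  "initial_memory Z T s \<longleftrightarrow>
     circuit_in_memory ''Z'' s Z \<and> dec_in_memory ''T'' s T \<and>
     (\<forall>p f. p \<noteq> ''Z'' \<and> p \<noteq> ''T'' \<longrightarrow> s (p, f) = (\<lambda>_. 0))"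

end

theory Submission
  imports Defs
begin

text \<open>
  Guess the values of all gates of \<open>Z\<close> and check them locally. For a part of \<open>Z\<close> given by a subtree of
  the decomposition, all that matters for the rest of the check is, for every label, which values occur
  at vertices with that label, which input values these vertices forbid, and which input values they
  still need: six bits per label, hence \<open>2 ^ (6 * k)\<close> states. All vertices of a label receive the same new
  arcs, so that adding arcs and relabelling act on states. For every subtree and every state there is a
  gate that is true iff the inputs in the subtree extend to a guess with that state. A disjoint union
  combines all pairs of states by conjunctions, whose inputs have disjoint variables, and disjunctions;
  adding arcs and relabelling need no gates at all. Hence the number of gates is linear in the number of
  vertices, whatever the number of nodes of the decomposition. The program does exactly this in one pass
  over the postorder, with a stack of families of gates and states coded as numbers.
\<close>

section \<open>Local conditions on gate values\<close>

text \<open>The time bound is linear in the number of gates, whereas a circuit may have more than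
  linearly many wires; so the wires of \<open>Z\<close> are never read, and all arcs are learnt from
  the decomposition. This is why the check of a gate is phrased through single arcs: a universal
  part (no arc from a forbidden value) and an existential part (some arc from each needed value).
  Both are insensitive to an arc being added twice. Acyclicity makes the correct guess unique, and
  since the output is guessed true, an input is accepted iff some guess survives. Negations of
  \<open>Z\<close> turn into forbidden values, so the only NOT gates of the result sit on variables;
  decomposability comes from the two sides of a union having disjoint vertices and each variable
  having only one position. As for the bound, \<open>N * N = 2 ^ (12 * k)\<close> pairs of states
  are combined at every union, each at the cost of a bitwise disjunction, which takes a number of
  steps linear in \<open>k\<close> because the machine can only add and subtract. This stays below
  \<open>9 ^ (18 * k)\<close> up to a constant factor.\<close>

text \<open>
  A guessed value \<open>b\<close> of a gate is correct iff its inputs avoid the values that are forbidden and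
  attain the values that are needed. An unmet need is discharged by a later arc from a vertex with
  the needed value, whereas an arc from a vertex with a forbidden value leads to rejection.
\<close>

fun forbids :: "gate \<Rightarrow> bool \<Rightarrow> bool \<Rightarrow> bool" where
  "forbids (GNot h) b c \<longleftrightarrow> c = b"
| "forbids (GAnd hs) b c \<longleftrightarrow> b \<and> \<not> c"
| "forbids (GOr hs) b c \<longleftrightarrow> \<not> b \<and> c"
| "forbids _ b c \<longleftrightarrow> False"

fun needs :: "gate \<Rightarrow> bool \<Rightarrow> bool \<Rightarrow> bool" where
  "needs (GAnd hs) b c \<longleftrightarrow> \<not> b \<and> \<not> c"
| "needs (GOr hs) b c \<longleftrightarrow> b \<and> c"
| "needs _ b c \<longleftrightarrow> False"

text \<open>A NOT gate needs nothing: with two truth values, forbidding \<open>b\<close> to its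
  input already forces the other value. AND and OR split by \<open>b\<close>: one value is a
  condition on all inputs, the other asks for a witness. Variables are excluded because their value
  comes from outside; \<open>admissible\<close> ties it to \<open>\<alpha>\<close>.\<close>

lemma gate_fun_iff_local:
  assumes "\<And>x. G \<noteq> GVar x" "\<And>c. G \<noteq> GConst c"
  shows "b = gate_fun \<alpha> v G \<longleftrightarrow>
    (\<forall>h \<in> set (gate_inputs G). \<not> forbids G b (v h)) \<and>
    (\<forall>c. needs G b c \<longrightarrow> (\<exists>h \<in> set (gate_inputs G). v h = c))"
  using assms by (cases G; cases b) (auto simp: all_bool_eq)

text \<open>Demanding a true output gate already here builds acceptance into the guess, so that no
  fact has to remember the output gate.\<close>

definition admissible :: "circuit \<Rightarrow> (nat \<Rightarrow> bool) \<Rightarrow> nat clique_dec \<Rightarrow> (nat \<Rightarrow> bool) \<Rightarrow> bool" where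
  "admissible Z \<alpha> T v \<longleftrightarrow> (\<forall>u \<in> dec_verts T.
     (\<forall>x. gates Z ! u = GVar x \<longrightarrow> v u = \<alpha> x) \<and> (u = out_gate Z \<longrightarrow> v u))"

text \<open>A forbidden arc can never be repaired by later arcs, so this is a filter on guesses and
  not part of the state; an open need can still be met and therefore has to be recorded.\<close>

definition unforbidden :: "circuit \<Rightarrow> nat clique_dec \<Rightarrow> (nat \<Rightarrow> bool) \<Rightarrow> bool" where
  "unforbidden Z T v \<longleftrightarrow> (\<forall>(h, u) \<in> dec_arcs T. \<not> forbids (gates Z ! u) (v u) (v h))"

text \<open>
  Facts 0 and 1 record the guessed value of a vertex, facts 2 and 3 the input values that it forbids,
  facts 4 and 5 the input values that it needs and does not yet have (false before true). The facts
  about all vertices with label \<open>a\<close> are merged and occupy the positions from \<open>6 * ix a\<close> on.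
\<close>

definition vertex_facts ::
    "circuit \<Rightarrow> nat clique_dec \<Rightarrow> (nat \<Rightarrow> bool) \<Rightarrow> nat \<Rightarrow> nat set" where
  "vertex_facts Z T v u =
     {if v u then 1 else 0} \<union>
     {if c then 3 else 2 |c. forbids (gates Z ! u) (v u) c} \<union>
     {if c then 5 else 4 |c. needs (gates Z ! u) (v u) c \<and> (\<forall>h. (h, u) \<in> dec_arcs T \<longrightarrow> v h \<noteq> c)}"

definition facts ::
    "circuit \<Rightarrow> (nat \<Rightarrow> nat) \<Rightarrow> nat clique_dec \<Rightarrow> (nat \<Rightarrow> bool) \<Rightarrow> nat set" where
  "facts Z ix T v =
     {6 * ix (dec_label T u) + f |u f. u \<in> dec_verts T \<and> f \<in> vertex_facts Z T v u}"

lemma vertex_facts_iff: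
  "f \<in> vertex_facts Z T v u \<longleftrightarrow>
     (f = 0 \<and> \<not> v u) \<or> (f = 1 \<and> v u) \<or>
     (f = 2 \<and> forbids (gates Z ! u) (v u) False) \<or> (f = 3 \<and> forbids (gates Z ! u) (v u) True) \<or>
     (f = 4 \<and> needs (gates Z ! u) (v u) False \<and> (\<forall>h. (h, u) \<in> dec_arcs T \<longrightarrow> v h)) \<or>
     (f = 5 \<and> needs (gates Z ! u) (v u) True \<and> (\<forall>h. (h, u) \<in> dec_arcs T \<longrightarrow> \<not> v h))"
  unfolding vertex_facts_def by (auto split: if_splits)

lemma vertex_facts_less: "f \<in> vertex_facts Z T v u \<Longrightarrow> f < 6"
  by (auto simp: vertex_facts_iff)

lemma dec_arcs_subset: "dec_arcs T \<subseteq> dec_verts T \<times> dec_verts T"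
  by (induction T) auto

lemma dec_label_in: "u \<in> dec_verts T \<Longrightarrow> dec_label T u \<in> dec_labels T"
  by (induction T) auto

lemma mult6_add_eq_iff:
  fixes a b f g :: nat
  assumes "f < 6" "g < 6"
  shows "6 * a + f = 6 * b + g \<longleftrightarrow> a = b \<and> f = g"
  using assms by presburger

lemma Ball_pairs: "(\<forall>(h, u) \<in> A. P h u) \<longleftrightarrow> (\<forall>h u. (h, u) \<in> A \<longrightarrow> P h u)"
  by auto

text \<open>Reduces an equation between sets of facts to single positions, that is, to one label and
  one of its six facts.\<close>

lemma eq_by_positions:
  assumes "\<And>a f. a \<in> L \<Longrightarrow> f < 6 \<Longrightarrow> 6 * ix a + f \<in> A \<longleftrightarrow> 6 * ix a + f \<in> B"
    and "\<And>p. p \<in> A \<or> p \<in> B \<Longrightarrow> \<exists>a f. a \<in> L \<and> f < 6 \<and> p = 6 * ix a + (f::nat)"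
  shows "A = B"
proof (rule set_eqI)
  fix p
  show "p \<in> A \<longleftrightarrow> p \<in> B"
  proof (cases "p \<in> A \<or> p \<in> B")
    case True
    then obtain a f where "a \<in> L" "f < 6" "p = 6 * ix a + f" using assms(2) by metis
    then show ?thesis using assms(1) by simp
  next
    case False
    then show ?thesis by simp
  qed
qed

text \<open>The condition sees \<open>h\<close> only through the bit \<open>v h\<close>. For each
  value of the bit it becomes a product of a condition on \<open>h\<close> and one on
  \<open>u\<close>, so the facts merged per label suffice to detect a conflict between two
  labels.\<close>

lemma bex_split_bool:
  "(\<exists>h \<in> V. \<exists>u \<in> W. P h \<and> Q u \<and> R u (v h)) \<longleftrightarrow>
     (\<exists>h \<in> V. P h \<and> \<not> v h) \<and> (\<exists>u \<in> W. Q u \<and> R u False) \<or>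
     (\<exists>h \<in> V. P h \<and> v h) \<and> (\<exists>u \<in> W. Q u \<and> R u True)" (is "?l \<longleftrightarrow> ?r")
proof
  assume ?l
  then obtain h u where hu: "h \<in> V" "u \<in> W" "P h" "Q u" "R u (v h)" by blast
  show ?r
  proof (cases "v h")
    case True
    then have "R u True" using hu by simp
    then show ?thesis using hu True by blast
  next
    case False
    then have "R u False" using hu by simp
    then show ?thesis using hu False by blast
  qed
next
  have *: ?l if "h \<in> V" "P h" "v h = c" "u \<in> W" "Q u" "R u c" for h u c using that by blast
  assume ?r then show ?l by (elim disjE conjE bexE) (rule *; simp)+
qed

text \<open>Since \<open>ix\<close> is injective and a label owns six consecutive positions, a
  position determines both its label and its fact.\<close>

lemma facts_iff:
  assumes "inj_on ix L" "dec_labels T \<subseteq> L" "a \<in> L" "f < 6"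
  shows "6 * ix a + f \<in> facts Z ix T v \<longleftrightarrow>
    (\<exists>u \<in> dec_verts T. dec_label T u = a \<and> f \<in> vertex_facts Z T v u)" (is "?l \<longleftrightarrow> ?r")
proof
  assume ?l
  then obtain u g where u: "u \<in> dec_verts T" "g \<in> vertex_facts Z T v u"
    and eq: "6 * ix a + f = 6 * ix (dec_label T u) + g"
    unfolding facts_def by auto
  then have "ix a = ix (dec_label T u)" "f = g"
    using mult6_add_eq_iff[OF assms(4) vertex_facts_less[OF u(2)]] by auto
  moreover have "dec_label T u \<in> L" using dec_label_in[OF u(1)] assms(2) by auto
  ultimately have "dec_label T u = a" using assms(1,3) by (auto dest: inj_onD)
  then show ?r using u \<open>f = g\<close> by auto
next
  assume ?r then show ?l unfolding facts_def by auto
qed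

lemma factsE:
  assumes "p \<in> facts Z ix T v"
  obtains a f where "a \<in> dec_labels T" "f < 6" "p = 6 * ix a + f"
proof -
  obtain u f where "u \<in> dec_verts T" "f \<in> vertex_facts Z T v u" "p = 6 * ix (dec_label T u) + f"
    using assms unfolding facts_def by auto
  then show ?thesis using that vertex_facts_less dec_label_in by metis
qed

text \<open>No arc runs between the two sides, so the open needs of a vertex are the same in the
  union as in its own side.\<close>

lemma facts_Disj_Union:
  assumes "dec_verts S \<inter> dec_verts T = {}"
  shows "facts Z ix (Disj_Union S T) v = facts Z ix S v \<union> facts Z ix T v"
proof -
  have S: "vertex_facts Z (Disj_Union S T) v u = vertex_facts Z S v u" if "u \<in> dec_verts S" for u
  proof -
    have "(h, u) \<notin> dec_arcs T" for h using that assms dec_arcs_subset[of T] by auto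
    then show ?thesis by (simp add: vertex_facts_def)
  qed
  have T: "vertex_facts Z (Disj_Union S T) v u = vertex_facts Z T v u" "u \<notin> dec_verts S"
    if "u \<in> dec_verts T" for u
  proof -
    have "(h, u) \<notin> dec_arcs S" for h using that assms dec_arcs_subset[of S] by auto
    then show "vertex_facts Z (Disj_Union S T) v u = vertex_facts Z T v u"
      by (simp add: vertex_facts_def)
    show "u \<notin> dec_verts S" using that assms by auto
  qed
  show ?thesis (is "?l = ?r")
  proof (rule set_eqI)
    fix p
    have "p \<in> ?l \<longleftrightarrow> (\<exists>u \<in> dec_verts S \<union> dec_verts T. \<exists>f \<in> vertex_facts Z (Disj_Union S T) v u.
        p = 6 * ix (dec_label (Disj_Union S T) u) + f)"
      unfolding facts_def by auto
    also have "\<dots> \<longleftrightarrow> (\<exists>u \<in> dec_verts S. \<exists>f \<in> vertex_facts Z S v u. p = 6 * ix (dec_label S u) + f) \<or>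
        (\<exists>u \<in> dec_verts T. \<exists>f \<in> vertex_facts Z T v u. p = 6 * ix (dec_label T u) + f)"
      unfolding bex_Un using S T by auto
    also have "\<dots> \<longleftrightarrow> p \<in> ?r" unfolding facts_def by auto
    finally show "p \<in> ?l \<longleftrightarrow> p \<in> ?r" .
  qed
qed

lemma unforbidden_Disj_Union:
  "unforbidden Z (Disj_Union S T) v \<longleftrightarrow> unforbidden Z S v \<and> unforbidden Z T v"
  by (auto simp: unforbidden_def)

lemma admissible_Disj_Union:
  "admissible Z \<alpha> (Disj_Union S T) v \<longleftrightarrow> admissible Z \<alpha> S v \<and> admissible Z \<alpha> T v"
  by (auto simp: admissible_def)

text \<open>This and the next two facts allow the gluing of guesses made separately on the two sides
  of a union: only the values on the vertices of the subtree matter, because its arcs stay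
  inside.\<close>

lemma admissible_cong:
  "(\<And>u. u \<in> dec_verts T \<Longrightarrow> v u = w u) \<Longrightarrow> admissible Z \<alpha> T v = admissible Z \<alpha> T w"
  by (auto simp: admissible_def)

lemma unforbidden_cong:
  assumes "\<And>u. u \<in> dec_verts T \<Longrightarrow> v u = w u"
  shows "unforbidden Z T v = unforbidden Z T w"
proof -
  have "(v u, v h) = (w u, w h)" if "(h, u) \<in> dec_arcs T" for h u
    using that dec_arcs_subset[of T] assms by auto
  then show ?thesis unfolding unforbidden_def Ball_pairs by simp
qed

lemma facts_cong:
  assumes "\<And>u. u \<in> dec_verts T \<Longrightarrow> v u = w u"
  shows "facts Z ix T v = facts Z ix T w"
proof -
  have "vertex_facts Z T v u = vertex_facts Z T w u" if "u \<in> dec_verts T" for u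
  proof -
    have "v h = w h" if "(h, u) \<in> dec_arcs T" for h using that assms dec_arcs_subset[of T] by auto
    then have "(\<forall>h. (h, u) \<in> dec_arcs T \<longrightarrow> v h \<noteq> c) \<longleftrightarrow> (\<forall>h. (h, u) \<in> dec_arcs T \<longrightarrow> w h \<noteq> c)" for c
      by auto
    then show ?thesis unfolding vertex_facts_def using assms[OF that] by simp
  qed
  then show ?thesis unfolding facts_def by (intro Collect_cong ex_cong1 conj_cong refl) auto
qed

text \<open>Some new arc would lead from a vertex of value \<open>c\<close> to a vertex forbidding
  \<open>c\<close>: first for \<open>c\<close> false (facts 0 and 2), then for \<open>c\<close> true
  (facts 1 and 3).\<close>

definition eta_rejects :: "(nat \<Rightarrow> nat) \<Rightarrow> nat \<Rightarrow> nat \<Rightarrow> nat set \<Rightarrow> bool" where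
  "eta_rejects ix i j F \<longleftrightarrow>
     6 * ix i \<in> F \<and> 6 * ix j + 2 \<in> F \<or> 6 * ix i + 1 \<in> F \<and> 6 * ix j + 3 \<in> F"

text \<open>If label \<open>i\<close> has a vertex of value \<open>c\<close>, every vertex labelled
  \<open>j\<close> receives an arc from it, so the merged need of \<open>c\<close> at
  \<open>j\<close> disappears as a whole. Both tests look at the original \<open>F\<close>.\<close>

definition eta_facts :: "(nat \<Rightarrow> nat) \<Rightarrow> nat \<Rightarrow> nat \<Rightarrow> nat set \<Rightarrow> nat set" where
  "eta_facts ix i j F = F - (if 6 * ix i \<in> F then {6 * ix j + 4} else {})
     - (if 6 * ix i + 1 \<in> F then {6 * ix j + 5} else {})"

definition rho_facts :: "(nat \<Rightarrow> nat) \<Rightarrow> nat \<Rightarrow> nat \<Rightarrow> nat set \<Rightarrow> nat set" where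
  "rho_facts ix i j F =
     (F - {6 * ix i + f |f. f < 6}) \<union> {6 * ix j + f |f. f < 6 \<and> 6 * ix i + f \<in> F}"

section \<open>Effect of new arcs and of relabelling on the facts\<close>

lemma unforbidden_Eta:
  assumes "inj_on ix L" "dec_labels (Eta i j T) \<subseteq> L"
  shows "unforbidden Z (Eta i j T) v \<longleftrightarrow>
    unforbidden Z T v \<and> \<not> eta_rejects ix i j (facts Z ix T v)"
proof -
  have T: "dec_labels T \<subseteq> L" and i: "i \<in> L" and j: "j \<in> L" using assms(2) by auto
  note F = facts_iff[OF assms(1) T]
  have iff: "eta_rejects ix i j (facts Z ix T v) \<longleftrightarrow>
     (\<exists>h \<in> dec_verts T. \<exists>u \<in> dec_verts T. dec_label T h = i \<and> dec_label T u = j \<and>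
        forbids (gates Z ! u) (v u) (v h))"
  proof -
    have "eta_rejects ix i j (facts Z ix T v) \<longleftrightarrow>
      (\<exists>h \<in> dec_verts T. dec_label T h = i \<and> \<not> v h) \<and>
      (\<exists>u \<in> dec_verts T. dec_label T u = j \<and> forbids (gates Z ! u) (v u) False) \<or>
      (\<exists>h \<in> dec_verts T. dec_label T h = i \<and> v h) \<and>
      (\<exists>u \<in> dec_verts T. dec_label T u = j \<and> forbids (gates Z ! u) (v u) True)"
      unfolding eta_rejects_def using F[OF i, of 0] F[OF i, of 1] F[OF j, of 2] F[OF j, of 3]
      by (simp add: vertex_facts_iff)
    also have "\<dots> \<longleftrightarrow> (\<exists>h \<in> dec_verts T. \<exists>u \<in> dec_verts T. dec_label T h = i \<and> dec_label T u = j \<and>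
        forbids (gates Z ! u) (v u) (v h))"
      by (rule bex_split_bool[symmetric])
    finally show ?thesis .
  qed
  have "unforbidden Z (Eta i j T) v \<longleftrightarrow> (\<forall>h u. (h, u) \<in> dec_arcs (Eta i j T) \<longrightarrow>
      \<not> forbids (gates Z ! u) (v u) (v h))"
    unfolding unforbidden_def by (rule Ball_pairs)
  also have "\<dots> \<longleftrightarrow> (\<forall>h u. (h, u) \<in> dec_arcs T \<longrightarrow> \<not> forbids (gates Z ! u) (v u) (v h)) \<and>
    \<not> (\<exists>h \<in> dec_verts T. \<exists>u \<in> dec_verts T. dec_label T h = i \<and> dec_label T u = j \<and>
        forbids (gates Z ! u) (v u) (v h))"
    by (simp only: dec_arcs.simps Un_iff mem_Collect_eq prod.case) blast
  also have "(\<forall>h u. (h, u) \<in> dec_arcs T \<longrightarrow> \<not> forbids (gates Z ! u) (v u) (v h)) \<longleftrightarrow>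
      unforbidden Z T v"
    unfolding unforbidden_def by (rule Ball_pairs[symmetric])
  finally show ?thesis unfolding iff .
qed

lemma facts_Eta:
  assumes "inj_on ix L" "dec_labels (Eta i j T) \<subseteq> L"
  shows "facts Z ix (Eta i j T) v = eta_facts ix i j (facts Z ix T v)" (is "?l = ?r")
proof -
  have T: "dec_labels T \<subseteq> L" and i: "i \<in> L" and j: "j \<in> L" using assms(2) by auto
  have F: "6 * ix a + f \<in> facts Z ix T v \<longleftrightarrow>
      (\<exists>u \<in> dec_verts T. dec_label T u = a \<and> f \<in> vertex_facts Z T v u)"
    if "a \<in> L" "f < 6" for a f using facts_iff[OF assms(1) T that] .
  have F': "6 * ix a + f \<in> ?l \<longleftrightarrow>
      (\<exists>u \<in> dec_verts T. dec_label T u = a \<and> f \<in> vertex_facts Z (Eta i j T) v u)"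
    if "a \<in> L" "f < 6" for a f using facts_iff[OF assms that] by simp
  have has: "6 * ix i \<in> facts Z ix T v \<longleftrightarrow> (\<exists>h \<in> dec_verts T. dec_label T h = i \<and> \<not> v h)"
    "6 * ix i + 1 \<in> facts Z ix T v \<longleftrightarrow> (\<exists>h \<in> dec_verts T. dec_label T h = i \<and> v h)"
    using F[OF i, of 0] F[OF i, of 1] by (auto simp: vertex_facts_iff)
  have mem: "6 * ix a + f \<in> ?r \<longleftrightarrow> 6 * ix a + f \<in> facts Z ix T v \<and>
      \<not> (a = j \<and> (f = 4 \<and> 6 * ix i \<in> facts Z ix T v \<or> f = 5 \<and> 6 * ix i + 1 \<in> facts Z ix T v))"
    if "a \<in> L" "f < 6" for a f
  proof -
    have "6 * ix a + f = 6 * ix j + 4 \<longleftrightarrow> a = j \<and> f = 4"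
      "6 * ix a + f = 6 * ix j + 5 \<longleftrightarrow> a = j \<and> f = 5"
      using that mult6_add_eq_iff[of f _ "ix a" "ix j"] inj_on_eq_iff[OF assms(1) that(1) j] by simp_all
    then show ?thesis unfolding eta_facts_def by (simp split: if_splits) metis
  qed
  have vf: "f \<in> vertex_facts Z (Eta i j T) v u \<longleftrightarrow> f \<in> vertex_facts Z T v u \<and>
      \<not> (dec_label T u = j \<and> (f = 4 \<and> 6 * ix i \<in> facts Z ix T v \<or> f = 5 \<and> 6 * ix i + 1 \<in> facts Z ix T v))"
    if u: "u \<in> dec_verts T" for u f
  proof -
    \<comment> \<open>A vertex with label \<open>j\<close> gains arcs from exactly the vertices with
      label \<open>i\<close>; every other vertex gains none.\<close>
    have "(\<forall>h. (h, u) \<in> dec_arcs (Eta i j T) \<longrightarrow> v h \<noteq> c) \<longleftrightarrow>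
      (\<forall>h. (h, u) \<in> dec_arcs T \<longrightarrow> v h \<noteq> c) \<and>
      \<not> (dec_label T u = j \<and> (\<exists>h \<in> dec_verts T. dec_label T h = i \<and> v h = c))" for c
      using u by (simp only: dec_arcs.simps Un_iff mem_Collect_eq prod.case) blast
    from this[of False] this[of True] show ?thesis
      unfolding vertex_facts_iff has by auto
  qed
  have "6 * ix a + f \<in> ?l \<longleftrightarrow> 6 * ix a + f \<in> ?r" if "a \<in> L" "f < 6" for a f
    unfolding mem[OF that] F'[OF that] F[OF that] using vf by auto
  moreover have "\<exists>a f. a \<in> L \<and> f < 6 \<and> p = 6 * ix a + f" if "p \<in> ?l \<or> p \<in> ?r" for p
  proof -
    have "p \<in> ?l \<or> p \<in> facts Z ix T v" using that by (auto simp: eta_facts_def)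
    then show ?thesis
    proof
      assume "p \<in> ?l"
      then show ?thesis by (rule factsE) (use assms(2) in auto)
    next
      assume "p \<in> facts Z ix T v"
      then show ?thesis by (rule factsE) (use T in auto)
    qed
  qed
  ultimately show ?thesis by (rule eq_by_positions)
qed

lemma facts_Rho:
  assumes "inj_on ix L" "dec_labels (Rho i j T) \<subseteq> L" "i \<noteq> j"
  shows "facts Z ix (Rho i j T) v = rho_facts ix i j (facts Z ix T v)" (is "?l = ?r")
proof -
  have T: "dec_labels T \<subseteq> L" and i: "i \<in> L" and j: "j \<in> L" using assms(2) by auto
  have vf: "vertex_facts Z (Rho i j T) v u = vertex_facts Z T v u" for u
    by (simp add: vertex_facts_def)
  have F: "6 * ix a + f \<in> facts Z ix T v \<longleftrightarrow>
      (\<exists>u \<in> dec_verts T. dec_label T u = a \<and> f \<in> vertex_facts Z T v u)"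
    if "a \<in> L" "f < 6" for a f using facts_iff[OF assms(1) T that] .
  have F': "6 * ix a + f \<in> ?l \<longleftrightarrow>
      (\<exists>u \<in> dec_verts T. dec_label (Rho i j T) u = a \<and> f \<in> vertex_facts Z T v u)"
    if "a \<in> L" "f < 6" for a f using facts_iff[OF assms(1,2) that] by (simp add: vf)
  have mem: "6 * ix a + f \<in> ?r \<longleftrightarrow> (6 * ix a + f \<in> facts Z ix T v \<and> a \<noteq> i) \<or>
      (a = j \<and> 6 * ix i + f \<in> facts Z ix T v)"
    if "a \<in> L" "f < 6" for a f
  proof -
    have "6 * ix a + f = 6 * ix j + g \<longleftrightarrow> a = j \<and> f = g"
      "6 * ix a + f = 6 * ix i + g \<longleftrightarrow> a = i \<and> f = g" if "g < 6" for g
      using that \<open>f < 6\<close> mult6_add_eq_iff[of f g] inj_on_eq_iff[OF assms(1) \<open>a \<in> L\<close>] i j by simp_all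
    then show ?thesis unfolding rho_facts_def using that by auto
  qed
  have "6 * ix a + f \<in> ?l \<longleftrightarrow> 6 * ix a + f \<in> ?r" if "a \<in> L" "f < 6" for a f
    unfolding mem[OF that] F'[OF that] F[OF that] F[OF i that(2)] using assms(3) by auto
  moreover have "\<exists>a f. a \<in> L \<and> f < 6 \<and> p = 6 * ix a + f" if "p \<in> ?l \<or> p \<in> ?r" for p
  proof -
    have "p \<in> ?l \<or> p \<in> facts Z ix T v \<or> (\<exists>f<6. p = 6 * ix j + f)"
      using that by (auto simp: rho_facts_def)
    then consider "p \<in> ?l" | "p \<in> facts Z ix T v" | "\<exists>f<6. p = 6 * ix j + f" by blast
    then show ?thesis
    proof cases
      case 1
      then show ?thesis by (rule factsE) (use assms(2) in auto)
    next
      case 2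
      then show ?thesis by (rule factsE) (use T in auto)
    next
      case 3
      then show ?thesis using j by auto
    qed
  qed
  ultimately show ?thesis by (rule eq_by_positions)
qed

lemma facts_Rho_same: "facts Z ix (Rho i i T) v = facts Z ix T v"
proof -
  have "dec_label (Rho i i T) u = dec_label T u" for u by simp
  then show ?thesis unfolding facts_def vertex_facts_def by simp
qed

lemma unforbidden_Rho: "unforbidden Z (Rho i j T) v = unforbidden Z T v"
  by (simp add: unforbidden_def)

text \<open>The conditions say together that \<open>v\<close> satisfies every gate equation and
  makes the output true; by acyclicity only the true gate values do so. All needs must be met at the
  root, since no arcs are added after it.\<close>

lemma circuit_fun_iff_guess:
  assumes Z: "circuit Z" and cf: "constant_free Z"
    and T: "clique_decomposition T (circuit_dag Z)"
    and ix: "inj_on ix L" "dec_labels T \<subseteq> L"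
  shows "circuit_fun Z \<alpha> \<longleftrightarrow> (\<exists>v. admissible Z \<alpha> T v \<and> unforbidden Z T v \<and>
    (\<forall>a \<in> L. \<forall>b \<in> {4, 5}. 6 * ix a + b \<notin> facts Z ix T v))"
proof -
  have V: "dec_verts T = {..<circuit_size Z}"
    and A: "dec_arcs T = {(h, g). g < circuit_size Z \<and> h \<in> set (gate_inputs (gates Z ! g))}"
    using T by (simp_all add: clique_decomposition_def circuit_dag_def)
  have out: "out_gate Z < circuit_size Z" using Z by (simp add: circuit_def)
  have noc: "gates Z ! g \<noteq> GConst b" if "g < circuit_size Z" for g b
    using cf that by (metis nth_mem constant_free_def circuit_size_def)
  \<comment> \<open>For a variable the last two clauses are vacuous and the first is the gate
    equation; for the other gates it is the reverse.\<close>
  have cond: "(\<forall>x. gates Z ! g = GVar x \<longrightarrow> v g = \<alpha> x) \<and>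
      (\<forall>h \<in> set (gate_inputs (gates Z ! g)). \<not> forbids (gates Z ! g) (v g) (v h)) \<and>
      (\<forall>c. needs (gates Z ! g) (v g) c \<longrightarrow> (\<exists>h \<in> set (gate_inputs (gates Z ! g)). v h = c))
      \<longleftrightarrow> v g = gate_fun \<alpha> v (gates Z ! g)" if "g < circuit_size Z" for g v
  proof (cases "\<exists>x. gates Z ! g = GVar x")
    case True
    then show ?thesis by auto
  next
    case False
    then show ?thesis using gate_fun_iff_local[of "gates Z ! g" "v g" \<alpha> v] noc[OF that] by auto
  qed
  have nf: "(\<forall>a \<in> L. \<forall>b \<in> {4, 5}. 6 * ix a + b \<notin> facts Z ix T v) \<longleftrightarrow>
      (\<forall>g < circuit_size Z. \<forall>c. needs (gates Z ! g) (v g) c \<longrightarrow>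
         (\<exists>h \<in> set (gate_inputs (gates Z ! g)). v h = c))" for v
  proof -
    have "(\<forall>a \<in> L. \<forall>b \<in> {4, 5}. 6 * ix a + b \<notin> facts Z ix T v) \<longleftrightarrow>
      (\<forall>u \<in> dec_verts T. 4 \<notin> vertex_facts Z T v u \<and> 5 \<notin> vertex_facts Z T v u)"
      by (simp add: facts_iff[OF ix]) (use dec_label_in[of _ T] ix(2) in blast)
    also have "\<dots> \<longleftrightarrow> (\<forall>g < circuit_size Z. \<forall>c. needs (gates Z ! g) (v g) c \<longrightarrow>
         (\<exists>h \<in> set (gate_inputs (gates Z ! g)). v h = c))"
      unfolding V A vertex_facts_iff all_bool_eq by auto
    finally show ?thesis .
  qed
  have eq: "admissible Z \<alpha> T v \<and> unforbidden Z T v \<and>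
      (\<forall>a \<in> L. \<forall>b \<in> {4, 5}. 6 * ix a + b \<notin> facts Z ix T v) \<longleftrightarrow>
      (\<forall>g < circuit_size Z. v g = gate_fun \<alpha> v (gates Z ! g)) \<and> v (out_gate Z)" for v
  proof -
    have "(\<forall>g < circuit_size Z. v g = gate_fun \<alpha> v (gates Z ! g)) \<longleftrightarrow>
      (\<forall>g < circuit_size Z. (\<forall>x. gates Z ! g = GVar x \<longrightarrow> v g = \<alpha> x) \<and>
      (\<forall>h \<in> set (gate_inputs (gates Z ! g)). \<not> forbids (gates Z ! g) (v g) (v h)) \<and>
      (\<forall>c. needs (gates Z ! g) (v g) c \<longrightarrow> (\<exists>h \<in> set (gate_inputs (gates Z ! g)). v h = c)))"
      using cond by simp
    then show ?thesis unfolding nf unfolding admissible_def unforbidden_def V A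
      using out by auto
  qed
  have ex: "\<exists>b. gate_value Z \<alpha> g b" if "g < circuit_size Z" for g
    using gate_value_total[OF Z that] .
  define w where "w g = gate_value Z \<alpha> g True" for g
  have w: "gate_value Z \<alpha> g (w g)" if "g < circuit_size Z" for g
    using ex[OF that] unfolding w_def by (metis (full_types))
  have inp: "h < circuit_size Z" if "g < circuit_size Z" "h \<in> set (gate_inputs (gates Z ! g))" for g h
    using Z that pair_wf_digraph.in_arcsD1[of "circuit_dag Z" h g]
    by (auto simp: circuit_def circuit_dag_def)
  have wf: "w g = gate_fun \<alpha> w (gates Z ! g)" if g: "g < circuit_size Z" for g
    using gate_value_unique[OF w[OF g] gate_value.intros[OF g w[OF inp[OF g]]]] .
  \<comment> \<open>Induction along the evaluation of the circuit: every solution of the gate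
    equations agrees with the computed value.\<close>
  have "v g = b" if v: "\<forall>g < circuit_size Z. v g = gate_fun \<alpha> v (gates Z ! g)"
    and gv: "gate_value Z \<alpha> g b" for v g b
    using gv
  proof (induction rule: gate_value.induct)
    case (1 g u)
    then show ?case using v gate_fun_cong[of "gates Z ! g" v u \<alpha>] by simp
  qed
  then show ?thesis unfolding eq circuit_fun_def using wf out w_def w[OF out] by (metis (full_types))
qed

section \<open>Topologically ordered DNNFs\<close>

text \<open>While the gate list grows there is no output yet; \<open>out_gate = 0\<close> is a dummy
  on which neither values nor variable sets depend.\<close>

definition gate_true :: "gate list \<Rightarrow> (nat \<Rightarrow> bool) \<Rightarrow> nat \<Rightarrow> bool" where
  "gate_true gs \<alpha> g \<longleftrightarrow> gate_value \<lparr>gates = gs, out_gate = 0\<rparr> \<alpha> g True"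

definition gate_vars :: "gate list \<Rightarrow> nat \<Rightarrow> nat set" where
  "gate_vars gs g = gate_Var \<lparr>gates = gs, out_gate = 0\<rparr> g"

definition list_vars :: "gate list \<Rightarrow> nat set" where
  "list_vars gs = {x. GVar x \<in> set gs}"

text \<open>All conditions speak of the earlier gates only, whose values and variables are not
  changed by an append. A DNNF can thus be grown one gate at a time, with the DNNF conditions
  checked once per gate.\<close>

definition appendable :: "gate list \<Rightarrow> gate \<Rightarrow> bool" where
  "appendable gs G \<longleftrightarrow>
     (\<forall>h \<in> set (gate_inputs G). h < length gs) \<and> distinct (gate_inputs G) \<and>
     G \<noteq> GAnd [] \<and> G \<noteq> GOr [] \<and>
     (\<forall>x. G = GVar x \<longrightarrow> x \<notin> list_vars gs) \<and>
     (\<forall>h. G = GNot h \<longrightarrow> (\<exists>x. gs ! h = GVar x)) \<and>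
     (\<forall>hs. G = GAnd hs \<longrightarrow> (\<forall>g1 \<in> set hs. \<forall>g2 \<in> set hs. g1 \<noteq> g2 \<longrightarrow>
        gate_vars gs g1 \<inter> gate_vars gs g2 = {}))"

inductive dnnf_list :: "gate list \<Rightarrow> bool" where
  Nil: "dnnf_list []"
| snoc: "dnnf_list gs \<Longrightarrow> appendable gs G \<Longrightarrow> dnnf_list (gs @ [G])"

lemma gate_inputs_less:
  "dnnf_list gs \<Longrightarrow> g < length gs \<Longrightarrow> h \<in> set (gate_inputs (gs ! g)) \<Longrightarrow> h < g"
proof (induction rule: dnnf_list.induct)
  case (snoc gs G)
  then show ?case by (cases "g = length gs") (auto simp: nth_append appendable_def)
qed simp

text \<open>Covers two uses: an appended suffix and, with \<open>hs = []\<close>, a different choice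
  of the output gate.\<close>

lemma gate_value_gates_cong:
  assumes "gate_value Z \<alpha> g b" "gates Z' = gates Z @ hs"
  shows "gate_value Z' \<alpha> g b"
  using assms(1)
proof (induction rule: gate_value.induct)
  case (1 g v)
  have eq: "gates Z' ! g = gates Z ! g" and less: "g < circuit_size Z'"
    using 1(1) assms(2) by (auto simp: circuit_size_def nth_append)
  have "gate_value Z' \<alpha> g (gate_fun \<alpha> v (gates Z' ! g))"
    by (rule gate_value.intros[OF less]) (use 1(3) eq in auto)
  then show ?case using eq by simp
qed

lemma gate_value_total_list:
  assumes "dnnf_list gs"
  shows "g < length gs \<Longrightarrow> gate_value \<lparr>gates = gs, out_gate = 0\<rparr> \<alpha> g (gate_true gs \<alpha> g)"
proof (induction g rule: less_induct)
  case (less g)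
  let ?Z = "\<lparr>gates = gs, out_gate = 0\<rparr>"
  have "gate_value ?Z \<alpha> g (gate_fun \<alpha> (gate_true gs \<alpha>) (gates ?Z ! g))"
    by (rule gate_value.intros)
      (use less gate_inputs_less[OF assms less.prems] in \<open>auto simp: circuit_size_def intro: less.IH less_trans\<close>)
  then show ?case unfolding gate_true_def by (metis (full_types) gate_value_unique)
qed

lemma gate_true_append:
  assumes "dnnf_list gs" "g < length gs"
  shows "gate_true (gs @ hs) \<alpha> g = gate_true gs \<alpha> g"
proof -
  have "gate_value \<lparr>gates = gs @ hs, out_gate = 0\<rparr> \<alpha> g (gate_true gs \<alpha> g)"
    by (rule gate_value_gates_cong[OF gate_value_total_list[OF assms]]) simp
  then show ?thesis unfolding gate_true_def[of "gs @ hs"]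
    by (cases "gate_true gs \<alpha> g") (auto dest: gate_value_unique)
qed

lemma gate_true_snoc:
  assumes "dnnf_list gs" "\<And>h. h \<in> set (gate_inputs G) \<Longrightarrow> h < length gs"
  shows "gate_true (gs @ [G]) \<alpha> (length gs) = gate_fun \<alpha> (gate_true gs \<alpha>) G"
proof -
  let ?Z = "\<lparr>gates = gs @ [G], out_gate = 0\<rparr>"
  have "gate_value ?Z \<alpha> (length gs) (gate_fun \<alpha> (gate_true gs \<alpha>) (gates ?Z ! length gs))"
  proof (rule gate_value.intros)
    fix h assume "h \<in> set (gate_inputs (gates ?Z ! length gs))"
    then have "h < length gs" using assms(2) by simp
    from gate_value_total_list[OF assms(1) this]
    show "gate_value ?Z \<alpha> h (gate_true gs \<alpha> h)" by (rule gate_value_gates_cong) simp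
  qed (simp add: circuit_size_def)
  then show ?thesis unfolding gate_true_def[of "gs @ [G]"]
    by (cases "gate_fun \<alpha> (gate_true gs \<alpha>) G") (auto dest: gate_value_unique)
qed

text \<open>Inputs have smaller positions, so a path ending in the prefix never leaves it when
  followed backwards.\<close>

lemma gate_path_prefix:
  assumes "dnnf_list gs" "g < length gs"
    and "(h, g) \<in> (parcs (circuit_dag \<lparr>gates = gs @ hs, out_gate = 0\<rparr>))\<^sup>*"
  shows "h < length gs \<and> (h, g) \<in> (parcs (circuit_dag \<lparr>gates = gs, out_gate = 0\<rparr>))\<^sup>*"
  using assms(3)
proof (induction rule: converse_rtrancl_induct)
  case base
  then show ?case using assms(2) by simp
next
  case (step y z)
  then have y: "y \<in> set (gate_inputs (gs ! z))" and z: "z < length gs"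
    by (auto simp: circuit_dag_def nth_append)
  then have "y < z" using gate_inputs_less[OF assms(1)] by simp
  moreover have "(y, z) \<in> parcs (circuit_dag \<lparr>gates = gs, out_gate = 0\<rparr>)"
    using y z by (simp add: circuit_dag_def circuit_size_def)
  ultimately show ?case using step.IH z by (auto intro: converse_rtrancl_into_rtrancl)
qed

lemma gate_vars_append:
  assumes "dnnf_list gs" "g < length gs"
  shows "gate_vars (gs @ hs) g = gate_vars gs g"
proof -
  have "(h, g) \<in> (parcs (circuit_dag \<lparr>gates = gs @ hs, out_gate = 0\<rparr>))\<^sup>*"
    if "(h, g) \<in> (parcs (circuit_dag \<lparr>gates = gs, out_gate = 0\<rparr>))\<^sup>*" for h
    by (rule rtrancl_mono[THEN subsetD, OF _ that])
      (auto simp: circuit_dag_def circuit_size_def nth_append)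
  moreover note gate_path_prefix[OF assms]
  ultimately show ?thesis unfolding gate_vars_def gate_Var_def circuit_size_def
    by (auto simp: nth_append intro: trans_less_add1)
qed

text \<open>An inclusion is enough: decomposability only asks for upper bounds on variable
  sets.\<close>

lemma gate_vars_snoc:
  assumes "dnnf_list gs" "\<And>h. h \<in> set (gate_inputs G) \<Longrightarrow> h < length gs"
  shows "gate_vars (gs @ [G]) (length gs) \<subseteq>
    {x. G = GVar x} \<union> (\<Union>h \<in> set (gate_inputs G). gate_vars gs h)"
proof
  fix x assume "x \<in> gate_vars (gs @ [G]) (length gs)"
  then obtain h where h: "h < length (gs @ [G])" "(gs @ [G]) ! h = GVar x"
    and p: "(h, length gs) \<in> (parcs (circuit_dag \<lparr>gates = gs @ [G], out_gate = 0\<rparr>))\<^sup>*"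
    by (auto simp: gate_vars_def gate_Var_def circuit_size_def)
  from p show "x \<in> {x. G = GVar x} \<union> (\<Union>h \<in> set (gate_inputs G). gate_vars gs h)"
  proof (cases rule: rtranclE)
    case base
    then show ?thesis using h by simp
  next
    case (step y)
    then have y: "y \<in> set (gate_inputs G)" by (simp add: circuit_dag_def)
    from gate_path_prefix[OF assms(1) assms(2)[OF y] step(1)]
    have "x \<in> gate_vars gs y" using h
      by (auto simp: gate_vars_def gate_Var_def circuit_size_def nth_append)
    then show ?thesis using y by blast
  qed
qed

lemma list_vars_snoc: "list_vars (gs @ [G]) = list_vars gs \<union> {x. G = GVar x}"
  by (auto simp: list_vars_def)

lemma dnnf_list_imp_dnnf:
  assumes gs: "dnnf_list gs" and out: "o' < length gs"
  shows "dnnf \<lparr>gates = gs, out_gate = o'\<rparr>"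
proof -
  let ?D = "\<lparr>gates = gs, out_gate = o'\<rparr>"
  have "parcs (circuit_dag ?D) \<subseteq> less_than"
    using gate_inputs_less[OF gs] by (auto simp: circuit_dag_def circuit_size_def)
  then have ac: "acyclic (parcs (circuit_dag ?D))"
    using wf_acyclic[OF wf_less_than] acyclic_subset by blast
  have wfd: "pair_wf_digraph (circuit_dag ?D)"
  proof
    fix e assume "e \<in> parcs (circuit_dag ?D)"
    then have "snd e < length gs" "fst e < snd e"
      using gate_inputs_less[OF gs] by (auto simp: circuit_dag_def circuit_size_def)
    then show "fst e \<in> pverts (circuit_dag ?D)" "snd e \<in> pverts (circuit_dag ?D)"
      by (simp_all add: circuit_dag_def circuit_size_def)
  qed
  have basic: "(\<forall>G \<in> set gs. distinct (gate_inputs G)) \<and> GAnd [] \<notin> set gs \<and> GOr [] \<notin> set gs"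
    using gs by (induction rule: dnnf_list.induct) (auto simp: appendable_def)
  have uniq: "\<forall>g < length gs. \<forall>h < length gs. \<forall>x. gs ! g = GVar x \<and> gs ! h = GVar x \<longrightarrow> g = h"
    using gs
  proof (induction rule: dnnf_list.induct)
    case (snoc gs G)
    have "GVar x \<notin> set gs" if "G = GVar x" for x
      using snoc(2) that by (simp add: appendable_def list_vars_def)
    then have "gs ! g \<noteq> GVar x" if "G = GVar x" "g < length gs" for x g
      using that nth_mem[of g gs] by metis
    then show ?case using snoc.IH by (auto simp: nth_append less_Suc_eq)
  qed simp
  \<comment> \<open>Carrying \<open>h < length gs\<close> along makes \<open>gs ! h\<close> stable
    under the appends of the induction.\<close>
  have dm: "\<forall>h. GNot h \<in> set gs \<longrightarrow> h < length gs \<and> (\<exists>x. gs ! h = GVar x)"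
    using gs
  proof (induction rule: dnnf_list.induct)
    case (snoc gs G)
    then show ?case by (auto simp: appendable_def nth_append)
  qed simp
  have dec: "\<forall>hs. GAnd hs \<in> set gs \<longrightarrow> (\<forall>h \<in> set hs. h < length gs) \<and>
      (\<forall>g1 \<in> set hs. \<forall>g2 \<in> set hs. g1 \<noteq> g2 \<longrightarrow> gate_vars gs g1 \<inter> gate_vars gs g2 = {})"
    using gs
  proof (induction rule: dnnf_list.induct)
    case (snoc gs G)
    have "(\<forall>h \<in> set hs. h < length gs) \<and>
      (\<forall>g1 \<in> set hs. \<forall>g2 \<in> set hs. g1 \<noteq> g2 \<longrightarrow> gate_vars gs g1 \<inter> gate_vars gs g2 = {})"
      if "GAnd hs \<in> set (gs @ [G])" for hs
    proof (cases "GAnd hs \<in> set gs")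
      case True
      then show ?thesis using snoc.IH by simp
    next
      case False
      then have "G = GAnd hs" using that by simp
      then show ?thesis using snoc(2) by (simp add: appendable_def)
    qed
    then show ?case using gate_vars_append[OF snoc(1)] by (simp add: less_SucI)
  qed simp
  show ?thesis unfolding dnnf_def circuit_def de_morgan_def decomposable_def
    using ac wfd basic uniq dm dec out
    by (simp add: circuit_size_def gate_vars_def gate_Var_def circuit_dag_def)
qed

lemma circuit_fun_list:
  "circuit_fun \<lparr>gates = gs, out_gate = o'\<rparr> \<alpha> = gate_true gs \<alpha> o'"
  unfolding circuit_fun_def gate_true_def
  using gate_value_gates_cong[where hs = "[]"] by (metis append_Nil2 circuit.select_convs)

section \<open>Numbers as sets of positions\<close>

definition bits :: "nat \<Rightarrow> nat set" where
  "bits x = {p. bit x p}"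

lemma bits_inject: "bits x = bits y \<longleftrightarrow> x = y"
  by (auto simp: bits_def bit_eq_iff)

lemma bits_or: "bits (Bit_Operations.or x y) = bits x \<union> bits y"
  by (auto simp: bits_def bit_or_iff)

lemma bits_0: "bits 0 = {}"
  by (simp add: bits_def)

lemma bits_exp: "bits (2 ^ p) = {p}"
  by (auto simp: bits_def bit_exp_iff)

text \<open>Without a common bit there is no carry.\<close>

lemma bits_add_disjoint:
  assumes "bits x \<inter> bits y = {}"
  shows "x + y = Bit_Operations.or x y"
  by (rule disjunctive_add_eq_or) (use assms in \<open>auto simp: bits_def bit_eq_iff bit_and_iff\<close>)

text \<open>Because \<open>x + y\<close> is the sum of the bitwise disjunction and the bitwise
  conjunction. This gives the machine a test for disjointness, used to find the states without open
  needs.\<close>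

lemma or_eq_add_iff: "Bit_Operations.or x y = x + y \<longleftrightarrow> bits x \<inter> bits y = {}" for x y :: nat
proof
  assume "Bit_Operations.or x y = x + y"
  then have "int (Bit_Operations.or x y) = int x + int y" by simp
  then have "Bit_Operations.or (int x) (int y) = int x + int y" by (simp add: of_nat_or_eq)
  then have "Bit_Operations.and (int x) (int y) = 0" using plus_and_or[of "int x" "int y"] by simp
  then have "Bit_Operations.and x y = 0" by (simp flip: of_nat_and_eq)
  then show "bits x \<inter> bits y = {}" by (auto simp: bits_def bit_eq_iff bit_and_iff)
qed (simp add: bits_add_disjoint)

lemma bits_minus_exp:
  assumes "p \<in> bits x"
  shows "bits (x - 2 ^ p) = bits x - {p}"
proof -
  have u: "bits (unset_bit p x) = bits x - {p}"
    by (auto simp: bits_def bit_unset_bit_iff)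
  have "unset_bit p x + 2 ^ p = Bit_Operations.or (unset_bit p x) (2 ^ p)"
    by (rule bits_add_disjoint) (simp add: u bits_exp)
  also have "\<dots> = x"
    using assms by (simp flip: bits_inject add: bits_or u bits_exp insert_absorb)
  finally show ?thesis using u by (metis add_diff_cancel_right')
qed

text \<open>The membership test of the machine: joining a power of two changes nothing exactly if
  its bit is present.\<close>

lemma or_exp_eq_iff: "Bit_Operations.or x (2 ^ p) = x \<longleftrightarrow> p \<in> bits x"
  unfolding bits_inject[symmetric] bits_or bits_exp by auto

text \<open>The machine compares by truncated subtraction: a disjunction different from
  \<open>x\<close> must exceed \<open>x\<close> in order to show up as a nonzero difference.\<close>

lemma or_ge: "x \<le> Bit_Operations.or x y" for x y :: nat
proof -
  have d: "bits x \<inter> (bits y - bits x) = {}" by auto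
  \<comment> \<open>The bits of \<open>y\<close> missing in \<open>x\<close>, written with xor since
    a complement is not a natural number.\<close>
  let ?z = "Bit_Operations.and y (Bit_Operations.xor x (Bit_Operations.or x y))"
  have "bits ?z = bits y - bits x"
    by (auto simp: bits_def bit_and_iff bit_xor_iff bit_or_iff)
  then have "x + ?z = Bit_Operations.or x ?z" and "bits (Bit_Operations.or x ?z) = bits (Bit_Operations.or x y)"
    using d by (simp_all add: bits_add_disjoint bits_or)
  then have "x + ?z = Bit_Operations.or x y" unfolding bits_inject by simp
  then show ?thesis by linarith
qed

lemma or_less_exp: "x < 2 ^ n \<Longrightarrow> y < 2 ^ n \<Longrightarrow> Bit_Operations.or x y < 2 ^ n" for x y :: nat
  by (simp flip: take_bit_nat_eq_self_iff)

lemma less_exp_iff_bits: "x < 2 ^ n \<longleftrightarrow> bits x \<subseteq> {..<n}"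
proof
  assume "x < 2 ^ n"
  then have "take_bit n x = x" by (simp add: take_bit_nat_eq_self_iff)
  then show "bits x \<subseteq> {..<n}" unfolding bits_def by (metis (lifting) bit_take_bit_iff lessThan_iff mem_Collect_eq subsetI)
next
  assume "bits x \<subseteq> {..<n}"
  then have "take_bit n x = x" by (auto simp: bits_def bit_eq_iff bit_take_bit_iff)
  then show "x < 2 ^ n" by (simp add: take_bit_nat_eq_self_iff)
qed

lemma top_bit_iff: "x < 2 ^ Suc n \<Longrightarrow> n \<in> bits x \<longleftrightarrow> 2 ^ n \<le> x"
proof
  assume x: "x < 2 ^ Suc n" and "2 ^ n \<le> x"
  then have "\<not> bits x \<subseteq> {..<n}" "bits x \<subseteq> {..<Suc n}"
    by (simp_all flip: less_exp_iff_bits)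
  then show "n \<in> bits x" by (auto simp: less_Suc_eq)
next
  assume "n \<in> bits x"
  then have "\<not> x < 2 ^ n" by (auto simp: less_exp_iff_bits)
  then show "2 ^ n \<le> x" by simp
qed

text \<open>One round of \<open>or_prog\<close>: below \<open>2 ^ Suc n\<close> the bit
  \<open>n\<close> is read off by a comparison and removed by a subtraction, and it enters the
  result if either number has it.\<close>

lemma or_top_bit:
  fixes x y :: nat
  assumes "x < 2 ^ Suc n" "y < 2 ^ Suc n"
  shows "(if 2 ^ n \<le> x \<or> 2 ^ n \<le> y then 2 ^ n else 0) +
    Bit_Operations.or (if 2 ^ n \<le> x then x - 2 ^ n else x) (if 2 ^ n \<le> y then y - 2 ^ n else y) =
    Bit_Operations.or x y" (is "?t + Bit_Operations.or ?x ?y = _")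
proof -
  have r: "bits (if 2 ^ n \<le> z then z - 2 ^ n else z) = bits z - {n}" if "z < 2 ^ Suc n" for z
    using top_bit_iff[OF that] by (auto simp: bits_minus_exp)
  have t: "bits ?t = (bits x \<union> bits y) \<inter> {n}"
    using top_bit_iff[OF assms(1)] top_bit_iff[OF assms(2)] by (auto simp: bits_exp bits_0)
  have "?t + Bit_Operations.or ?x ?y = Bit_Operations.or ?t (Bit_Operations.or ?x ?y)"
    by (rule bits_add_disjoint) (auto simp only: bits_or r[OF assms(1)] r[OF assms(2)] t)
  also have "\<dots> = Bit_Operations.or x y"
    unfolding bits_inject[symmetric] bits_or r[OF assms(1)] r[OF assms(2)] t by auto
  finally show ?thesis .
qed

section \<open>A calculus for programs\<close>

text \<open>Total correctness, with the elapsed time handed to the postcondition. As programs are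
  deterministic, the rules for the constructors without loops are equivalences and can be used for
  rewriting.\<close>

definition wp :: "prog \<Rightarrow> memory \<Rightarrow> (nat \<Rightarrow> memory \<Rightarrow> bool) \<Rightarrow> bool" where
  "wp c s Q \<longleftrightarrow> (\<exists>n t. exec c s n t \<and> Q n t)"

lemma wp_exec: "exec c s n t \<Longrightarrow> wp c s Q \<longleftrightarrow> Q n t"
  unfolding wp_def by (auto dest: exec_deterministic)

lemma wp_Skip: "wp Skip s Q \<longleftrightarrow> Q 1 s"
  by (rule wp_exec) (rule exec_Skip)

lemma wp_Store: "wp (Store a e f) s Q \<longleftrightarrow>
    Q (expr_cost e + expr_cost f + 1) (s(a := (s a)(expr_val e s := expr_val f s)))"
  by (rule wp_exec) (rule exec_Store)

lemma wp_Seq: "wp (Seq c d) s Q \<longleftrightarrow> wp c s (\<lambda>m t. wp d t (\<lambda>n u. Q (m + n) u))" (is "?l \<longleftrightarrow> ?r")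
proof
  assume ?l
  then obtain n t where e: "exec (Seq c d) s n t" "Q n t" unfolding wp_def by blast
  from e(1) obtain m1 n1 t1 where
    "n = m1 + n1" "exec c s m1 t1" "exec d t1 n1 t" by (rule exec_SeqE)
  then show ?r using e(2) unfolding wp_def by blast
next
  assume ?r
  then show ?l unfolding wp_def by (blast intro: exec_Seq)
qed

lemma wp_Cond: "wp (Cond e c d) s Q \<longleftrightarrow>
    (if expr_val e s \<noteq> 0 then wp c s (\<lambda>n. Q (expr_cost e + 1 + n))
     else wp d s (\<lambda>n. Q (expr_cost e + 1 + n)))" (is "?l \<longleftrightarrow> ?r")
proof
  assume ?l
  then obtain n t where e: "exec (Cond e c d) s n t" "Q n t" unfolding wp_def by blast
  from e(1) show ?r by (rule exec_CondE) (use e(2) in \<open>auto simp: wp_def\<close>)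
next
  assume r: ?r
  show ?l
  proof (cases "expr_val e s = 0")
    case True
    with r obtain n t where "exec d s n t" "Q (expr_cost e + 1 + n) t" by (auto simp: wp_def)
    then show ?thesis unfolding wp_def using exec_CondF[OF True] by blast
  next
    case False
    with r obtain n t where "exec c s n t" "Q (expr_cost e + 1 + n) t" by (auto simp: wp_def)
    then show ?thesis unfolding wp_def using exec_CondT[OF False] by blast
  qed
qed

lemma wp_mono: "wp c s P \<Longrightarrow> (\<And>n t. P n t \<Longrightarrow> Q n t) \<Longrightarrow> wp c s Q"
  unfolding wp_def by auto

lemmas wp_simps = wp_Skip wp_Store wp_Seq wp_Cond

text \<open>Exactly \<open>n\<close> rounds of a loop, without the final test. Rounds can be
  concatenated (\<open>wp_rounds_add\<close>), so that the recursion over the decomposition can be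
  matched with consecutive stretches of a single flat loop over the postorder.\<close>

fun wp_rounds :: "nat \<Rightarrow> expr \<Rightarrow> prog \<Rightarrow> memory \<Rightarrow> (nat \<Rightarrow> memory \<Rightarrow> bool) \<Rightarrow> bool" where
  "wp_rounds 0 e c s Q \<longleftrightarrow> Q 0 s"
| "wp_rounds (Suc n) e c s Q \<longleftrightarrow> expr_val e s \<noteq> 0 \<and>
     wp c s (\<lambda>m t. wp_rounds n e c t (\<lambda>m'. Q (expr_cost e + 1 + m + m')))"

lemma wp_rounds_mono:
  "wp_rounds n e c s P \<Longrightarrow> (\<And>m t. P m t \<Longrightarrow> Q m t) \<Longrightarrow> wp_rounds n e c s Q"
proof (induction n arbitrary: s P Q)
  case (Suc n)
  from Suc.prems(1) have "wp c s (\<lambda>m t. wp_rounds n e c t (\<lambda>m'. P (expr_cost e + 1 + m + m')))" by simp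
  then have "wp c s (\<lambda>m t. wp_rounds n e c t (\<lambda>m'. Q (expr_cost e + 1 + m + m')))"
    by (rule wp_mono) (erule Suc.IH, erule Suc.prems(2))
  then show ?case using Suc.prems(1) by simp
qed simp

lemma wp_rounds_add:
  "wp_rounds (m + n) e c s Q \<longleftrightarrow> wp_rounds m e c s (\<lambda>i t. wp_rounds n e c t (\<lambda>j. Q (i + j)))"
proof (induction m arbitrary: s Q)
  case (Suc m)
  then show ?case by (simp add: add.assoc)
qed simp

lemma wp_While_rounds:
  "wp_rounds n e c s (\<lambda>m t. expr_val e t = 0 \<and> Q (m + (expr_cost e + 1)) t) \<Longrightarrow> wp (While e c) s Q"
proof (induction n arbitrary: s Q)
  case 0
  then have "expr_val e s = 0" "Q (expr_cost e + 1) s" by simp_all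
  then show ?case unfolding wp_def using exec_WhileF by blast
next
  case (Suc n)
  then obtain m t where e: "expr_val e s \<noteq> 0" "exec c s m t"
    and r: "wp_rounds n e c t (\<lambda>m' t. expr_val e t = 0 \<and> Q (expr_cost e + 1 + m + m' + (expr_cost e + 1)) t)"
    by (auto simp: wp_def)
  have "wp (While e c) t (\<lambda>m'. Q (expr_cost e + 1 + m + m'))"
    by (rule Suc.IH) (use r in \<open>simp add: add.assoc\<close>)
  then show ?case using e exec_WhileT unfolding wp_def by blast
qed

lemma wp_While_count:
  assumes init: "I 0 s"
    and step: "\<And>i s. i < k \<Longrightarrow> I i s \<Longrightarrow> expr_val e s \<noteq> 0 \<and>
      wp c s (\<lambda>n t. n + expr_cost e + 1 \<le> C \<and> I (Suc i) t)"
    and exit: "\<And>s. I k s \<Longrightarrow> expr_val e s = 0"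
    and Q: "\<And>n t. n \<le> k * C + expr_cost e + 1 \<Longrightarrow> I k t \<Longrightarrow> Q n t"
  shows "wp (While e c) s Q"
proof -
  have *: "wp_rounds j e c s (\<lambda>m t. m \<le> j * C \<and> I (i + j) t)" if "I i s" "i + j \<le> k" for i j s
    using that
  proof (induction j arbitrary: i s)
    case (Suc j)
    from step[of i s] Suc.prems have e: "expr_val e s \<noteq> 0"
      and w: "wp c s (\<lambda>n t. n + expr_cost e + 1 \<le> C \<and> I (Suc i) t)" by auto
    have "wp c s (\<lambda>m t. wp_rounds j e c t (\<lambda>m' t. expr_cost e + 1 + m + m' \<le> Suc j * C \<and> I (i + Suc j) t))"
      using w
    proof (rule wp_mono)
      fix n t assume nt: "n + expr_cost e + 1 \<le> C \<and> I (Suc i) t"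
      then have "wp_rounds j e c t (\<lambda>m t. m \<le> j * C \<and> I (Suc i + j) t)"
        using Suc.prems by (intro Suc.IH) auto
      then show "wp_rounds j e c t (\<lambda>m' t. expr_cost e + 1 + n + m' \<le> Suc j * C \<and> I (i + Suc j) t)"
        by (rule wp_rounds_mono) (use nt in auto)
    qed
    then show ?case using e by simp
  qed simp
  have "wp_rounds k e c s (\<lambda>m t. m \<le> k * C \<and> I k t)" using *[OF init, of k] by simp
  then have "wp_rounds k e c s (\<lambda>m t. expr_val e t = 0 \<and> Q (m + (expr_cost e + 1)) t)"
    by (rule wp_rounds_mono) (auto intro!: Q exit)
  then show ?thesis by (rule wp_While_rounds)
qed

section \<open>Bitwise disjunction on the machine\<close>

text \<open>
  Scalars are cells of one array. Cells below 8 are scratch. Of the others, cell 8 holds the number \<open>B\<close>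
  of bits of a state, cell 9 the number \<open>N = 2 ^ B\<close> of states, cell 10 the stack pointer, cell 11 the
  current node of the decomposition, cell 14 the mask of all needs.
\<close>

abbreviation regs :: array where "regs \<equiv> (''W'', ''r'')"
abbreviation powers :: array where "powers \<equiv> (''W'', ''p'')"
abbreviation label_mask :: array where "label_mask \<equiv> (''W'', ''l'')"
abbreviation src_mask :: array where "src_mask \<equiv> (''W'', ''i'')"
abbreviation dst_mask :: array where "dst_mask \<equiv> (''W'', ''j'')"
abbreviation stack_gate :: array where "stack_gate \<equiv> (''W'', ''g'')"
abbreviation stack_state :: array where "stack_state \<equiv> (''W'', ''s'')"
abbreviation accum :: array where "accum \<equiv> (''W'', ''a'')"

abbreviation reg :: "nat \<Rightarrow> expr" where "reg i \<equiv> Load regs (Num i)"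
abbreviation set_reg :: "nat \<Rightarrow> expr \<Rightarrow> prog" where "set_reg i \<equiv> Store regs (Num i)"
abbreviation seq (infixr ";;" 60) where "c ;; d \<equiv> Seq c d"

text \<open>Nonzero exactly if the value of \<open>f\<close> is at most that of \<open>e\<close>,
  subtraction being truncated; the added 1 covers equality.\<close>

abbreviation at_least :: "expr \<Rightarrow> expr \<Rightarrow> expr" where
  "at_least e f \<equiv> Minus (Plus e (Num 1)) f"

text \<open>Works from the top bit downwards, since the machine can compare and subtract but neither
  shift nor halve. Cells 2 and 3 hold what is left of the operands, cell 5 the result; a sum of two
  tests acts as their disjunction. Cells 0 and 1 are left alone for the callers.\<close>

definition or_prog :: prog where
  "or_prog =
     set_reg 5 (Num 0) ;; set_reg 4 (reg 8) ;;
     While (reg 4)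
       (set_reg 4 (Minus (reg 4) (Num 1)) ;;
        set_reg 6 (Load powers (reg 4)) ;;
        Cond (Plus (at_least (reg 2) (reg 6)) (at_least (reg 3) (reg 6)))
          (set_reg 5 (Plus (reg 5) (reg 6))) Skip ;;
        Cond (at_least (reg 2) (reg 6)) (set_reg 2 (Minus (reg 2) (reg 6))) Skip ;;
        Cond (at_least (reg 3) (reg 6)) (set_reg 3 (Minus (reg 3) (reg 6))) Skip)"

definition frame :: "memory \<Rightarrow> memory \<Rightarrow> bool" where
  "frame s t \<longleftrightarrow> (\<forall>a. a \<noteq> regs \<longrightarrow> t a = s a) \<and> (\<forall>i\<ge>8. t regs i = s regs i)"

lemma frame_refl: "frame s s"
  by (simp add: frame_def)

lemma frame_array: "frame s t \<Longrightarrow> a \<noteq> regs \<Longrightarrow> t a = s a"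
  unfolding frame_def by blast

definition powers_ready :: "memory \<Rightarrow> bool" where
  "powers_ready s \<longleftrightarrow> (\<forall>l < s regs 8. s powers l = 2 ^ l)"

lemma powers_ready_frame: "frame s t \<Longrightarrow> powers_ready s \<Longrightarrow> powers_ready t"
  by (auto simp: frame_def powers_ready_def)

lemma wp_or_prog:
  assumes pr: "powers_ready s" and x: "s regs 2 < 2 ^ s regs 8" and y: "s regs 3 < 2 ^ s regs 8"
    and Q: "\<And>n t. n \<le> 71 * s regs 8 + 12 \<Longrightarrow> frame s t \<Longrightarrow> t regs 0 = s regs 0 \<Longrightarrow> t regs 1 = s regs 1 \<Longrightarrow>
      t regs 5 = Bit_Operations.or (s regs 2) (s regs 3) \<Longrightarrow> Q n t"
  shows "wp or_prog s Q"
proof -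
  define B where "B = s regs 8"
  \<comment> \<open>Result so far plus disjunction of the remainders is constant; at the end the
    remainders are below \<open>2 ^ 0\<close>, hence 0.\<close>
  define I where "I i t \<longleftrightarrow> frame s t \<and> t regs 0 = s regs 0 \<and> t regs 1 = s regs 1 \<and>
    t regs 4 = B - i \<and> t regs 2 < 2 ^ (B - i) \<and> t regs 3 < 2 ^ (B - i) \<and>
    t regs 5 + Bit_Operations.or (t regs 2) (t regs 3) = Bit_Operations.or (s regs 2) (s regs 3)" for i t
  let ?s = "(s(regs := (s regs)(5 := 0, 4 := B)))"
  let ?b = "set_reg 4 (Minus (reg 4) (Num 1)) ;;
        set_reg 6 (Load powers (reg 4)) ;;
        Cond (Plus (at_least (reg 2) (reg 6)) (at_least (reg 3) (reg 6)))
          (set_reg 5 (Plus (reg 5) (reg 6))) Skip ;;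
        Cond (at_least (reg 2) (reg 6)) (set_reg 2 (Minus (reg 2) (reg 6))) Skip ;;
        Cond (at_least (reg 3) (reg 6)) (set_reg 3 (Minus (reg 3) (reg 6))) Skip"
  have step: "expr_val (reg 4) t \<noteq> 0 \<and>
      wp ?b t (\<lambda>n u. n + expr_cost (reg 4) + 1 \<le> 71 \<and> I (Suc i) u)" if i: "i < B" and I: "I i t" for i t
  proof -
    obtain l where l: "B - i = Suc l" "B - Suc i = l" "l < B" using i by (intro that[of "B - Suc i"]) auto
    have fr: "frame s t" and t: "t regs 0 = s regs 0" "t regs 1 = s regs 1" "t regs 4 = Suc l"
      "t regs 2 < 2 ^ Suc l" "t regs 3 < 2 ^ Suc l"
      "t regs 5 + Bit_Operations.or (t regs 2) (t regs 3) = Bit_Operations.or (s regs 2) (s regs 3)"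
      using I unfolding I_def l by simp_all
    have p: "t powers l = 2 ^ l"
      using pr fr l(3) by (simp add: powers_ready_def frame_def B_def)
    have less: "a < 2 ^ Suc l \<Longrightarrow> 2 ^ l \<le> a \<Longrightarrow> a - 2 ^ l < 2 ^ l" for a :: nat by simp
    note o = or_top_bit[OF t(4,5)]
    show ?thesis
      using t fr p less[OF t(4)] less[OF t(5)] o unfolding I_def l
      by (simp add: wp_simps frame_def not_le Suc_diff_le split: if_splits)
  qed
  have init: "I 0 ?s" using x y by (simp add: I_def frame_def B_def)
  have exit: "expr_val (reg 4) t = 0" if "I B t" for t using that by (simp add: I_def)
  have fin: "Q (expr_cost (Num 5) + expr_cost (Num 0) + 1 + (expr_cost (Num 4) + expr_cost (reg 8) + 1 + n)) t"
    if "n \<le> B * 71 + expr_cost (reg 4) + 1" "I B t" for n t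
    by (rule Q) (use that in \<open>auto simp: I_def B_def\<close>)
  show ?thesis unfolding or_prog_def wp_Seq wp_Store
    by (rule wp_While_count[where I = I and k = B and C = 71, OF _ step exit fin])
      (use init in \<open>simp_all add: B_def\<close>)
qed

text \<open>Meant for an \<open>e\<close> that is a power of two. The difference of cells 5 and 0
  vanishes exactly if the bit is present, hence \<open>Skip\<close> stands in the first
  branch.\<close>

abbreviation if_bit :: "expr \<Rightarrow> prog \<Rightarrow> prog" where
  "if_bit e c \<equiv> set_reg 2 (reg 0) ;; set_reg 3 e ;; or_prog ;; Cond (Minus (reg 5) (reg 0)) Skip c"

text \<open>Cell 0 carries the state of an entry and cell 1 its gate. The new state is a function of
  the old state alone; the gate may be replaced depending on both. The reference memory
  \<open>s0\<close> fixes the masks and powers, which scratch work leaves intact.\<close>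

definition implements :: "memory \<Rightarrow> prog \<Rightarrow> nat \<Rightarrow> (nat \<Rightarrow> nat) \<Rightarrow> (nat \<Rightarrow> nat \<Rightarrow> nat) \<Rightarrow> bool" where
  "implements s0 c n f k \<longleftrightarrow> (\<forall>s x g. frame s0 s \<and> s regs 0 = x \<and> s regs 1 = g \<and> x < 2 ^ s0 regs 8 \<longrightarrow>
     wp c s (\<lambda>m t. m \<le> n \<and> frame s0 t \<and> t regs 0 = f x \<and> t regs 1 = k x g \<and> f x < 2 ^ s0 regs 8))"

lemma implements_cost_mono: "implements s0 c m f k \<Longrightarrow> m \<le> n \<Longrightarrow> implements s0 c n f k"
  unfolding implements_def by (blast intro: wp_mono order_trans)

lemma implements_Skip: "implements s0 Skip 1 (\<lambda>x. x) (\<lambda>x g. g)"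
  by (simp add: implements_def wp_simps)

lemma implements_Seq:
  assumes c: "implements s0 c m f k" and d: "implements s0 d n f' k'"
  shows "implements s0 (c ;; d) (m + n) (\<lambda>x. f' (f x)) (\<lambda>x g. k' (f x) (k x g))"
  unfolding implements_def wp_Seq
proof (intro allI impI, elim conjE)
  fix s x g assume s: "frame s0 s" "s regs 0 = x" "s regs 1 = g" "x < 2 ^ s0 regs 8"
  show "wp c s (\<lambda>m'. \<lambda>t. wp d t (\<lambda>n' u. m' + n' \<le> m + n \<and> frame s0 u \<and>
    u regs 0 = f' (f x) \<and> u regs 1 = k' (f x) (k x g) \<and> f' (f x) < 2 ^ s0 regs 8))"
  proof (rule wp_mono)
    show "wp c s (\<lambda>m' t. m' \<le> m \<and> frame s0 t \<and> t regs 0 = f x \<and> t regs 1 = k x g \<and> f x < 2 ^ s0 regs 8)"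
      using c s unfolding implements_def by blast
  next
    fix m' t assume t: "m' \<le> m \<and> frame s0 t \<and> t regs 0 = f x \<and> t regs 1 = k x g \<and> f x < 2 ^ s0 regs 8"
    then have "wp d t (\<lambda>n' u. n' \<le> n \<and> frame s0 u \<and> u regs 0 = f' (f x) \<and>
        u regs 1 = k' (f x) (k x g) \<and> f' (f x) < 2 ^ s0 regs 8)"
      using d unfolding implements_def by blast
    then show "wp d t (\<lambda>n' u. m' + n' \<le> m + n \<and> frame s0 u \<and>
      u regs 0 = f' (f x) \<and> u regs 1 = k' (f x) (k x g) \<and> f' (f x) < 2 ^ s0 regs 8)"
      by (rule wp_mono) (use t in auto)
  qed
qed

text \<open>One \<open>or_prog\<close> for states of \<open>s regs 8\<close> bits, with a margin for
  moving the operands and for the test around it.\<close>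

definition or_cost :: "memory \<Rightarrow> nat" where
  "or_cost s = 71 * s regs 8 + 30"

lemma implements_if_bit:
  assumes pr: "powers_ready s0" and a: "a \<noteq> regs" "s0 a i = 2 ^ p" and p: "p < s0 regs 8"
    and c: "implements s0 c n f k"
  shows "implements s0 (if_bit (Load a (Num i)) c) (or_cost s0 + n)
    (\<lambda>x. if p \<in> bits x then f x else x) (\<lambda>x g. if p \<in> bits x then k x g else g)"
  unfolding implements_def
proof (intro allI impI, elim conjE)
  fix s x g assume s: "frame s0 s" "s regs 0 = x" "s regs 1 = g" "x < 2 ^ s0 regs 8"
  let ?P = "\<lambda>m t. m \<le> or_cost s0 + n \<and> frame s0 t \<and>
    t regs 0 = (if p \<in> bits x then f x else x) \<and> t regs 1 = (if p \<in> bits x then k x g else g) \<and>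
    (if p \<in> bits x then f x else x) < 2 ^ s0 regs 8"
  let ?s = "s(regs := (s regs)(2 := x, 3 := 2 ^ p))"
  have sa: "s a i = 2 ^ p" using a frame_array[OF s(1)] by simp
  have fr: "frame s0 ?s" using s(1) by (auto simp: frame_def)
  have "wp or_prog ?s (\<lambda>m t. m \<le> 71 * s0 regs 8 + 12 \<and> frame s0 t \<and> t regs 0 = x \<and> t regs 1 = g \<and>
      t regs 5 = Bit_Operations.or x (2 ^ p))"
  proof (rule wp_or_prog)
    show "powers_ready ?s" by (rule powers_ready_frame[OF fr pr])
    show "?s regs 2 < 2 ^ ?s regs 8" "?s regs 3 < 2 ^ ?s regs 8"
      using s p by (auto simp: frame_def)
  qed (use s fr in \<open>auto simp: frame_def\<close>)
  then have "wp or_prog ?s (\<lambda>m t. wp (Cond (Minus (reg 5) (reg 0)) Skip c) t (\<lambda>m'. ?P (4 + (4 + (m + m')))))"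
  proof (rule wp_mono, elim conjE)
    fix m t assume t: "m \<le> 71 * s0 regs 8 + 12" "frame s0 t" "t regs 0 = x" "t regs 1 = g"
      "t regs 5 = Bit_Operations.or x (2 ^ p)"
    show "wp (Cond (Minus (reg 5) (reg 0)) Skip c) t (\<lambda>m'. ?P (4 + (4 + (m + m'))))"
    proof (cases "p \<in> bits x")
      case True
      then have or: "Bit_Operations.or x (2 ^ p) = x" by (simp add: or_exp_eq_iff)
      have "wp c t (\<lambda>m t. m \<le> n \<and> frame s0 t \<and> t regs 0 = f x \<and> t regs 1 = k x g \<and> f x < 2 ^ s0 regs 8)"
        using c t s(4) unfolding implements_def by blast
      then show ?thesis unfolding wp_Cond using True t or
        by (simp del: One_nat_def) (erule wp_mono, auto simp: or_cost_def)
    next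
      case False
      then have "Bit_Operations.or x (2 ^ p) - x \<noteq> 0"
        using or_exp_eq_iff[of x p] or_ge[of x "2 ^ p"] by simp
      then show ?thesis unfolding wp_Cond wp_Skip using False t s(4) by (simp add: or_cost_def)
    qed
  qed
  then show "wp (if_bit (Load a (Num i)) c) s ?P"
    unfolding wp_Seq wp_Store using sa s(2) a by (simp del: One_nat_def split del: if_split)
qed

text \<open>Rejection redirects the entry to gate 0, the constant false, and leaves its state
  alone.\<close>

lemma implements_kill: "implements s0 (set_reg 1 (Num 0)) 3 (\<lambda>x. x) (\<lambda>x g. 0)"
  by (auto simp: implements_def wp_simps frame_def)

lemma implements_minus:
  assumes a: "a \<noteq> regs" "s0 a i = 2 ^ p"
  shows "implements s0 (set_reg 0 (Minus (reg 0) (Load a (Num i)))) 10 (\<lambda>x. x - 2 ^ p) (\<lambda>x g. g)"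
  unfolding implements_def
proof (intro allI impI, elim conjE)
  fix s x g assume s: "frame s0 s" "s regs 0 = x" "s regs 1 = g" "x < 2 ^ s0 regs 8"
  have "s a i = 2 ^ p" using a frame_array[OF s(1)] by simp
  then show "wp (set_reg 0 (Minus (reg 0) (Load a (Num i)))) s (\<lambda>m t. m \<le> 10 \<and> frame s0 t \<and>
      t regs 0 = x - 2 ^ p \<and> t regs 1 = g \<and> x - 2 ^ p < 2 ^ s0 regs 8)"
    using s by (auto simp: wp_simps frame_def less_imp_diff_less)
qed

lemma implements_or:
  assumes pr: "powers_ready s0" and a: "a \<noteq> regs" "s0 a i = 2 ^ p" and p: "p < s0 regs 8"
  shows "implements s0 (set_reg 2 (reg 0) ;; set_reg 3 (Load a (Num i)) ;; or_prog ;; set_reg 0 (reg 5))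
    (or_cost s0) (\<lambda>x. Bit_Operations.or x (2 ^ p)) (\<lambda>x g. g)"
  unfolding implements_def
proof (intro allI impI, elim conjE)
  fix s x g assume s: "frame s0 s" "s regs 0 = x" "s regs 1 = g" "x < 2 ^ s0 regs 8"
  let ?s = "s(regs := (s regs)(2 := x, 3 := 2 ^ p))"
  have sa: "s a i = 2 ^ p" using a frame_array[OF s(1)] by simp
  have fr: "frame s0 ?s" using s(1) by (auto simp: frame_def)
  have less: "Bit_Operations.or x (2 ^ p) < 2 ^ s0 regs 8" using s(4) p by (intro or_less_exp) simp_all
  have "wp or_prog ?s (\<lambda>m t. 4 + (4 + (m + 4)) \<le> or_cost s0 \<and>
      frame s0 (t(regs := (t regs)(0 := t regs 5))) \<and> t regs 5 = Bit_Operations.or x (2 ^ p) \<and> t regs 1 = g)"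
  proof (rule wp_or_prog)
    show "powers_ready ?s" by (rule powers_ready_frame[OF fr pr])
    show "?s regs 2 < 2 ^ ?s regs 8" "?s regs 3 < 2 ^ ?s regs 8"
      using s p by (auto simp: frame_def)
  qed (use s fr in \<open>auto simp: frame_def or_cost_def\<close>)
  then show "wp (set_reg 2 (reg 0) ;; set_reg 3 (Load a (Num i)) ;; or_prog ;; set_reg 0 (reg 5)) s
    (\<lambda>m t. m \<le> or_cost s0 \<and> frame s0 t \<and> t regs 0 = Bit_Operations.or x (2 ^ p) \<and> t regs 1 = g \<and>
       Bit_Operations.or x (2 ^ p) < 2 ^ s0 regs 8)"
    unfolding wp_Seq wp_Store using sa s(2) a less by (simp del: One_nat_def)
qed

section \<open>The label operations on a state\<close>

text \<open>Here \<open>b\<close> codes a truth value: the masks \<open>b\<close>,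
  \<open>2 + b\<close> and \<open>4 + b\<close> stand for this value occurring, being forbidden and
  being needed.\<close>

abbreviation eta_half :: "nat \<Rightarrow> prog" where
  "eta_half b \<equiv> if_bit (Load src_mask (Num b))
     (if_bit (Load dst_mask (Num (2 + b))) (set_reg 1 (Num 0)) ;;
      if_bit (Load dst_mask (Num (4 + b))) (set_reg 0 (Minus (reg 0) (Load dst_mask (Num (4 + b))))))"

definition eta_state :: "prog" where
  "eta_state = eta_half 0 ;; eta_half 1"

fun rho_state :: "nat \<Rightarrow> prog" where
  "rho_state 0 = Skip"
| "rho_state (Suc f) = rho_state f ;;
     if_bit (Load src_mask (Num f))
       (set_reg 0 (Minus (reg 0) (Load src_mask (Num f))) ;;
        (set_reg 2 (reg 0) ;; set_reg 3 (Load dst_mask (Num f)) ;; or_prog ;; set_reg 0 (reg 5)))"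

definition masks_ready :: "(nat \<Rightarrow> nat) \<Rightarrow> nat \<Rightarrow> nat \<Rightarrow> memory \<Rightarrow> bool" where
  "masks_ready ix i j s \<longleftrightarrow> powers_ready s \<and> 6 * ix i + 6 \<le> s regs 8 \<and> 6 * ix j + 6 \<le> s regs 8 \<and>
     (\<forall>f < 6. s src_mask f = 2 ^ (6 * ix i + f) \<and> s dst_mask f = 2 ^ (6 * ix j + f))"

text \<open>The functions are chosen before the memory: one \<open>f\<close> and one
  \<open>k\<close> serve all entries of a family, whatever the scratch cells contain.\<close>

lemma implements_eta:
  obtains f k where "\<And>s0. masks_ready ix i j s0 \<Longrightarrow> implements s0 eta_state (6 * or_cost s0 + 30) f k"
    "\<And>x. bits (f x) = eta_facts ix i j (bits x)"
    "\<And>x g. k x g = (if eta_rejects ix i j (bits x) then 0 else g)"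
proof -
  let ?p = "\<lambda>b. 6 * ix i + b" and ?q = "\<lambda>b. 6 * ix j + b"
  define f where "f b x = (if ?p b \<in> bits x then
     (if ?q (4 + b) \<in> bits x then x - 2 ^ ?q (4 + b) else x) else x)" for b x
  define k where "k b x g = (if ?p b \<in> bits x then (if ?q (2 + b) \<in> bits x then 0 else g) else g)"
    for b and x g :: nat
  have half: "implements s0 (eta_half b) (3 * or_cost s0 + 13) (f b) (k b)"
    if "b < 2" and m: "masks_ready ix i j s0" for b s0
  proof -
        have pr: "powers_ready s0" using m by (simp add: masks_ready_def)
    have M: "s0 src_mask b = 2 ^ ?p b" "s0 dst_mask (2 + b) = 2 ^ ?q (2 + b)" "s0 dst_mask (4 + b) = 2 ^ ?q (4 + b)"
      "?p b < s0 regs 8" "?q (2 + b) < s0 regs 8" "?q (4 + b) < s0 regs 8"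
      using m \<open>b < 2\<close> by (auto simp: masks_ready_def)
    have "implements s0 (eta_half b) (or_cost s0 + ((or_cost s0 + 3) + (or_cost s0 + 10)))
      (\<lambda>x. if ?p b \<in> bits x then (\<lambda>x. if ?q (4 + b) \<in> bits x then x - 2 ^ ?q (4 + b) else x)
          ((\<lambda>x. if ?q (2 + b) \<in> bits x then x else x) x) else x)
      (\<lambda>x g. if ?p b \<in> bits x then (\<lambda>x g. if ?q (4 + b) \<in> bits x then g else g)
          ((\<lambda>x. if ?q (2 + b) \<in> bits x then x else x) x) ((\<lambda>x g. if ?q (2 + b) \<in> bits x then 0 else g) x g) else g)"
      by (rule implements_if_bit[OF pr, of src_mask b "?p b", OF _ M(1,4) implements_Seq[OF
          implements_if_bit[OF pr, of dst_mask "2 + b" "?q (2 + b)", OF _ M(2,5) implements_kill]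
          implements_if_bit[OF pr, of dst_mask "4 + b" "?q (4 + b)", OF _ M(3,6)
            implements_minus[of dst_mask s0 "4 + b" "?q (4 + b)", OF _ M(3)]]]]) simp_all
    moreover have "or_cost s0 + ((or_cost s0 + 3) + (or_cost s0 + 10)) = 3 * or_cost s0 + 13" by simp
    ultimately show ?thesis unfolding f_def k_def if_cancel by (simp only:)
  qed
  have bf: "bits (f b x) = (if ?p b \<in> bits x then bits x - {?q (4 + b)} else bits x)" for b x
    by (auto simp: f_def bits_minus_exp)
  have ne: "6 * a + c \<noteq> 6 * d + e" if "c \<noteq> e" "c < 6" "e < 6" for a c d e :: nat
    using mult6_add_eq_iff that by blast
  show thesis
  proof
    show "implements s0 eta_state (6 * or_cost s0 + 30) (\<lambda>x. f 1 (f 0 x)) (\<lambda>x g. k 1 (f 0 x) (k 0 x g))"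
      if "masks_ready ix i j s0" for s0
      unfolding eta_state_def
      by (rule implements_cost_mono[OF implements_Seq[OF half[OF _ that] half[OF _ that]]]) simp_all
    fix x g
    \<comment> \<open>The first half removes at most fact 4 of label \<open>j\<close>, so fact 1 of
      \<open>i\<close> and fact 3 of \<open>j\<close>, which the second half tests, are still the
      original ones.\<close>
    have has1: "?p 1 \<in> bits (f 0 x) \<longleftrightarrow> ?p 1 \<in> bits x" "?q 3 \<in> bits (f 0 x) \<longleftrightarrow> ?q 3 \<in> bits x"
      using ne[of 1 4 "ix i" "ix j"] by (auto simp: bf)
    show "bits (f 1 (f 0 x)) = eta_facts ix i j (bits x)"
      unfolding bf[of 1] has1 unfolding bf eta_facts_def by (simp add: numeral_eq_Suc)
    show "k 1 (f 0 x) (k 0 x g) = (if eta_rejects ix i j (bits x) then 0 else g)"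
      using has1 by (auto simp: k_def eta_rejects_def numeral_eq_Suc)
  qed
qed

text \<open>The facts are moved one at a time. For distinct labels the two blocks of positions are
  disjoint, so a moved bit is not moved again and does not disturb the bits still to come.\<close>

lemma implements_rho:
  assumes ij: "ix i \<noteq> ix j"
  obtains f where "\<And>s0. masks_ready ix i j s0 \<Longrightarrow> implements s0 (rho_state 6) (12 * or_cost s0 + 70) f (\<lambda>x g. g)"
    "\<And>x. bits (f x) = rho_facts ix i j (bits x)"
proof -
  let ?p = "\<lambda>b. 6 * ix i + b" and ?q = "\<lambda>b. 6 * ix j + b"
  have ne: "?p c \<noteq> ?q e" "?p c = ?p e \<longleftrightarrow> c = e" "?q c = ?q e \<longleftrightarrow> c = e" if "c < 6" "e < 6" for c e :: nat
    using mult6_add_eq_iff[OF that] ij by auto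
  have "\<exists>f. (\<forall>s0. masks_ready ix i j s0 \<longrightarrow>
       implements s0 (rho_state n) (n * (2 * or_cost s0 + 10) + 1) f (\<lambda>x g. g)) \<and>
     (\<forall>x. bits (f x) = (bits x - {?p c |c. c < n}) \<union> {?q c |c. c < n \<and> ?p c \<in> bits x})" if "n \<le> 6" for n
    using that
  proof (induction n)
    case 0
    then show ?case using implements_Skip by auto
  next
    case (Suc n)
    then obtain f where f: "\<And>s0. masks_ready ix i j s0 \<Longrightarrow>
        implements s0 (rho_state n) (n * (2 * or_cost s0 + 10) + 1) f (\<lambda>x g. g)"
      "\<And>x. bits (f x) = (bits x - {?p c |c. c < n}) \<union> {?q c |c. c < n \<and> ?p c \<in> bits x}" by auto
    let ?h = "\<lambda>x. if ?p n \<in> bits x then Bit_Operations.or (x - 2 ^ ?p n) (2 ^ ?q n) else x"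
    have "implements s0 (rho_state (Suc n)) (Suc n * (2 * or_cost s0 + 10) + 1) (\<lambda>x. ?h (f x)) (\<lambda>x g. g)"
      if m: "masks_ready ix i j s0" for s0
    proof -
      have pr: "powers_ready s0" using m by (simp add: masks_ready_def)
      have M: "s0 src_mask n = 2 ^ ?p n" "s0 dst_mask n = 2 ^ ?q n" "?p n < s0 regs 8" "?q n < s0 regs 8"
        using m Suc.prems by (auto simp: masks_ready_def)
      have "implements s0 (rho_state (Suc n))
        ((n * (2 * or_cost s0 + 10) + 1) + (or_cost s0 + (10 + or_cost s0)))
        (\<lambda>x. ?h (f x)) (\<lambda>x g. if ?p n \<in> bits (f x) then g else g)"
        unfolding rho_state.simps
        by (rule implements_Seq[OF f(1)[OF m] implements_if_bit[OF pr, of src_mask n "?p n", OF _ M(1,3)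
              implements_Seq[OF implements_minus[of src_mask s0 n "?p n", OF _ M(1)]
                implements_or[OF pr, of dst_mask n "?q n", OF _ M(2,4)]]]]) simp_all
      then show ?thesis
        by (simp add: algebra_simps)
    qed
    moreover have "bits (?h (f x)) = (bits x - {?p c |c. c < Suc n}) \<union> {?q c |c. c < Suc n \<and> ?p c \<in> bits x}" for x
    proof -
      have mem: "?p n \<in> bits (f x) \<longleftrightarrow> ?p n \<in> bits x" using ne Suc.prems unfolding f(2) by auto
      have "bits (?h (f x)) = (bits (f x) - {?p n}) \<union> (if ?p n \<in> bits x then {?q n} else {})"
        using mem by (auto simp: bits_or bits_exp bits_minus_exp)
      also have "\<dots> = (bits x - {?p c |c. c < Suc n}) \<union> {?q c |c. c < Suc n \<and> ?p c \<in> bits x}"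
        unfolding f(2) using Suc.prems by (auto simp: less_Suc_eq ne)
      finally show ?thesis .
    qed
    ultimately show ?case by blast
  qed
  from this[of 6] obtain f where f: "\<And>s0. masks_ready ix i j s0 \<Longrightarrow> implements s0 (rho_state 6) (6 * (2 * or_cost s0 + 10) + 1) f (\<lambda>x g. g)"
    "\<And>x. bits (f x) = rho_facts ix i j (bits x)" by (auto simp: rho_facts_def)
  show thesis
    by (rule that[OF implements_cost_mono[OF f(1)] f(2)]) simp_all
qed

section \<open>Families of gates indexed by states\<close>

definition dec_vars :: "circuit \<Rightarrow> nat clique_dec \<Rightarrow> nat set" where
  "dec_vars Z T = {x. \<exists>u \<in> dec_verts T. gates Z ! u = GVar x}"

definition family_sound ::
    "nat \<Rightarrow> gate list \<Rightarrow> nat set \<Rightarrow> (nat \<Rightarrow> nat) \<Rightarrow> (nat \<Rightarrow> nat) \<Rightarrow> bool" where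
  "family_sound N gs V G S \<longleftrightarrow> (\<forall>e < N. G e < length gs \<and> S e < N \<and> gate_vars gs (G e) \<subseteq> V)"

text \<open>Several entries may carry the same state. Hence adding arcs and relabelling, which can
  identify states, only rewrite the table and never have to join gates; a disjoint union returns to
  one entry per state. What is said about a state \<open>\<sigma>\<close> therefore concerns the
  disjunction of all entries that carry it.\<close>

definition family ::
    "circuit \<Rightarrow> (nat \<Rightarrow> nat) \<Rightarrow> nat \<Rightarrow> gate list \<Rightarrow> nat clique_dec \<Rightarrow> (nat \<Rightarrow> nat) \<Rightarrow> (nat \<Rightarrow> nat) \<Rightarrow> bool" where
  "family Z ix N gs T G S \<longleftrightarrow> family_sound N gs (dec_vars Z T) G S \<and>
     (\<forall>\<alpha> \<sigma>. (\<exists>e < N. S e = \<sigma> \<and> gate_true gs \<alpha> (G e)) \<longleftrightarrow>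
        (\<exists>v. admissible Z \<alpha> T v \<and> unforbidden Z T v \<and> facts Z ix T v = bits \<sigma>))"

text \<open>Gate 0 is the constant false and stands for an absent gate.\<close>

definition dnnf_list0 :: "gate list \<Rightarrow> bool" where
  "dnnf_list0 gs \<longleftrightarrow> dnnf_list gs \<and> gs \<noteq> [] \<and> gs ! 0 = GConst False"

lemma dnnf_list0_snoc: "dnnf_list0 gs \<Longrightarrow> appendable gs G \<Longrightarrow> dnnf_list0 (gs @ [G])"
  by (auto simp: dnnf_list0_def nth_append intro: dnnf_list.snoc)

lemma dnnf_list0D: "dnnf_list0 gs \<Longrightarrow> dnnf_list gs"
  by (simp add: dnnf_list0_def)

lemma gate_0:
  assumes "dnnf_list0 gs"
  shows "0 < length gs" "\<not> gate_true gs \<alpha> 0" "gate_vars gs 0 = {}"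
proof -
  obtain hs where gs: "gs = [GConst False] @ hs"
    using assms by (cases gs) (auto simp: dnnf_list0_def)
  have ok: "dnnf_list []" "dnnf_list [GConst False]"
    using dnnf_list.snoc[OF dnnf_list.Nil, of "GConst False"]
    by (auto simp: appendable_def dnnf_list.Nil)
  show "0 < length gs" using gs by simp
  show "\<not> gate_true gs \<alpha> 0"
    unfolding gs gate_true_append[OF ok(2), of 0, simplified]
    using gate_true_snoc[OF ok(1), of "GConst False" \<alpha>] gate_true_append[OF ok(2), of 0 hs \<alpha>] by simp
  show "gate_vars gs 0 = {}"
    using gate_vars_snoc[OF ok(1), of "GConst False"] gate_vars_append[OF ok(2), of 0 hs]
    by (simp add: gs)
qed

lemma family_append:
  assumes "dnnf_list gs" "family Z ix N gs T G S"
  shows "family Z ix N (gs @ hs) T G S"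
proof -
  have less: "G e < length gs" if "e < N" for e
    using assms(2) that by (simp add: family_def family_sound_def)
  have "(\<exists>e < N. S e = \<sigma> \<and> gate_true (gs @ hs) \<alpha> (G e)) \<longleftrightarrow> (\<exists>e < N. S e = \<sigma> \<and> gate_true gs \<alpha> (G e))" for \<alpha> \<sigma>
    using less gate_true_append[OF assms(1)] by metis
  then show ?thesis using assms(2) gate_vars_append[OF assms(1) less]
    by (simp add: family_def family_sound_def trans_less_add1)
qed

lemma finite_dec_verts: "finite (dec_verts T)"
  by (induction T) auto

text \<open>Provides a number for the facts of any guess, so that no guess is lost by speaking of
  codes.\<close>

lemma facts_code: "\<exists>x. bits x = facts Z ix T v"
proof -
  have "facts Z ix T v \<subseteq> (\<lambda>(u, f). 6 * ix (dec_label T u) + f) ` (dec_verts T \<times> {..<6})"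
  proof
    fix p assume "p \<in> facts Z ix T v"
    then obtain u f where "u \<in> dec_verts T" "f \<in> vertex_facts Z T v u" "p = 6 * ix (dec_label T u) + f"
      unfolding facts_def by auto
    then show "p \<in> (\<lambda>(u, f). 6 * ix (dec_label T u) + f) ` (dec_verts T \<times> {..<6})"
      by (intro image_eqI[of _ _ "(u, f)"]) (auto dest: vertex_facts_less)
  qed
  then have "finite (facts Z ix T v)" by (rule finite_subset) (simp add: finite_dec_verts)
  moreover have "\<exists>x. bits x = F" if "finite F" for F
    using that
  proof (induction F)
    case empty
    then show ?case using bits_0 by blast
  next
    case (insert p F)
    then obtain x where "bits x = F" by blast
    then have "bits (Bit_Operations.or x (2 ^ p)) = insert p F" by (simp add: bits_or bits_exp)
    then show ?case by blast
  qed
  ultimately show ?thesis by blast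
qed

text \<open>The label operations act on the states only: no gate is needed for them.\<close>

lemma family_map:
  assumes gs: "dnnf_list0 gs" and F: "family Z ix N gs T G S"
    and verts: "dec_verts T' = dec_verts T"
    and unf: "\<And>v. unforbidden Z T' v \<longleftrightarrow> unforbidden Z T v \<and> \<not> rej (facts Z ix T v)"
    and fc: "\<And>v. facts Z ix T' v = upd (facts Z ix T v)"
    and f: "\<And>x. bits (f x) = upd (bits x)" and k: "\<And>x g. k x g = (if rej (bits x) then 0 else g)"
    and less: "\<And>e. e < N \<Longrightarrow> f (S e) < N"
  shows "family Z ix N gs T' (\<lambda>e. k (S e) (G e)) (\<lambda>e. f (S e))"
  unfolding family_def
proof (intro conjI allI)
  have vars: "dec_vars Z T' = dec_vars Z T" by (simp add: dec_vars_def verts)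
  show "family_sound N gs (dec_vars Z T') (\<lambda>e. k (S e) (G e)) (\<lambda>e. f (S e))"
    using F less gate_0[OF gs] unfolding family_def family_sound_def vars k by auto
  fix \<alpha> \<sigma>
  have sem: "(\<exists>e < N. S e = \<tau> \<and> gate_true gs \<alpha> (G e)) \<longleftrightarrow>
      (\<exists>v. admissible Z \<alpha> T v \<and> unforbidden Z T v \<and> facts Z ix T v = bits \<tau>)" for \<tau>
    using F unfolding family_def by blast
  have adm: "admissible Z \<alpha> T' v = admissible Z \<alpha> T v" for v by (simp add: admissible_def verts)
  show "(\<exists>e < N. f (S e) = \<sigma> \<and> gate_true gs \<alpha> (k (S e) (G e))) \<longleftrightarrow>
    (\<exists>v. admissible Z \<alpha> T' v \<and> unforbidden Z T' v \<and> facts Z ix T' v = bits \<sigma>)" (is "?l \<longleftrightarrow> ?r")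
  proof
    assume ?l
    then obtain e where e: "e < N" "f (S e) = \<sigma>" "gate_true gs \<alpha> (k (S e) (G e))" by blast
    then have nr: "\<not> rej (bits (S e))" "gate_true gs \<alpha> (G e)"
      using gate_0(2)[OF gs] by (auto simp: k split: if_splits)
    then obtain v where "admissible Z \<alpha> T v" "unforbidden Z T v" "facts Z ix T v = bits (S e)"
      using sem[of "S e"] e(1) by blast
    then show ?r using nr e(2) f[of "S e"] unfolding adm unf fc by auto
  next
    assume ?r
    then obtain v where v: "admissible Z \<alpha> T v" "unforbidden Z T v" "\<not> rej (facts Z ix T v)"
      "upd (facts Z ix T v) = bits \<sigma>" unfolding adm unf fc by blast
    obtain \<tau> where \<tau>: "bits \<tau> = facts Z ix T v" using facts_code by blast
    then obtain e where e: "e < N" "S e = \<tau>" "gate_true gs \<alpha> (G e)" using sem[of \<tau>] v by auto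
    have "bits (f \<tau>) = bits \<sigma>" using f v(4) \<tau> by simp
    then show ?l using e \<tau> v(3) by (intro exI[of _ e]) (auto simp: k bits_inject)
  qed
qed

text \<open>\<open>P\<close> is the set of pairs of entries dealt with, \<open>A r\<close> the gate
  for those whose joint state is \<open>r\<close>. The disjunction over these pairs is grown as a
  chain of binary gates that starts from gate 0 and has \<open>A r\<close> as its last link; so no
  gate has more than two inputs.\<close>

definition union_inv ::
    "nat \<Rightarrow> gate list \<Rightarrow> nat set \<Rightarrow> (nat \<Rightarrow> nat) \<Rightarrow> (nat \<Rightarrow> nat) \<Rightarrow> (nat \<Rightarrow> nat) \<Rightarrow> (nat \<Rightarrow> nat) \<Rightarrow>
     gate list \<Rightarrow> (nat \<Rightarrow> nat) \<Rightarrow> (nat \<times> nat) set \<Rightarrow> bool" where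
  "union_inv N gs0 V G1 S1 G2 S2 gs A P \<longleftrightarrow>
     dnnf_list0 gs \<and> (\<exists>hs. gs = gs0 @ hs) \<and> list_vars gs = list_vars gs0 \<and>
     (\<forall>r < N. A r < length gs \<and> gate_vars gs (A r) \<subseteq> V \<and>
        (\<forall>\<alpha>. gate_true gs \<alpha> (A r) \<longleftrightarrow> (\<exists>e1 e2. (e1, e2) \<in> P \<and> Bit_Operations.or (S1 e1) (S2 e2) = r \<and>
           gate_true gs0 \<alpha> (G1 e1) \<and> gate_true gs0 \<alpha> (G2 e2))))"

text \<open>The copy \<open>GOr [g2]\<close> keeps the inputs of the conjunction distinct even if \<open>g1 = g2\<close>.\<close>

definition join_gates :: "gate list \<Rightarrow> nat \<Rightarrow> nat \<Rightarrow> nat \<Rightarrow> gate list" where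
  "join_gates gs g1 g2 a = [GOr [g2], GAnd [g1, length gs], GOr [a, Suc (length gs)]]"

lemma union_inv_step:
  assumes inv: "union_inv N gs0 V G1 S1 G2 S2 gs A P" and gs0: "dnnf_list gs0"
    and g1: "G1 e1 < length gs0" "gate_vars gs0 (G1 e1) \<subseteq> V1"
    and g2: "G2 e2 < length gs0" "gate_vars gs0 (G2 e2) \<subseteq> V2"
    and V: "V1 \<inter> V2 = {}" "V1 \<union> V2 \<subseteq> V" and r: "r = Bit_Operations.or (S1 e1) (S2 e2)" "r < N"
  shows "union_inv N gs0 V G1 S1 G2 S2 (gs @ join_gates gs (G1 e1) (G2 e2) (A r))
    (A(r := length gs + 2)) (insert (e1, e2) P)"
proof -
  from inv obtain hs where gs: "dnnf_list0 gs" and hs: "gs = gs0 @ hs" and lv: "list_vars gs = list_vars gs0"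
    and A: "\<And>r. r < N \<Longrightarrow> A r < length gs" "\<And>r. r < N \<Longrightarrow> gate_vars gs (A r) \<subseteq> V"
      "\<And>r \<alpha>. r < N \<Longrightarrow> gate_true gs \<alpha> (A r) \<longleftrightarrow> (\<exists>e1 e2. (e1, e2) \<in> P \<and> Bit_Operations.or (S1 e1) (S2 e2) = r \<and>
           gate_true gs0 \<alpha> (G1 e1) \<and> gate_true gs0 \<alpha> (G2 e2))"
    unfolding union_inv_def by blast
  let ?n = "length gs"
  define gs1 where "gs1 = gs @ [GOr [G2 e2]]"
  define gs2 where "gs2 = gs1 @ [GAnd [G1 e1, ?n]]"
  define gs3 where "gs3 = gs2 @ [GOr [A r, Suc ?n]]"
  have G: "G1 e1 < ?n" "G2 e2 < ?n" "gate_vars gs (G1 e1) \<subseteq> V1" "gate_vars gs (G2 e2) \<subseteq> V2"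
    "gate_true gs \<alpha> (G1 e1) = gate_true gs0 \<alpha> (G1 e1)" "gate_true gs \<alpha> (G2 e2) = gate_true gs0 \<alpha> (G2 e2)" for \<alpha>
    using g1 g2 gate_vars_append[OF gs0] gate_true_append[OF gs0] by (auto simp: hs)
  note ok = dnnf_list0D
  have ok1: "dnnf_list0 gs1" unfolding gs1_def
    by (rule dnnf_list0_snoc[OF gs]) (use G in \<open>simp add: appendable_def\<close>)
  have l1: "length gs1 = Suc ?n" by (simp add: gs1_def)
  have v1: "gate_vars gs1 ?n \<subseteq> V2" "gate_vars gs1 (G1 e1) \<subseteq> V1"
    using gate_vars_snoc[OF ok[OF gs], of "GOr [G2 e2]"] gate_vars_append[OF ok[OF gs] G(1)] G unfolding gs1_def by auto
  have t1: "gate_true gs1 \<alpha> ?n = gate_true gs0 \<alpha> (G2 e2)" for \<alpha>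
    using gate_true_snoc[OF ok[OF gs], of "GOr [G2 e2]"] G unfolding gs1_def by simp
  \<comment> \<open>Decomposability of the new conjunction: its inputs have their variables in
    \<open>V1\<close> and \<open>V2\<close>. They are different gates, the second being the fresh
    copy.\<close>
  have ok2: "dnnf_list0 gs2" unfolding gs2_def
    by (rule dnnf_list0_snoc[OF ok1]) (use G l1 v1 V in \<open>auto simp: appendable_def\<close>)
  have l2: "length gs2 = Suc (Suc ?n)" by (simp add: gs2_def l1)
  have v2: "gate_vars gs2 (Suc ?n) \<subseteq> V"
  proof -
    have "gate_vars gs2 (length gs1) \<subseteq> {} \<union> (\<Union>h \<in> {G1 e1, ?n}. gate_vars gs1 h)"
      unfolding gs2_def by (rule order_trans[OF gate_vars_snoc[OF ok[OF ok1]]]) (use G l1 in auto)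
    then have "gate_vars gs2 (Suc ?n) \<subseteq> gate_vars gs1 (G1 e1) \<union> gate_vars gs1 ?n" using l1 by simp
    then show ?thesis using v1 V(2) by blast
  qed
  have t2: "gate_true gs2 \<alpha> (Suc ?n) \<longleftrightarrow> gate_true gs0 \<alpha> (G1 e1) \<and> gate_true gs0 \<alpha> (G2 e2)" for \<alpha>
  proof -
    have "gate_true gs2 \<alpha> (length gs1) = gate_fun \<alpha> (gate_true gs1 \<alpha>) (GAnd [G1 e1, ?n])"
      unfolding gs2_def by (rule gate_true_snoc[OF ok[OF ok1]]) (use G l1 in auto)
    then show ?thesis using l1 t1 G(5) gate_true_append[OF ok[OF gs] G(1)] by (simp add: gs1_def)
  qed
  have eq2: "gs2 = gs @ [GOr [G2 e2], GAnd [G1 e1, ?n]]" by (simp add: gs2_def gs1_def)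
  have Ar: "A r < length gs" "gate_vars gs2 (A r) \<subseteq> V" "gate_true gs2 \<alpha> (A r) = gate_true gs \<alpha> (A r)" for \<alpha>
    using A(1,2)[OF r(2)] gate_vars_append[OF ok[OF gs]] gate_true_append[OF ok[OF gs]] by (auto simp: eq2)
  have ok3: "dnnf_list0 gs3" unfolding gs3_def
    by (rule dnnf_list0_snoc[OF ok2]) (use Ar l2 in \<open>auto simp: appendable_def\<close>)
  have v3: "gate_vars gs3 (?n + 2) \<subseteq> V"
  proof -
    have "gate_vars gs3 (length gs2) \<subseteq> {} \<union> (\<Union>h \<in> {A r, Suc ?n}. gate_vars gs2 h)"
      unfolding gs3_def by (rule order_trans[OF gate_vars_snoc[OF ok[OF ok2]]]) (use Ar l2 in auto)
    then have "gate_vars gs3 (?n + 2) \<subseteq> gate_vars gs2 (A r) \<union> gate_vars gs2 (Suc ?n)" using l2 by simp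
    then show ?thesis using Ar(2) v2 by blast
  qed
  have t3: "gate_true gs3 \<alpha> (?n + 2) \<longleftrightarrow> gate_true gs \<alpha> (A r) \<or>
      gate_true gs0 \<alpha> (G1 e1) \<and> gate_true gs0 \<alpha> (G2 e2)" for \<alpha>
  proof -
    have "gate_true gs3 \<alpha> (length gs2) = gate_fun \<alpha> (gate_true gs2 \<alpha>) (GOr [A r, Suc ?n])"
      unfolding gs3_def by (rule gate_true_snoc[OF ok[OF ok2]]) (use Ar l2 in auto)
    then show ?thesis using l2 t2 Ar by simp
  qed
  have eq3: "gs3 = gs @ join_gates gs (G1 e1) (G2 e2) (A r)"
    by (simp add: gs3_def gs2_def gs1_def join_gates_def)
  have lv3: "list_vars gs3 = list_vars gs0"
    unfolding lv[symmetric] gs3_def gs2_def gs1_def list_vars_snoc by simp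
  have l3: "length gs3 = ?n + 3" by (simp add: gs3_def l2)
  have ex: "(\<exists>a b. (a, b) \<in> insert (e1, e2) P \<and> R a b) \<longleftrightarrow> (\<exists>a b. (a, b) \<in> P \<and> R a b) \<or> R e1 e2" for R
    by auto
  have old: "gate_true gs3 \<alpha> (A q) = gate_true gs \<alpha> (A q)" "gate_vars gs3 (A q) = gate_vars gs (A q)"
    if "q < N" for q \<alpha>
    unfolding eq3 using A(1)[OF that] gate_vars_append[OF ok[OF gs]] gate_true_append[OF ok[OF gs]] by auto
  show ?thesis unfolding union_inv_def eq3[symmetric]
  proof (intro conjI allI impI)
    show "dnnf_list0 gs3" "list_vars gs3 = list_vars gs0" by fact+
    show "\<exists>hs. gs3 = gs0 @ hs" using hs eq3 by simp
    fix q assume q: "q < N"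
    show "(A(r := length gs + 2)) q < length gs3" using A(1)[OF q] l3 by simp
    show "gate_vars gs3 ((A(r := length gs + 2)) q) \<subseteq> V"
      using v3 A(2)[OF q] old[OF q] by simp
    fix \<alpha>
    show "gate_true gs3 \<alpha> ((A(r := length gs + 2)) q) \<longleftrightarrow> (\<exists>a b. (a, b) \<in> insert (e1, e2) P \<and>
       Bit_Operations.or (S1 a) (S2 b) = q \<and> gate_true gs0 \<alpha> (G1 a) \<and> gate_true gs0 \<alpha> (G2 b))"
      unfolding ex A(3)[OF q, symmetric] using t3 old[OF q] r by auto
  qed
qed

lemma union_inv_init:
  assumes "dnnf_list0 gs0"
  shows "union_inv N gs0 V G1 S1 G2 S2 gs0 (\<lambda>_. 0) {}"
  using assms gate_0[OF assms] by (auto simp: union_inv_def)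

text \<open>The sides share no vertex, so any two guesses can be glued and any guess splits; the
  facts of the glued guess are the union of the facts, whose code is the bitwise
  disjunction.\<close>

lemma family_Disj_Union:
  assumes gs0: "dnnf_list0 gs0"
    and F1: "family Z ix N gs0 T1 G1 S1" and F2: "family Z ix N gs0 T2 G2 S2"
    and disj: "dec_verts T1 \<inter> dec_verts T2 = {}" and N: "N = 2 ^ B"
    and inv: "union_inv N gs0 (dec_vars Z (Disj_Union T1 T2)) G1 S1 G2 S2 gs A ({..<N} \<times> {..<N})"
  shows "family Z ix N gs (Disj_Union T1 T2) A (\<lambda>e. e)"
  unfolding family_def
proof (intro conjI allI)
  let ?T = "Disj_Union T1 T2"
  show "family_sound N gs (dec_vars Z ?T) A (\<lambda>e. e)"
    using inv unfolding union_inv_def family_sound_def by blast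
  fix \<alpha> \<sigma>
  have sem1: "(\<exists>e < N. S1 e = \<tau> \<and> gate_true gs0 \<alpha> (G1 e)) \<longleftrightarrow>
      (\<exists>v. admissible Z \<alpha> T1 v \<and> unforbidden Z T1 v \<and> facts Z ix T1 v = bits \<tau>)" for \<tau>
    using F1 unfolding family_def by blast
  have sem2: "(\<exists>e < N. S2 e = \<tau> \<and> gate_true gs0 \<alpha> (G2 e)) \<longleftrightarrow>
      (\<exists>v. admissible Z \<alpha> T2 v \<and> unforbidden Z T2 v \<and> facts Z ix T2 v = bits \<tau>)" for \<tau>
    using F2 unfolding family_def by blast
  have less: "S1 e < N" "S2 e < N" if "e < N" for e
    using F1 F2 that by (auto simp: family_def family_sound_def)
  have "(\<exists>e < N. e = \<sigma> \<and> gate_true gs \<alpha> (A e)) \<longleftrightarrow> \<sigma> < N \<and> gate_true gs \<alpha> (A \<sigma>)" by auto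
  also have "\<dots> \<longleftrightarrow> \<sigma> < N \<and> (\<exists>e1 e2. (e1, e2) \<in> {..<N} \<times> {..<N} \<and> Bit_Operations.or (S1 e1) (S2 e2) = \<sigma> \<and>
      gate_true gs0 \<alpha> (G1 e1) \<and> gate_true gs0 \<alpha> (G2 e2))"
    using inv unfolding union_inv_def by blast
  also have "\<dots> \<longleftrightarrow> (\<exists>\<tau>1 \<tau>2. Bit_Operations.or \<tau>1 \<tau>2 = \<sigma> \<and>
      (\<exists>e < N. S1 e = \<tau>1 \<and> gate_true gs0 \<alpha> (G1 e)) \<and> (\<exists>e < N. S2 e = \<tau>2 \<and> gate_true gs0 \<alpha> (G2 e)))"
    using less or_less_exp[of _ B] unfolding N by auto
  also have "\<dots> \<longleftrightarrow> (\<exists>v. admissible Z \<alpha> ?T v \<and> unforbidden Z ?T v \<and> facts Z ix ?T v = bits \<sigma>)"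
    (is "?l \<longleftrightarrow> ?r")
  proof
    assume ?l
    then obtain \<tau>1 \<tau>2 v w where or: "Bit_Operations.or \<tau>1 \<tau>2 = \<sigma>"
      and v: "admissible Z \<alpha> T1 v" "unforbidden Z T1 v" "facts Z ix T1 v = bits \<tau>1"
      and w: "admissible Z \<alpha> T2 w" "unforbidden Z T2 w" "facts Z ix T2 w = bits \<tau>2"
      unfolding sem1 sem2 by blast
    define u where "u h = (if h \<in> dec_verts T1 then v h else w h)" for h
    have u1: "u h = v h" if "h \<in> dec_verts T1" for h using that by (simp add: u_def)
    have u2: "u h = w h" if "h \<in> dec_verts T2" for h using that disj by (auto simp: u_def)
    have "admissible Z \<alpha> ?T u" "unforbidden Z ?T u" "facts Z ix ?T u = bits \<sigma>"
      using v w or admissible_cong[of T1 u v, OF u1] admissible_cong[of T2 u w, OF u2]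
        unforbidden_cong[of T1 u v, OF u1] unforbidden_cong[of T2 u w, OF u2]
        facts_cong[of T1 u v, OF u1] facts_cong[of T2 u w, OF u2]
      by (auto simp: admissible_Disj_Union unforbidden_Disj_Union facts_Disj_Union[OF disj] bits_or)
    then show ?r by blast
  next
    assume ?r
    then obtain v where v: "admissible Z \<alpha> ?T v" "unforbidden Z ?T v" "facts Z ix ?T v = bits \<sigma>" by blast
    obtain \<tau>1 \<tau>2 where t: "bits \<tau>1 = facts Z ix T1 v" "bits \<tau>2 = facts Z ix T2 v"
      using facts_code by metis
    then have "bits (Bit_Operations.or \<tau>1 \<tau>2) = bits \<sigma>"
      using v(3) by (simp add: bits_or facts_Disj_Union[OF disj])
    then have "Bit_Operations.or \<tau>1 \<tau>2 = \<sigma>" by (simp add: bits_inject)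
    moreover have "admissible Z \<alpha> T1 v" "admissible Z \<alpha> T2 v" "unforbidden Z T1 v" "unforbidden Z T2 v"
      using v by (auto simp: admissible_Disj_Union unforbidden_Disj_Union)
    ultimately show ?l unfolding sem1 sem2 using t[symmetric] by blast
  qed
  finally show "(\<exists>e < N. e = \<sigma> \<and> gate_true gs \<alpha> (A e)) \<longleftrightarrow>
    (\<exists>v. admissible Z \<alpha> ?T v \<and> unforbidden Z ?T v \<and> facts Z ix ?T v = bits \<sigma>)" .
qed

text \<open>The first gate is for the guess true, the second for false. A variable admits a guess
  exactly under the matching literal; a gate of another kind may be guessed freely, since it is
  checked through the facts.\<close>

definition guess_gates :: "gate \<Rightarrow> nat \<Rightarrow> gate list" where
  "guess_gates G n = (case G of GVar x \<Rightarrow> [GVar x, GNot n] | _ \<Rightarrow> [GConst True, GConst True])"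

lemma guess_gates_correct:
  assumes gs: "dnnf_list0 gs" and fresh: "\<And>x. G = GVar x \<Longrightarrow> x \<notin> list_vars gs"
  shows "dnnf_list0 (gs @ guess_gates G (length gs))" (is ?ok)
    and "list_vars (gs @ guess_gates G (length gs)) = list_vars gs \<union> {x. G = GVar x}" (is ?lv)
    and "gate_true (gs @ guess_gates G (length gs)) \<alpha> (length gs) \<longleftrightarrow> (\<forall>x. G = GVar x \<longrightarrow> \<alpha> x)" (is ?t)
    and "gate_true (gs @ guess_gates G (length gs)) \<alpha> (Suc (length gs)) \<longleftrightarrow> (\<forall>x. G = GVar x \<longrightarrow> \<not> \<alpha> x)" (is ?f)
    and "gate_vars (gs @ guess_gates G (length gs)) (length gs) \<subseteq> {x. G = GVar x}" (is ?v1)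
    and "gate_vars (gs @ guess_gates G (length gs)) (Suc (length gs)) \<subseteq> {x. G = GVar x}" (is ?v2)
proof -
  let ?n = "length gs"
  obtain A C where AC: "guess_gates G ?n = [A, C]" and A: "A = (case G of GVar x \<Rightarrow> GVar x | _ \<Rightarrow> GConst True)"
    and C: "C = (case G of GVar x \<Rightarrow> GNot ?n | _ \<Rightarrow> GConst True)"
    by (cases G) (auto simp: guess_gates_def)
  have eq: "gs @ guess_gates G ?n = (gs @ [A]) @ [C]" by (simp add: AC)
  have okA: "dnnf_list0 (gs @ [A])"
    by (rule dnnf_list0_snoc[OF gs]) (use fresh in \<open>auto simp: A appendable_def split: gate.splits\<close>)
  have inC: "\<And>h. h \<in> set (gate_inputs C) \<Longrightarrow> h < length (gs @ [A])" by (auto simp: C split: gate.splits)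
  have inA: "\<And>h. h \<in> set (gate_inputs A) \<Longrightarrow> h < length gs" by (auto simp: A split: gate.splits)
  show ?ok unfolding eq
    by (rule dnnf_list0_snoc[OF okA]) (auto simp: A C appendable_def nth_append split: gate.splits)
  show ?lv unfolding eq list_vars_snoc by (auto simp: A C split: gate.splits)
  have n: "?n < length (gs @ [A])" by simp
  have tA: "gate_true (gs @ [A]) \<alpha> ?n \<longleftrightarrow> (\<forall>x. G = GVar x \<longrightarrow> \<alpha> x)"
    using gate_true_snoc[OF dnnf_list0D[OF gs] inA, where \<alpha> = \<alpha>] by (auto simp: A split: gate.splits)
  then show ?t unfolding eq gate_true_append[OF dnnf_list0D[OF okA] n] .
  show ?f unfolding eq
    using gate_true_snoc[OF dnnf_list0D[OF okA] inC, where \<alpha> = \<alpha>] tA by (auto simp: C split: gate.splits)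
  have vA: "gate_vars (gs @ [A]) ?n \<subseteq> {x. G = GVar x}"
  proof -
    have "gate_vars (gs @ [A]) ?n \<subseteq> {x. A = GVar x} \<union> (\<Union>h \<in> set (gate_inputs A). gate_vars gs h)"
      by (rule gate_vars_snoc[OF dnnf_list0D[OF gs] inA])
    also have "\<dots> \<subseteq> {x. G = GVar x}" by (auto simp: A split: gate.splits)
    finally show ?thesis .
  qed
  then show ?v1 unfolding eq gate_vars_append[OF dnnf_list0D[OF okA] n] .
  have "gate_vars ((gs @ [A]) @ [C]) (length (gs @ [A])) \<subseteq>
      {x. C = GVar x} \<union> (\<Union>h \<in> set (gate_inputs C). gate_vars (gs @ [A]) h)"
    by (rule gate_vars_snoc[OF dnnf_list0D[OF okA] inC])
  also have "\<dots> \<subseteq> {x. G = GVar x}" using vA by (auto simp: C split: gate.splits)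
  finally show ?v2 unfolding eq by simp
qed

text \<open>Only entries 0 and 1 can be alive, the others point to gate 0. For the output gate the
  entry of the value false is dead as well, which enforces the clause of \<open>admissible\<close>
  on the output.\<close>

lemma family_Create:
  assumes gs: "dnnf_list0 gs" and fresh: "\<And>x. gates Z ! u = GVar x \<Longrightarrow> x \<notin> list_vars gs"
    and N: "2 \<le> N" and S: "\<And>e. e < N \<Longrightarrow> S e < N"
    and S0: "bits (S 0) = facts Z ix (Create u a) (\<lambda>_. False)"
    and S1: "bits (S 1) = facts Z ix (Create u a) (\<lambda>_. True)"
    and G0: "G 0 = (if u = out_gate Z then 0 else Suc (length gs))" and G1: "G 1 = length gs"
    and G: "\<And>e. 2 \<le> e \<Longrightarrow> e < N \<Longrightarrow> G e = 0"
  shows "family Z ix N (gs @ guess_gates (gates Z ! u) (length gs)) (Create u a) G S"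
    (is "family Z ix N ?gs _ _ _")
proof -
  note g = guess_gates_correct[OF gs, of "gates Z ! u", OF fresh]
  have len: "length ?gs = length gs + 2" by (cases "gates Z ! u") (auto simp: guess_gates_def)
  have e: "e = 0 \<or> e = 1 \<or> 2 \<le> e" for e :: nat by auto
  have z: "gate_vars ?gs 0 = {}" "\<not> gate_true ?gs \<alpha> 0" for \<alpha> using gate_0[OF g(1)] by simp_all
  have V: "dec_vars Z (Create u a) = {x. gates Z ! u = GVar x}" by (auto simp: dec_vars_def)
  have sound: "family_sound N ?gs (dec_vars Z (Create u a)) G S"
    unfolding family_sound_def V
  proof (intro allI impI)
    fix e assume "e < N"
    with e[of e] show "G e < length ?gs \<and> S e < N \<and> gate_vars ?gs (G e) \<subseteq> {x. gates Z ! u = GVar x}"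
      using S len z(1) g(5,6) G0 G1 G \<open>e < N\<close> by (auto split: if_splits)
  qed
  have "(\<exists>e < N. S e = \<sigma> \<and> gate_true ?gs \<alpha> (G e)) \<longleftrightarrow>
      (\<exists>v. admissible Z \<alpha> (Create u a) v \<and> unforbidden Z (Create u a) v \<and> facts Z ix (Create u a) v = bits \<sigma>)"
    for \<alpha> \<sigma>
  proof -
    have "(\<exists>e < N. S e = \<sigma> \<and> gate_true ?gs \<alpha> (G e)) \<longleftrightarrow>
        S 0 = \<sigma> \<and> gate_true ?gs \<alpha> (G 0) \<or> S 1 = \<sigma> \<and> gate_true ?gs \<alpha> (G 1)" (is "?l \<longleftrightarrow> ?r")
    proof
      assume ?l
      then obtain i where "i < N" "S i = \<sigma>" "gate_true ?gs \<alpha> (G i)" by blast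
      then show ?r using e[of i] G[of i] z(2) by auto
    next
      assume ?r
      then show ?l using N by (metis less_le_trans one_less_numeral_iff pos2 semiring_norm(76))
    qed
    also have "\<dots> \<longleftrightarrow> (\<exists>b. (if b then S 1 else S 0) = \<sigma> \<and> admissible Z \<alpha> (Create u a) (\<lambda>_. b))"
    proof -
      have "admissible Z \<alpha> (Create u a) (\<lambda>_. True) \<longleftrightarrow> gate_true ?gs \<alpha> (G 1)"
        unfolding G1 using g(3)[where \<alpha> = \<alpha>] by (simp add: admissible_def)
      moreover have "admissible Z \<alpha> (Create u a) (\<lambda>_. False) \<longleftrightarrow> gate_true ?gs \<alpha> (G 0)"
        unfolding G0 using g(4)[where \<alpha> = \<alpha>] z(2)[of \<alpha>] by (auto simp: admissible_def)
      ultimately show ?thesis by (auto simp: ex_bool_eq)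
    qed
    also have "\<dots> \<longleftrightarrow> (\<exists>b. facts Z ix (Create u a) (\<lambda>_. b) = bits \<sigma> \<and> admissible Z \<alpha> (Create u a) (\<lambda>_. b))"
      unfolding ex_bool_eq by (simp add: S0[symmetric] S1[unfolded One_nat_def, symmetric] bits_inject)
    also have "\<dots> \<longleftrightarrow> (\<exists>v. admissible Z \<alpha> (Create u a) v \<and> unforbidden Z (Create u a) v \<and>
        facts Z ix (Create u a) v = bits \<sigma>)" (is "?l \<longleftrightarrow> ?r")
    proof
      assume ?l
      then show ?r by (auto simp: unforbidden_def)
    next
      assume ?r
      then obtain v where v: "admissible Z \<alpha> (Create u a) v" "facts Z ix (Create u a) v = bits \<sigma>" by blast
      \<comment> \<open>On a single vertex every guess acts like a constant one.\<close>
      then show ?l using admissible_cong[of "Create u a" v "\<lambda>_. v u"] facts_cong[of "Create u a" v "\<lambda>_. v u"]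
        by auto
    qed
    finally show ?thesis .
  qed
  with sound show ?thesis unfolding family_def by blast
qed

section \<open>Emitting gates\<close>

text \<open>No emitted gate has more than two inputs, so the wires of gate \<open>g\<close> may sit
  at \<open>2 * g\<close> and \<open>2 * g + 1\<close>, an offset that one addition
  computes.\<close>

definition D_mem :: "memory \<Rightarrow> gate list \<Rightarrow> bool" where
  "D_mem s gs \<longleftrightarrow> s (''D'', ''size'') 0 = length gs \<and>
     (\<forall>g < length gs. s (''D'', ''kind'') g = gate_kind (gs ! g) \<and>
        (\<forall>x. gs ! g = GVar x \<longrightarrow> s (''D'', ''var'') g = x) \<and>
        s (''D'', ''degree'') g = length (gate_inputs (gs ! g)) \<and>
        s (''D'', ''offset'') g = 2 * g \<and> length (gate_inputs (gs ! g)) \<le> 2 \<and>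
        (\<forall>l < length (gate_inputs (gs ! g)). s (''D'', ''wire'') (2 * g + l) = gate_inputs (gs ! g) ! l))"

lemma D_mem_cong: "D_mem s gs \<Longrightarrow> (\<And>f. t (''D'', f) = s (''D'', f)) \<Longrightarrow> D_mem t gs"
  by (simp add: D_mem_def)

lemma D_mem_imp_circuit_in_memory:
  "D_mem s gs \<Longrightarrow> s (''D'', ''output'') 0 = o' \<Longrightarrow> circuit_in_memory ''D'' s \<lparr>gates = gs, out_gate = o'\<rparr>"
  by (simp add: D_mem_def circuit_in_memory_def circuit_size_def Let_def)

abbreviation D_size :: expr where "D_size \<equiv> Load (''D'', ''size'') (Num 0)"

text \<open>All fields are written whatever the kind of the gate. Values left over in cells 4, 5 and
  6 do no harm, because only as many wires count as the degree says, and \<open>var\<close> only for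
  variables.\<close>

definition add_gate :: prog where
  "add_gate =
     Store (''D'', ''kind'') D_size (reg 2) ;;
     Store (''D'', ''degree'') D_size (reg 3) ;;
     Store (''D'', ''var'') D_size (reg 4) ;;
     Store (''D'', ''offset'') D_size (Plus D_size D_size) ;;
     Store (''D'', ''wire'') (Plus D_size D_size) (reg 5) ;;
     Store (''D'', ''wire'') (Plus (Plus D_size D_size) (Num 1)) (reg 6) ;;
     Store (''D'', ''size'') (Num 0) (Plus D_size (Num 1))"

lemma wp_add_gate:
  assumes D: "D_mem s gs"
    and kd: "s regs 2 = gate_kind G" and dg: "s regs 3 = length (gate_inputs G)"
    and vr: "\<And>x. G = GVar x \<Longrightarrow> s regs 4 = x"
    and ip: "length (gate_inputs G) \<le> 2"
      "0 < length (gate_inputs G) \<Longrightarrow> s regs 5 = gate_inputs G ! 0"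
      "1 < length (gate_inputs G) \<Longrightarrow> s regs 6 = gate_inputs G ! 1"
    and Q: "\<And>t. D_mem t (gs @ [G]) \<Longrightarrow> (\<And>a. fst a \<noteq> ''D'' \<Longrightarrow> t a = s a) \<Longrightarrow> Q 47 t"
  shows "wp add_gate s Q"
proof -
  have sz: "s (''D'', ''size'') 0 = length gs" using D by (simp add: D_mem_def)
  let ?n = "length gs"
  let ?t = "s((''D'', ''kind'') := (s (''D'', ''kind''))(?n := s regs 2),
      (''D'', ''degree'') := (s (''D'', ''degree''))(?n := s regs 3),
      (''D'', ''var'') := (s (''D'', ''var''))(?n := s regs 4),
      (''D'', ''offset'') := (s (''D'', ''offset''))(?n := ?n + ?n),
      (''D'', ''wire'') := (s (''D'', ''wire''))(?n + ?n := s regs 5, ?n + ?n + 1 := s regs 6),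
      (''D'', ''size'') := (s (''D'', ''size''))(0 := ?n + 1))"
  have "D_mem ?t (gs @ [G])"
    unfolding D_mem_def
  proof (intro conjI allI impI)
    show "?t (''D'', ''size'') 0 = length (gs @ [G])" by simp
    fix g assume g: "g < length (gs @ [G])"
    show "?t (''D'', ''kind'') g = gate_kind ((gs @ [G]) ! g)"
      "?t (''D'', ''degree'') g = length (gate_inputs ((gs @ [G]) ! g))"
      "?t (''D'', ''offset'') g = 2 * g" "length (gate_inputs ((gs @ [G]) ! g)) \<le> 2"
      using D g kd dg ip(1) by (auto simp: D_mem_def nth_append)
    show "?t (''D'', ''var'') g = x" if "(gs @ [G]) ! g = GVar x" for x
      using D g vr that by (auto simp: D_mem_def nth_append split: if_splits)
    fix l assume l: "l < length (gate_inputs ((gs @ [G]) ! g))"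
    show "?t (''D'', ''wire'') (2 * g + l) = gate_inputs ((gs @ [G]) ! g) ! l"
    proof (cases "g = ?n")
      case True
      then have "l < length (gate_inputs G)" using l by simp
      moreover from this ip(1) have "l = 0 \<or> l = 1" by auto
      ultimately show ?thesis using True ip(2,3) by auto
    next
      case False
      then have "g < ?n" using g by simp
      moreover have "l < length (gate_inputs (gs ! g))" using l \<open>g < ?n\<close> by (simp add: nth_append)
      \<comment> \<open>At most two inputs per gate, so older wires lie strictly below the cells
        just written.\<close>
      moreover have "2 * g + l < ?n + ?n" using D calculation by (fastforce simp: D_mem_def)
      ultimately show ?thesis using D by (simp add: D_mem_def nth_append)
    qed
  qed
  moreover have "?t a = s a" if "fst a \<noteq> ''D''" for a
  proof -
    have "a \<noteq> (''D'', f)" for f using that by (cases a) simp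
    then show ?thesis by (simp only: fun_upd_other not_False_eq_True)
  qed
  ultimately have "Q 47 ?t" by (rule Q)
  then show ?thesis unfolding add_gate_def by (simp add: wp_simps sz del: One_nat_def)
qed

section \<open>Transforming the top family\<close>

definition map_prog :: "prog \<Rightarrow> prog" where
  "map_prog c =
     set_reg 12 (Minus (reg 10) (reg 9)) ;;
     While (Minus (reg 10) (reg 12))
       (set_reg 0 (Load stack_state (reg 12)) ;; set_reg 1 (Load stack_gate (reg 12)) ;; c ;;
        Store stack_state (reg 12) (reg 0) ;; Store stack_gate (reg 12) (reg 1) ;;
        set_reg 12 (Plus (reg 12) (Num 1)))"

lemma wp_map_prog:
  assumes impl: "\<And>t. masks_ready ix i j t \<Longrightarrow> t regs 8 = s regs 8 \<Longrightarrow> implements t c C f k"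
    and m: "masks_ready ix i j s"
    and sp: "s regs 10 = b + N" "s regs 9 = N" "N = 2 ^ s regs 8"
    and S: "\<And>e. e < N \<Longrightarrow> s stack_state (b + e) < N"
    and Q: "\<And>n t. n \<le> N * (C + 40) + 20 \<Longrightarrow>
      (\<And>a. a \<noteq> regs \<Longrightarrow> a \<noteq> stack_gate \<Longrightarrow> a \<noteq> stack_state \<Longrightarrow> t a = s a) \<Longrightarrow>
      (\<And>r. 8 \<le> r \<Longrightarrow> r \<noteq> 12 \<Longrightarrow> t regs r = s regs r) \<Longrightarrow>
      (\<And>q. q < b \<Longrightarrow> t stack_gate q = s stack_gate q \<and> t stack_state q = s stack_state q) \<Longrightarrow>
      (\<And>e. e < N \<Longrightarrow> t stack_gate (b + e) = k (s stack_state (b + e)) (s stack_gate (b + e)) \<and>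
         t stack_state (b + e) = f (s stack_state (b + e)) \<and> f (s stack_state (b + e)) < N) \<Longrightarrow> Q n t"
  shows "wp (map_prog c) s Q"
proof -
  define I where "I n t \<longleftrightarrow>
      (\<forall>a. a \<noteq> regs \<longrightarrow> a \<noteq> stack_gate \<longrightarrow> a \<noteq> stack_state \<longrightarrow> t a = s a) \<and>
      (\<forall>r. 8 \<le> r \<longrightarrow> r \<noteq> 12 \<longrightarrow> t regs r = s regs r) \<and> t regs 12 = b + n \<and>
      (\<forall>q. q < b \<or> b + n \<le> q \<longrightarrow> t stack_gate q = s stack_gate q \<and> t stack_state q = s stack_state q) \<and>
      (\<forall>e < n. t stack_gate (b + e) = k (s stack_state (b + e)) (s stack_gate (b + e)) \<and>
         t stack_state (b + e) = f (s stack_state (b + e)) \<and> f (s stack_state (b + e)) < N)" for n t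
  let ?e = "Minus (reg 10) (reg 12)"
  let ?pre = "set_reg 0 (Load stack_state (reg 12)) ;; set_reg 1 (Load stack_gate (reg 12)) ;; c ;;
        Store stack_state (reg 12) (reg 0) ;; Store stack_gate (reg 12) (reg 1) ;;
        set_reg 12 (Plus (reg 12) (Num 1))"
  have step: "expr_val ?e t \<noteq> 0 \<and> wp ?pre t (\<lambda>n' u. n' + expr_cost ?e + 1 \<le> C + 40 \<and> I (Suc n) u)"
    if n: "n < N" and I: "I n t" for n t
  proof -
    have t: "\<And>a. a \<noteq> regs \<Longrightarrow> a \<noteq> stack_gate \<Longrightarrow> a \<noteq> stack_state \<Longrightarrow> t a = s a"
      "\<And>r. 8 \<le> r \<Longrightarrow> r \<noteq> 12 \<Longrightarrow> t regs r = s regs r" "t regs 12 = b + n"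
      "\<And>q. q < b \<or> b + n \<le> q \<Longrightarrow> t stack_gate q = s stack_gate q \<and> t stack_state q = s stack_state q"
      "\<And>e. e < n \<Longrightarrow> t stack_gate (b + e) = k (s stack_state (b + e)) (s stack_gate (b + e)) \<and>
         t stack_state (b + e) = f (s stack_state (b + e)) \<and> f (s stack_state (b + e)) < N"
      using I unfolding I_def by blast+
    let ?x = "s stack_state (b + n)" and ?g = "s stack_gate (b + n)"
    let ?t = "t(regs := (t regs)(0 := ?x, 1 := ?g))"
    have m': "masks_ready ix i j ?t"
      using m t(1,2) by (simp add: masks_ready_def powers_ready_def)
    have r8: "?t regs 8 = s regs 8" using t(2) by simp
    have "wp c ?t (\<lambda>n' u. n' \<le> C \<and> frame ?t u \<and> u regs 0 = f ?x \<and> u regs 1 = k ?x ?g \<and> f ?x < 2 ^ ?t regs 8)"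
    proof -
      have "?x < 2 ^ ?t regs 8" using S[OF n] r8 sp(3) by simp
      then show ?thesis using impl[OF m' r8] frame_refl[of ?t] unfolding implements_def by fastforce
    qed
    then have w: "wp c ?t (\<lambda>n' u. n' \<le> C \<and> I (Suc n) (u(stack_state := (u stack_state)(u regs 12 := u regs 0),
        stack_gate := (u stack_gate)(u regs 12 := u regs 1),
        regs := (u regs)(12 := u regs 12 + 1))))"
    proof (rule wp_mono, elim conjE, intro conjI)
      fix n' u assume u: "frame ?t u" "u regs 0 = f ?x" "u regs 1 = k ?x ?g" "f ?x < 2 ^ ?t regs 8"
      have ua: "u a = t a" if "a \<noteq> regs" for a using frame_array[OF u(1) that] that by simp
      have ur: "u regs r = t regs r" if "8 \<le> r" for r using u(1) that by (simp add: frame_def)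
      show "I (Suc n) (u(stack_state := (u stack_state)(u regs 12 := u regs 0),
        stack_gate := (u stack_gate)(u regs 12 := u regs 1),
        regs := (u regs)(12 := u regs 12 + 1)))" (is "I _ ?u")
        unfolding I_def
      proof (intro conjI allI impI)
        show "?u a = s a" if "a \<noteq> regs" "a \<noteq> stack_gate" "a \<noteq> stack_state" for a
          using that ua t(1) by simp
        show "?u regs r = s regs r" if "8 \<le> r" "r \<noteq> 12" for r using that ur t(2) by simp
        show "?u regs 12 = b + Suc n" using ur t(3) by simp
        show "?u stack_gate q = s stack_gate q" "?u stack_state q = s stack_state q"
          if "q < b \<or> b + Suc n \<le> q" for q
          using that ur t(3) ua t(4)[of q] by auto
        fix e assume e: "e < Suc n"
        have r8': "?t regs 8 = s regs 8" using t(2) by simp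
        show "?u stack_gate (b + e) = k (s stack_state (b + e)) (s stack_gate (b + e))"
          "?u stack_state (b + e) = f (s stack_state (b + e))" "f (s stack_state (b + e)) < N"
          using e u(2,3,4) ur t(3) ua t(5)[of e] r8' sp(3) by (auto simp: less_Suc_eq)
      qed
    qed
    have "expr_val ?e t \<noteq> 0" using t(2,3) sp n by simp
    moreover have "wp ?pre t (\<lambda>n' u. n' + expr_cost ?e + 1 \<le> C + 40 \<and> I (Suc n) u)"
      unfolding wp_Seq wp_Store using t(3) t(4)[of "b + n"]
      by (simp del: One_nat_def) (rule wp_mono[OF w], simp)
    ultimately show ?thesis ..
  qed
  let ?s = "s(regs := (s regs)(12 := b))"
  have init: "I 0 ?s" by (auto simp: I_def)
  have exit: "expr_val ?e t = 0" if "I N t" for t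
    using that sp by (simp add: I_def)
  have fin: "Q (expr_cost (Num 12) + expr_cost (Minus (reg 10) (reg 9)) + 1 + n) t"
    if "n \<le> N * (C + 40) + expr_cost ?e + 1" "I N t" for n t
    by (rule Q) (use that in \<open>auto simp: I_def\<close>)
  show ?thesis unfolding map_prog_def wp_Seq wp_Store
    by (rule wp_While_count[where I = I and k = N and C = "C + 40", OF _ step exit fin])
      (use init sp in simp_all)
qed

section \<open>Disjoint union\<close>

text \<open>Emits the three gates of \<open>join_gates\<close>. Cell 0 saves the joint state, as
  cell 5 is needed for inputs; \<open>Minus D_size (Num 1)\<close> names the gate just emitted, and
  the degree 2 stays in cell 3 for the last gate.\<close>

definition union_pair :: prog where
  "union_pair =
     set_reg 2 (Load stack_state (reg 12)) ;; set_reg 3 (Load stack_state (reg 13)) ;;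
     or_prog ;; set_reg 0 (reg 5) ;;
     set_reg 2 (Num 5) ;; set_reg 3 (Num 1) ;; set_reg 5 (Load stack_gate (reg 13)) ;; add_gate ;;
     set_reg 2 (Num 4) ;; set_reg 3 (Num 2) ;; set_reg 5 (Load stack_gate (reg 12)) ;;
     set_reg 6 (Minus D_size (Num 1)) ;; add_gate ;;
     set_reg 2 (Num 5) ;; set_reg 5 (Load accum (reg 0)) ;; set_reg 6 (Minus D_size (Num 1)) ;; add_gate ;;
     Store accum (reg 0) (Minus D_size (Num 1))"

lemma wp_union_pair:
  assumes pr: "powers_ready s" and D: "D_mem s gs"
    and x: "s stack_state (s regs 12) < 2 ^ s regs 8" and y: "s stack_state (s regs 13) < 2 ^ s regs 8"
    and r: "r = Bit_Operations.or (s stack_state (s regs 12)) (s stack_state (s regs 13))"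
    and Q: "\<And>n t. n \<le> or_cost s + 260 \<Longrightarrow>
      D_mem t (gs @ join_gates gs (s stack_gate (s regs 12)) (s stack_gate (s regs 13)) (s accum r)) \<Longrightarrow>
      t accum = (s accum)(r := length gs + 2) \<Longrightarrow>
      (\<And>a. fst a \<noteq> ''D'' \<Longrightarrow> a \<noteq> regs \<Longrightarrow> a \<noteq> accum \<Longrightarrow> t a = s a) \<Longrightarrow>
      (\<And>i. 8 \<le> i \<Longrightarrow> t regs i = s regs i) \<Longrightarrow> Q n t"
  shows "wp union_pair s Q"
proof -
  let ?g1 = "s stack_gate (s regs 12)" and ?g2 = "s stack_gate (s regs 13)"
  let ?s = "s(regs := (s regs)(2 := s stack_state (s regs 12), 3 := s stack_state (s regs 13)))"
  have fr: "frame s ?s" by (simp add: frame_def)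
  have size: "t (''D'', ''size'') 0 = length hs" if "D_mem t hs" for t hs using that by (simp add: D_mem_def)
  show ?thesis unfolding union_pair_def wp_Seq wp_Store
    apply (simp del: One_nat_def)
    apply (rule wp_or_prog)
    subgoal by (rule powers_ready_frame[OF fr pr])
    subgoal using x by simp
    subgoal using y by simp
    subgoal premises p1 for n1 t1
    proof -
      have a1: "t1 a = s a" if "a \<noteq> regs" for a using frame_array[OF p1(2) that] that by simp
      have r1: "t1 regs i = s regs i" if "8 \<le> i" for i using p1(2) that by (simp add: frame_def)
      have v1: "t1 regs 5 = r" using p1(5) r by simp
      have D1: "D_mem t1 gs" by (rule D_mem_cong[OF D]) (simp add: a1)
      show ?thesis
        apply (rule wp_add_gate[where gs = gs and G = "GOr [?g2]"])
        subgoal by (rule D_mem_cong[OF D1]) simp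
        subgoal by simp
        subgoal by simp
        subgoal by simp
        subgoal by simp
        subgoal by (simp add: a1 r1)
        subgoal by simp
        subgoal premises p2 for t2
        proof -
          have a2: "t2 a = s a" if "a \<noteq> regs" "fst a \<noteq> ''D''" for a using p2(2)[OF that(2)] that a1 by simp
          have r2: "t2 regs i = s regs i" if "8 \<le> i" for i using p2(2)[of regs] that r1 by simp
          have v2: "t2 regs 0 = r" using p2(2)[of regs] v1 by simp
          show ?thesis
            apply (rule wp_add_gate[where gs = "gs @ [GOr [?g2]]" and G = "GAnd [?g1, length gs]"])
            subgoal by (rule D_mem_cong[OF p2(1)]) simp
            subgoal by simp
            subgoal by simp
            subgoal by simp
            subgoal by simp
            subgoal by (simp add: a2 r2)
            subgoal by (simp add: size[OF p2(1)])
            subgoal premises p3 for t3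
            proof -
              have a3: "t3 a = s a" if "a \<noteq> regs" "fst a \<noteq> ''D''" for a using p3(2)[OF that(2)] that a2 by simp
              have r3: "t3 regs i = s regs i" if "8 \<le> i" for i using p3(2)[of regs] that r2 by simp
              have v3: "t3 regs 0 = r" "t3 regs 3 = 2" using p3(2)[of regs] v2 by simp_all
              show ?thesis
                apply (rule wp_add_gate[where gs = "gs @ [GOr [?g2], GAnd [?g1, length gs]]"
                      and G = "GOr [s accum r, Suc (length gs)]"])
                subgoal by (rule D_mem_cong[of t3]) (use p3(1) in simp_all)
                subgoal by simp
                subgoal by (simp add: v3)
                subgoal by simp
                subgoal by simp
                subgoal by (simp add: a3 v3)
                subgoal by (simp add: size[OF p3(1)])
                subgoal premises p4 for t4
                proof -
                  have a4: "t4 a = s a" if "a \<noteq> regs" "fst a \<noteq> ''D''" for a using p4(2)[OF that(2)] that a3 by simp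
                  have r4: "t4 regs i = s regs i" if "8 \<le> i" for i using p4(2)[of regs] that r3 by simp
                  have v4: "t4 regs 0 = r" using p4(2)[of regs] v3 by simp
                  show ?thesis
                  proof (rule Q)
                    show "D_mem (t4(accum := (t4 accum)(t4 regs 0 := t4 (''D'', ''size'') 0 - 1)))
                        (gs @ join_gates gs ?g1 ?g2 (s accum r))"
                      by (rule D_mem_cong[of t4]) (use p4(1) in \<open>simp_all add: join_gates_def\<close>)
                  qed (use p1(1) size[OF p4(1)] a4 r4 v4 in \<open>auto simp: or_cost_def\<close>)
                qed
                done
            qed
            done
        qed
        done
    qed
    done
qed

text \<open>The new gates are collected in \<open>accum\<close>, indexed by state, because both
  families on the stack are still read up to the last pair. Copying them over the lower family also
  resets \<open>accum\<close> to gate 0 for the next union.\<close>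

definition union_prog :: prog where
  "union_prog =
     set_reg 12 (Minus (Minus (reg 10) (reg 9)) (reg 9)) ;;
     While (Minus (Minus (reg 10) (reg 9)) (reg 12))
       (set_reg 13 (Minus (reg 10) (reg 9)) ;;
        While (Minus (reg 10) (reg 13)) (union_pair ;; set_reg 13 (Plus (reg 13) (Num 1))) ;;
        set_reg 12 (Plus (reg 12) (Num 1))) ;;
     set_reg 12 (Num 0) ;;
     While (Minus (reg 9) (reg 12))
       (set_reg 13 (Plus (Minus (Minus (reg 10) (reg 9)) (reg 9)) (reg 12)) ;;
        Store stack_gate (reg 13) (Load accum (reg 12)) ;; Store stack_state (reg 13) (reg 12) ;;
        Store accum (reg 12) (Num 0) ;; set_reg 12 (Plus (reg 12) (Num 1))) ;;
     set_reg 10 (Minus (reg 10) (reg 9))"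

lemma wp_union_copy:
  assumes sp: "s regs 10 = b + N + N" "s regs 9 = N" and s12: "s regs 12 = 0"
    and acc: "\<And>r. N \<le> r \<Longrightarrow> s accum r = 0"
    and Q: "\<And>n t. n \<le> N * 50 + 20 \<Longrightarrow>
      (\<And>a. a \<noteq> regs \<Longrightarrow> a \<noteq> accum \<Longrightarrow> a \<noteq> stack_gate \<Longrightarrow> a \<noteq> stack_state \<Longrightarrow> t a = s a) \<Longrightarrow>
      (\<And>i. 8 \<le> i \<Longrightarrow> i \<noteq> 12 \<Longrightarrow> i \<noteq> 13 \<Longrightarrow> t regs i = s regs i) \<Longrightarrow>
      t accum = (\<lambda>_. 0) \<Longrightarrow>
      (\<And>q. q < b \<Longrightarrow> t stack_gate q = s stack_gate q \<and> t stack_state q = s stack_state q) \<Longrightarrow>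
      (\<And>e. e < N \<Longrightarrow> t stack_gate (b + e) = s accum e \<and> t stack_state (b + e) = e) \<Longrightarrow> Q n t"
  shows "wp (While (Minus (reg 9) (reg 12))
       (set_reg 13 (Plus (Minus (Minus (reg 10) (reg 9)) (reg 9)) (reg 12)) ;;
        Store stack_gate (reg 13) (Load accum (reg 12)) ;; Store stack_state (reg 13) (reg 12) ;;
        Store accum (reg 12) (Num 0) ;; set_reg 12 (Plus (reg 12) (Num 1)))) s Q"
proof -
  define I where "I n t \<longleftrightarrow>
      (\<forall>a. a \<noteq> regs \<longrightarrow> a \<noteq> accum \<longrightarrow> a \<noteq> stack_gate \<longrightarrow> a \<noteq> stack_state \<longrightarrow> t a = s a) \<and>
      (\<forall>i. 8 \<le> i \<longrightarrow> i \<noteq> 12 \<longrightarrow> i \<noteq> 13 \<longrightarrow> t regs i = s regs i) \<and> t regs 12 = n \<and>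
      t accum = (\<lambda>r. if r < n then 0 else s accum r) \<and>
      (\<forall>q < b. t stack_gate q = s stack_gate q \<and> t stack_state q = s stack_state q) \<and>
      (\<forall>e < n. t stack_gate (b + e) = s accum e \<and> t stack_state (b + e) = e)" for n t
  show ?thesis
  proof (rule wp_While_count[where I = I and k = N and C = 50])
    show "I 0 s" using s12 by (simp add: I_def)
    show "expr_val (Minus (reg 9) (reg 12)) t = 0" if "I N t" for t
      using that sp by (simp add: I_def)
    show "Q n t" if "n \<le> N * 50 + expr_cost (Minus (reg 9) (reg 12)) + 1" "I N t" for n t
      by (rule Q) (use that acc in \<open>auto simp: I_def fun_eq_iff\<close>)
    fix n t assume n: "n < N" and "I n t"
    then have t: "\<And>a. a \<noteq> regs \<Longrightarrow> a \<noteq> accum \<Longrightarrow> a \<noteq> stack_gate \<Longrightarrow> a \<noteq> stack_state \<Longrightarrow> t a = s a"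
      "\<forall>i. 8 \<le> i \<longrightarrow> i \<noteq> 12 \<longrightarrow> i \<noteq> 13 \<longrightarrow> t regs i = s regs i" "t regs 12 = n"
      "t accum = (\<lambda>r. if r < n then 0 else s accum r)"
      "\<forall>q < b. t stack_gate q = s stack_gate q \<and> t stack_state q = s stack_state q"
      "\<forall>e < n. t stack_gate (b + e) = s accum e \<and> t stack_state (b + e) = e"
      unfolding I_def by blast+
    have sp': "t regs 10 = b + N + N" "t regs 9 = N" using sp t(2) by simp_all
    let ?u = "t(stack_gate := (t stack_gate)(b + n := s accum n), stack_state := (t stack_state)(b + n := n),
      accum := (t accum)(n := 0), regs := (t regs)(13 := b + n, 12 := n + 1))"
    have "I (Suc n) ?u"
      unfolding I_def
    proof (intro conjI allI impI)
      show "?u a = s a" if "a \<noteq> regs" "a \<noteq> accum" "a \<noteq> stack_gate" "a \<noteq> stack_state" for a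
        using that t(1) by simp
      show "?u regs i = s regs i" if "8 \<le> i" "i \<noteq> 12" "i \<noteq> 13" for i using that t(2) by simp
      show "?u regs 12 = Suc n" by simp
      show "?u accum = (\<lambda>r. if r < Suc n then 0 else s accum r)" using t(4) by (auto simp: fun_eq_iff)
      show "?u stack_gate q = s stack_gate q" "?u stack_state q = s stack_state q" if "q < b" for q
        using t(5) that by auto
      show "?u stack_gate (b + e) = s accum e" "?u stack_state (b + e) = e" if "e < Suc n" for e
        using t(6) that by (auto simp: less_Suc_eq)
    qed
    then show "expr_val (Minus (reg 9) (reg 12)) t \<noteq> 0 \<and>
      wp (set_reg 13 (Plus (Minus (Minus (reg 10) (reg 9)) (reg 9)) (reg 12)) ;;
        Store stack_gate (reg 13) (Load accum (reg 12)) ;; Store stack_state (reg 13) (reg 12) ;;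
        Store accum (reg 12) (Num 0) ;; set_reg 12 (Plus (reg 12) (Num 1))) t
       (\<lambda>n' t. n' + expr_cost (Minus (reg 9) (reg 12)) + 1 \<le> 50 \<and> I (Suc n) t)"
      using sp' n t(3,4) by (simp add: wp_simps fun_upd_twist del: One_nat_def)
  qed
qed

lemma wp_union_prog:
  assumes sp: "s regs 10 = b + N + N" "s regs 9 = N" "N = 2 ^ s regs 8"
    and pr: "powers_ready s" and D: "D_mem s gs0" and gs0: "dnnf_list0 gs0"
    and F1: "family_sound N gs0 V1 G1 S1" and F2: "family_sound N gs0 V2 G2 S2"
    and st: "\<And>e. e < N \<Longrightarrow> s stack_gate (b + e) = G1 e \<and> s stack_state (b + e) = S1 e"
      "\<And>e. e < N \<Longrightarrow> s stack_gate (b + N + e) = G2 e \<and> s stack_state (b + N + e) = S2 e"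
    and V: "V1 \<inter> V2 = {}" and acc: "s accum = (\<lambda>_. 0)"
    and Q: "\<And>n t gs A. n \<le> N * (N * (or_cost s + 300) + 100) + 100 \<Longrightarrow>
      D_mem t gs \<Longrightarrow> union_inv N gs0 (V1 \<union> V2) G1 S1 G2 S2 gs A ({..<N} \<times> {..<N}) \<Longrightarrow>
      length gs = length gs0 + 3 * (N * N) \<Longrightarrow>
      (\<And>a. fst a \<noteq> ''D'' \<Longrightarrow> a \<noteq> regs \<Longrightarrow> a \<noteq> stack_gate \<Longrightarrow> a \<noteq> stack_state \<Longrightarrow> t a = s a) \<Longrightarrow>
      (\<And>i. 8 \<le> i \<Longrightarrow> i \<noteq> 10 \<Longrightarrow> i \<noteq> 12 \<Longrightarrow> i \<noteq> 13 \<Longrightarrow> t regs i = s regs i) \<Longrightarrow>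
      t regs 10 = b + N \<Longrightarrow>
      (\<And>q. q < b \<Longrightarrow> t stack_gate q = s stack_gate q \<and> t stack_state q = s stack_state q) \<Longrightarrow>
      (\<And>e. e < N \<Longrightarrow> t stack_gate (b + e) = A e \<and> t stack_state (b + e) = e) \<Longrightarrow> Q n t"
  shows "wp union_prog s Q"
proof -
  \<comment> \<open>The pairs that precede \<open>(i, j)\<close> in the order of the two nested
    loops.\<close>
  define P where "P i j = {(e1, e2). e1 < i \<and> e2 < N \<or> e1 = i \<and> e2 < j}" for i j :: nat
  define J where "J i j t \<longleftrightarrow> (\<exists>gs. D_mem t gs \<and> union_inv N gs0 (V1 \<union> V2) G1 S1 G2 S2 gs (t accum) (P i j) \<and>
      length gs = length gs0 + 3 * (i * N + j)) \<and> (\<forall>r\<ge>N. t accum r = 0) \<and>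
      (\<forall>a. fst a \<noteq> ''D'' \<longrightarrow> a \<noteq> regs \<longrightarrow> a \<noteq> accum \<longrightarrow> t a = s a) \<and>
      (\<forall>r. 8 \<le> r \<longrightarrow> r \<noteq> 12 \<longrightarrow> r \<noteq> 13 \<longrightarrow> t regs r = s regs r) \<and> t regs 12 = b + i" for i j t
  have J_cong: "J i j u" if "J i j t" "\<And>a. a \<noteq> regs \<Longrightarrow> u a = t a"
    "\<And>r. 8 \<le> r \<Longrightarrow> r \<noteq> 13 \<Longrightarrow> u regs r = t regs r" for i j t u
  proof -
    from that(1) obtain gs where J: "D_mem t gs" "union_inv N gs0 (V1 \<union> V2) G1 S1 G2 S2 gs (t accum) (P i j)"
      "length gs = length gs0 + 3 * (i * N + j)" "\<forall>r\<ge>N. t accum r = 0"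
      "\<And>a. fst a \<noteq> ''D'' \<Longrightarrow> a \<noteq> regs \<Longrightarrow> a \<noteq> accum \<Longrightarrow> t a = s a"
      "\<forall>r. 8 \<le> r \<longrightarrow> r \<noteq> 12 \<longrightarrow> r \<noteq> 13 \<longrightarrow> t regs r = s regs r" "t regs 12 = b + i"
      unfolding J_def by blast
    have "D_mem u gs" by (rule D_mem_cong[OF J(1)]) (simp add: that(2))
    moreover have "u accum = t accum" using that(2) by simp
    ultimately show ?thesis using J that(2,3) unfolding J_def by (intro conjI exI[of _ gs] allI impI) simp_all
  qed
  have PN: "P i N = P (Suc i) 0" for i by (auto simp: P_def less_Suc_eq)
  have PS: "P i (Suc j) = insert (i, j) (P i j)" for i j by (auto simp: P_def less_Suc_eq)
  have P0: "P 0 0 = {}" and PP: "P N 0 = {..<N} \<times> {..<N}" by (auto simp: P_def)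
  have or_less: "Bit_Operations.or (S1 i) (S2 j) < N" if "i < N" "j < N" for i j
    using F1 F2 that unfolding sp(3) family_sound_def by (intro or_less_exp) auto
  let ?inner = "union_pair ;; set_reg 13 (Plus (reg 13) (Num 1))"
  let ?ie = "Minus (reg 10) (reg 13)"
  have inner: "expr_val ?ie t \<noteq> 0 \<and> wp ?inner t (\<lambda>n u. n + expr_cost ?ie + 1 \<le> or_cost s + 290 \<and>
      (J i (Suc j) u \<and> u regs 13 = b + N + Suc j))"
    if i: "i < N" and j: "j < N" and I: "J i j t \<and> t regs 13 = b + N + j" for i j t
  proof -
    from I obtain gs where Dt: "D_mem t gs" and inv: "union_inv N gs0 (V1 \<union> V2) G1 S1 G2 S2 gs (t accum) (P i j)"
      and len: "length gs = length gs0 + 3 * (i * N + j)" and ac: "\<forall>r\<ge>N. t accum r = 0"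
      and ar: "\<And>a. fst a \<noteq> ''D'' \<Longrightarrow> a \<noteq> regs \<Longrightarrow> a \<noteq> accum \<Longrightarrow> t a = s a"
      and rg: "\<forall>r. 8 \<le> r \<longrightarrow> r \<noteq> 12 \<longrightarrow> r \<noteq> 13 \<longrightarrow> t regs r = s regs r"
      and r12: "t regs 12 = b + i" and r13: "t regs 13 = b + N + j"
      unfolding J_def by blast
    have val: "t stack_gate (t regs 12) = G1 i" "t stack_state (t regs 12) = S1 i"
      "t stack_gate (t regs 13) = G2 j" "t stack_state (t regs 13) = S2 j"
      using st(1)[OF i] st(2)[OF j] ar r12 r13 by simp_all
    have less: "S1 i < N" "S2 j < N" "G1 i < length gs0" "G2 j < length gs0"
      "gate_vars gs0 (G1 i) \<subseteq> V1" "gate_vars gs0 (G2 j) \<subseteq> V2"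
      using F1 F2 i j by (auto simp: family_sound_def)
    have "wp ?inner t (\<lambda>n u. n + expr_cost ?ie + 1 \<le> or_cost s + 290 \<and>
      (J i (Suc j) u \<and> u regs 13 = b + N + Suc j))"
      unfolding wp_Seq
    proof (rule wp_union_pair)
      show "powers_ready t" using pr ar rg by (simp add: powers_ready_def)
      show "D_mem t gs" by fact
      show "t stack_state (t regs 12) < 2 ^ t regs 8" "t stack_state (t regs 13) < 2 ^ t regs 8"
        using val less rg sp(3) by simp_all
      show "Bit_Operations.or (S1 i) (S2 j) = Bit_Operations.or (t stack_state (t regs 12)) (t stack_state (t regs 13))"
        using val by simp
    next
      let ?r = "Bit_Operations.or (S1 i) (S2 j)"
      fix n u assume n: "n \<le> or_cost t + 260"
        and Du: "D_mem u (gs @ join_gates gs (t stack_gate (t regs 12)) (t stack_gate (t regs 13)) (t accum ?r))"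
        and au: "u accum = (t accum)(?r := length gs + 2)"
        and aru: "\<And>a. fst a \<noteq> ''D'' \<Longrightarrow> a \<noteq> regs \<Longrightarrow> a \<noteq> accum \<Longrightarrow> u a = t a"
        and rgu: "\<And>i. 8 \<le> i \<Longrightarrow> u regs i = t regs i"
      let ?gs = "gs @ join_gates gs (G1 i) (G2 j) (t accum ?r)"
      have "union_inv N gs0 (V1 \<union> V2) G1 S1 G2 S2 ?gs (u accum) (P i (Suc j))"
        unfolding au PS
        by (rule union_inv_step[OF inv dnnf_list0D[OF gs0] less(3,5) less(4,6) V]) (use or_less[OF i j] in auto)
      moreover have "length ?gs = length gs0 + 3 * (i * N + Suc j)" using len by (simp add: join_gates_def)
      moreover have "u accum r = 0" if "N \<le> r" for r using au ac or_less[OF i j] that by auto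
      ultimately have "J i (Suc j) u"
        using Du aru rgu ar rg r12 unfolding J_def val by (intro conjI exI[of _ ?gs] allI impI) simp_all
      then have "J i (Suc j) (u(regs := (u regs)(13 := u regs 13 + 1)))"
        by (rule J_cong) auto
      moreover have "or_cost t = or_cost s" using rg by (simp add: or_cost_def)
      ultimately show "wp (set_reg 13 (Plus (reg 13) (Num 1))) u (\<lambda>n' v. n + n' + expr_cost ?ie + 1 \<le> or_cost s + 290 \<and>
          (J i (Suc j) v \<and> v regs 13 = b + N + Suc j))"
        using n rgu r13 by (simp add: wp_simps)
    qed
    moreover have "expr_val ?ie t \<noteq> 0" using rg r13 sp j by simp
    ultimately show ?thesis by blast
  qed
  let ?oe = "Minus (Minus (reg 10) (reg 9)) (reg 12)"
  let ?outer = "set_reg 13 (Minus (reg 10) (reg 9)) ;; While ?ie ?inner ;; set_reg 12 (Plus (reg 12) (Num 1))"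
  have outer: "expr_val ?oe t \<noteq> 0 \<and> wp ?outer t (\<lambda>n u. n + expr_cost ?oe + 1 \<le> N * (or_cost s + 290) + 50 \<and>
      J (Suc i) 0 u)" if i: "i < N" and I: "J i 0 t" for i t
  proof -
    have tr: "t regs 10 = b + N + N" "t regs 9 = N" "t regs 12 = b + i" using I sp unfolding J_def by auto
    have "wp ?outer t (\<lambda>n u. n + expr_cost ?oe + 1 \<le> N * (or_cost s + 290) + 50 \<and> J (Suc i) 0 u)"
      unfolding wp_Seq wp_Store
    proof (rule wp_While_count[where I = "\<lambda>j u. J i j u \<and> u regs 13 = b + N + j" and k = N and C = "or_cost s + 290"])
      let ?t = "t(regs := (t regs)(expr_val (Num 13) t := expr_val (Minus (reg 10) (reg 9)) t))"
      have "J i 0 ?t" by (rule J_cong[OF I]) auto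
      then show "J i 0 ?t \<and> ?t regs 13 = b + N + 0" using tr by simp
    next
      fix j u assume "j < N" "J i j u \<and> u regs 13 = b + N + j"
      then show "expr_val ?ie u \<noteq> 0 \<and> wp ?inner u (\<lambda>n u. n + expr_cost ?ie + 1 \<le> or_cost s + 290 \<and>
          (J i (Suc j) u \<and> u regs 13 = b + N + Suc j))" by (rule inner[OF i])
    next
      fix u assume u: "J i N u \<and> u regs 13 = b + N + N"
      then show "expr_val ?ie u = 0" using sp by (simp add: J_def)
    next
      fix n u assume n: "n \<le> N * (or_cost s + 290) + expr_cost ?ie + 1" and u: "J i N u \<and> u regs 13 = b + N + N"
      let ?v = "u(regs := (u regs)(12 := u regs 12 + 1))"
      from u obtain gs where "D_mem u gs" "union_inv N gs0 (V1 \<union> V2) G1 S1 G2 S2 gs (u accum) (P i N)"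
        "length gs = length gs0 + 3 * (i * N + N)" unfolding J_def by blast
      then have "D_mem ?v gs \<and> union_inv N gs0 (V1 \<union> V2) G1 S1 G2 S2 gs (?v accum) (P (Suc i) 0) \<and>
        length gs = length gs0 + 3 * (Suc i * N + 0)"
        using D_mem_cong[of u gs ?v] by (simp add: PN)
      moreover have "\<forall>a. fst a \<noteq> ''D'' \<longrightarrow> a \<noteq> regs \<longrightarrow> a \<noteq> accum \<longrightarrow> ?v a = s a"
        using u unfolding J_def by (metis fun_upd_other)
      ultimately have "J (Suc i) 0 ?v" using u unfolding J_def by (intro conjI exI[of _ gs]) auto
      then show "expr_cost (Num 13) + expr_cost (Minus (reg 10) (reg 9)) + 1 + (n + (expr_cost (Num 12) +
          expr_cost (Plus (reg 12) (Num 1)) + 1)) + expr_cost ?oe + 1 \<le> N * (or_cost s + 290) + 50 \<and>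
        J (Suc i) 0 (u(regs := (u regs)(expr_val (Num 12) u := expr_val (Plus (reg 12) (Num 1)) u)))"
        using n by (simp del: One_nat_def)
    qed
    moreover have "expr_val ?oe t \<noteq> 0" using tr i by simp
    ultimately show ?thesis by blast
  qed
  have init: "J 0 0 (s(regs := (s regs)(12 := b)))"
  proof -
    have "D_mem (s(regs := (s regs)(12 := b))) gs0" by (rule D_mem_cong[OF D]) simp
    then show ?thesis using union_inv_init[OF gs0] acc unfolding J_def P0 by auto
  qed
  have exit: "expr_val ?oe t = 0" if "J N 0 t" for t using that sp by (simp add: J_def)
  show ?thesis
    unfolding union_prog_def wp_Seq[of "While ?oe ?outer"] wp_Seq[of "set_reg 12 (Minus (Minus (reg 10) (reg 9)) (reg 9))"] wp_Store
  proof (rule wp_While_count[where I = "\<lambda>i. J i 0" and k = N and C = "N * (or_cost s + 290) + 50", OF _ outer exit])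
    show "J 0 0 (s(regs := (s regs)(expr_val (Num 12) s := expr_val (Minus (Minus (reg 10) (reg 9)) (reg 9)) s)))"
      using init sp by simp
  next
    fix n t assume n: "n \<le> N * (N * (or_cost s + 290) + 50) + expr_cost ?oe + 1" and "J N 0 t"
    then obtain gs where Dt: "D_mem t gs" and inv: "union_inv N gs0 (V1 \<union> V2) G1 S1 G2 S2 gs (t accum) (P N 0)"
      and len: "length gs = length gs0 + 3 * (N * N + 0)" and ac: "\<forall>r\<ge>N. t accum r = 0"
      and ar: "\<And>a. fst a \<noteq> ''D'' \<Longrightarrow> a \<noteq> regs \<Longrightarrow> a \<noteq> accum \<Longrightarrow> t a = s a"
      and rg: "\<forall>r. 8 \<le> r \<longrightarrow> r \<noteq> 12 \<longrightarrow> r \<noteq> 13 \<longrightarrow> t regs r = s regs r"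
      unfolding J_def by blast
    have sq: "N * (N * (or_cost s + 290)) \<le> N * (N * (or_cost s + 300))" by simp
    show "wp (set_reg 12 (Num 0) ;; While (Minus (reg 9) (reg 12))
       (set_reg 13 (Plus (Minus (Minus (reg 10) (reg 9)) (reg 9)) (reg 12)) ;;
        Store stack_gate (reg 13) (Load accum (reg 12)) ;; Store stack_state (reg 13) (reg 12) ;;
        Store accum (reg 12) (Num 0) ;; set_reg 12 (Plus (reg 12) (Num 1))) ;;
      set_reg 10 (Minus (reg 10) (reg 9))) t
      (\<lambda>m. Q (expr_cost (Num 12) + expr_cost (Minus (Minus (reg 10) (reg 9)) (reg 9)) + 1 + (n + m)))"
      unfolding wp_Seq[of "set_reg 12 (Num 0)"] wp_Seq[of "While (Minus (reg 9) (reg 12)) _"] wp_Store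
    proof (rule wp_union_copy[where b = b and N = N], goal_cases)
      case 1
      show ?case using sp rg by simp
    next
      case 2
      show ?case using sp rg by simp
    next
      case 3
      show ?case by simp
    next
      case 4
      then show ?case using ac by simp
    next
      case (5 m u)
      have len': "length gs = length gs0 + 3 * (N * N)" using len by simp
      have ua: "u a = t a" if "a \<noteq> regs" "a \<noteq> accum" "a \<noteq> stack_gate" "a \<noteq> stack_state" for a
        using 5(2)[OF that] that by simp
      have ur: "u regs i = s regs i" if "8 \<le> i" "i \<noteq> 12" "i \<noteq> 13" for i
        using 5(3)[OF that] rg that by simp
      show ?case
      proof (rule Q[OF _ _ inv[unfolded PP] len'], goal_cases)
        case 1
        show ?case using n 5(1) sq by (simp add: distrib_left)
      next
        case 2
        show ?case by (rule D_mem_cong[OF Dt]) (simp add: ua)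
      next
        case (3 a)
        then show ?case using ua ar 5(4) acc by (cases "a = accum") simp_all
      next
        case (4 i)
        then show ?case using ur by simp
      next
        case 5
        show ?case using ur sp by simp
      next
        case (6 q)
        then show ?case using 5(5)[of q] ar by simp
      next
        case (7 e)
        then show ?case using 5(6)[of e] by simp
      qed
    qed
  qed
qed

section \<open>Creating a vertex\<close>

text \<open>The table holds only \<open>2 ^ (6 * ix a)\<close> for a label \<open>a\<close>; the
  masks of its other facts follow by doubling, as there is no multiplication.\<close>

definition load_masks :: "array \<Rightarrow> expr \<Rightarrow> prog" where
  "load_masks m e =
     Store m (Num 0) (Load label_mask e) ;;
     Store m (Num 1) (Plus (Load m (Num 0)) (Load m (Num 0))) ;;
     Store m (Num 2) (Plus (Load m (Num 1)) (Load m (Num 1))) ;;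
     Store m (Num 3) (Plus (Load m (Num 2)) (Load m (Num 2))) ;;
     Store m (Num 4) (Plus (Load m (Num 3)) (Load m (Num 3))) ;;
     Store m (Num 5) (Plus (Load m (Num 4)) (Load m (Num 4)))"

lemma less_6_cases: "f < 6 \<Longrightarrow> f \<in> {0, 1, 2, 3, 4, 5}" for f :: nat
  by auto

lemma wp_load_masks:
  assumes "s label_mask (expr_val e s) = 2 ^ p"
    and Q: "\<And>t. (\<And>a. a \<noteq> m \<Longrightarrow> t a = s a) \<Longrightarrow> (\<And>f. f < 6 \<Longrightarrow> t m f = 2 ^ (p + f)) \<Longrightarrow>
      Q (expr_cost e + 38) t"
  shows "wp (load_masks m e) s Q"
proof -
  let ?v = "2 ^ p :: nat"
  let ?t = "s(m := (s m)(0 := ?v, 1 := ?v + ?v, 2 := ?v + ?v + (?v + ?v),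
      3 := ?v + ?v + (?v + ?v) + (?v + ?v + (?v + ?v)),
      4 := ?v + ?v + (?v + ?v) + (?v + ?v + (?v + ?v)) + (?v + ?v + (?v + ?v) + (?v + ?v + (?v + ?v))),
      5 := ?v + ?v + (?v + ?v) + (?v + ?v + (?v + ?v)) + (?v + ?v + (?v + ?v) + (?v + ?v + (?v + ?v))) +
       (?v + ?v + (?v + ?v) + (?v + ?v + (?v + ?v)) + (?v + ?v + (?v + ?v) + (?v + ?v + (?v + ?v))))))"
  have "Q (expr_cost e + 38) ?t"
    by (rule Q) (auto dest!: less_6_cases simp: power_add)
  then show ?thesis unfolding load_masks_def using assms(1)
    by (simp add: wp_simps add.commute[of _ "expr_cost e"] del: One_nat_def)
qed

text \<open>The area above the stack pointer may hold leftovers of families already consumed; zeros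
  make its entries point to gate 0.\<close>

definition clear_top :: prog where
  "clear_top = set_reg 12 (Num 0) ;;
     While (Minus (reg 9) (reg 12))
       (Store stack_gate (Plus (reg 10) (reg 12)) (Num 0) ;;
        Store stack_state (Plus (reg 10) (reg 12)) (Num 0) ;;
        set_reg 12 (Plus (reg 12) (Num 1)))"

lemma wp_clear_top:
  assumes sp: "s regs 10 = b" "s regs 9 = N"
    and Q: "\<And>n t. n \<le> N * 50 + 20 \<Longrightarrow>
      (\<And>a. a \<noteq> regs \<Longrightarrow> a \<noteq> stack_gate \<Longrightarrow> a \<noteq> stack_state \<Longrightarrow> t a = s a) \<Longrightarrow>
      (\<And>i. 8 \<le> i \<Longrightarrow> i \<noteq> 12 \<Longrightarrow> t regs i = s regs i) \<Longrightarrow>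
      (\<And>q. q < b \<Longrightarrow> t stack_gate q = s stack_gate q \<and> t stack_state q = s stack_state q) \<Longrightarrow>
      (\<And>e. e < N \<Longrightarrow> t stack_gate (b + e) = 0 \<and> t stack_state (b + e) = 0) \<Longrightarrow> Q n t"
  shows "wp clear_top s Q"
proof -
  define I where "I n t \<longleftrightarrow>
      (\<forall>a. a \<noteq> regs \<longrightarrow> a \<noteq> stack_gate \<longrightarrow> a \<noteq> stack_state \<longrightarrow> t a = s a) \<and>
      (\<forall>i. 8 \<le> i \<longrightarrow> i \<noteq> 12 \<longrightarrow> t regs i = s regs i) \<and> t regs 12 = n \<and>
      (\<forall>q < b. t stack_gate q = s stack_gate q \<and> t stack_state q = s stack_state q) \<and>
      (\<forall>e < n. t stack_gate (b + e) = 0 \<and> t stack_state (b + e) = 0)" for n t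
  show ?thesis unfolding clear_top_def wp_Seq[of "set_reg 12 (Num 0)"] wp_Store
  proof (rule wp_While_count[where I = I and k = N and C = 50], goal_cases)
    case 1
    show ?case by (auto simp: I_def)
  next
    case (2 n t)
    then have t: "\<And>a. a \<noteq> regs \<Longrightarrow> a \<noteq> stack_gate \<Longrightarrow> a \<noteq> stack_state \<Longrightarrow> t a = s a"
      "\<And>i. 8 \<le> i \<Longrightarrow> i \<noteq> 12 \<Longrightarrow> t regs i = s regs i" "t regs 12 = n"
      "\<And>q. q < b \<Longrightarrow> t stack_gate q = s stack_gate q \<and> t stack_state q = s stack_state q"
      "\<And>e. e < n \<Longrightarrow> t stack_gate (b + e) = 0 \<and> t stack_state (b + e) = 0"
      unfolding I_def by blast+
    have sp': "t regs 10 = b" "t regs 9 = N" using sp t(2) by simp_all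
    let ?u = "t(stack_gate := (t stack_gate)(b + n := 0), stack_state := (t stack_state)(b + n := 0),
      regs := (t regs)(12 := n + 1))"
    have "I (Suc n) ?u"
      unfolding I_def
    proof (intro conjI allI impI)
      show "?u a = s a" if "a \<noteq> regs" "a \<noteq> stack_gate" "a \<noteq> stack_state" for a using that t(1) by simp
      show "?u regs i = s regs i" if "8 \<le> i" "i \<noteq> 12" for i using that t(2) by simp
      show "?u regs 12 = Suc n" by simp
      show "?u stack_gate q = s stack_gate q" "?u stack_state q = s stack_state q" if "q < b" for q
        using t(4) that by auto
      show "?u stack_gate (b + e) = 0" "?u stack_state (b + e) = 0" if "e < Suc n" for e
        using t(5) that by (auto simp: less_Suc_eq)
    qed
    then show ?case using sp' 2(1) t(3) by (simp add: wp_simps fun_upd_twist del: One_nat_def)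
  next
    case (3 t)
    then show ?case using sp by (simp add: I_def)
  next
    case (4 n t)
    show ?case by (rule Q) (use 4 in \<open>auto simp: I_def\<close>)
  qed
qed

text \<open>Kind 0 is a variable, for which the two literals are emitted. Otherwise the cells
  prepared for the constant true (kind 2) are still in place for the second gate.\<close>

definition create_gates :: prog where
  "create_gates =
     set_reg 0 (Load (''Z'', ''kind'') (reg 7)) ;; set_reg 1 D_size ;;
     set_reg 4 (Load (''Z'', ''var'') (reg 7)) ;; set_reg 3 (Num 0) ;;
     Cond (reg 0) (set_reg 2 (Num 2)) (set_reg 2 (Num 0)) ;; add_gate ;;
     Cond (reg 0) Skip (set_reg 2 (Num 3) ;; set_reg 3 (Num 1) ;; set_reg 5 (reg 1)) ;; add_gate"

lemma wp_create_gates: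
  assumes D: "D_mem s gs" and nc: "\<And>c. G \<noteq> GConst c"
    and kd: "s (''Z'', ''kind'') (s regs 7) = gate_kind G"
    and vr: "\<And>x. G = GVar x \<Longrightarrow> s (''Z'', ''var'') (s regs 7) = x"
    and Q: "\<And>n t. n \<le> 200 \<Longrightarrow> D_mem t (gs @ guess_gates G (length gs)) \<Longrightarrow>
      (\<And>a. fst a \<noteq> ''D'' \<Longrightarrow> a \<noteq> regs \<Longrightarrow> t a = s a) \<Longrightarrow> (\<And>i. 7 \<le> i \<Longrightarrow> t regs i = s regs i) \<Longrightarrow>
      t regs 0 = gate_kind G \<Longrightarrow> t regs 1 = length gs \<Longrightarrow> Q n t"
  shows "wp create_gates s Q"
proof -
  have sz: "s (''D'', ''size'') 0 = length gs" using D by (simp add: D_mem_def)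
  show ?thesis
  proof (cases "\<exists>x. G = GVar x")
    case True
    then obtain x where x: "G = GVar x" by blast
    show ?thesis unfolding create_gates_def wp_Seq wp_Store wp_Cond wp_Skip
      apply (simp add: kd vr[OF x] sz x del: One_nat_def)
      apply (rule wp_add_gate[where gs = gs and G = "GVar x"])
      subgoal by (rule D_mem_cong[OF D]) simp
      subgoal by simp
      subgoal by simp
      subgoal by simp
      subgoal by simp
      subgoal by simp
      subgoal by simp
      subgoal premises p1 for t1
      proof -
        have t1: "t1 a = s a" if "a \<noteq> regs" "fst a \<noteq> ''D''" for a using p1(2)[OF that(2)] that by simp
        have r1: "t1 regs 0 = 0" "t1 regs 1 = length gs" "\<And>i. 7 \<le> i \<Longrightarrow> t1 regs i = s regs i"
          using p1(2)[of regs] by simp_all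
        show ?thesis
          apply (simp add: r1 del: One_nat_def)
          apply (rule wp_add_gate[OF D_mem_cong[OF p1(1)], where G = "GNot (length gs)"])
          subgoal by simp
          subgoal by simp
          subgoal by simp
          subgoal by simp
          subgoal by simp
          subgoal by simp
          subgoal by simp
          subgoal premises p2 for t2
            by (rule Q) (use p2 t1 r1 x in \<open>simp_all add: guess_gates_def del: One_nat_def\<close>)
          done
      qed
      done
  next
    case False
    then have k0: "0 < gate_kind G" "gate_kind G \<noteq> 0" and gg: "guess_gates G n = [GConst True, GConst True]" for n
      using nc by (cases G; auto simp: guess_gates_def)+
    show ?thesis unfolding create_gates_def wp_Seq wp_Store wp_Cond wp_Skip
      apply (simp add: kd sz k0 del: One_nat_def)
      apply (rule wp_add_gate[where gs = gs and G = "GConst True"])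
      subgoal by (rule D_mem_cong[OF D]) simp
      subgoal by simp
      subgoal by simp
      subgoal by simp
      subgoal by simp
      subgoal by simp
      subgoal by simp
      subgoal premises p1 for t1
      proof -
        have t1: "t1 a = s a" if "a \<noteq> regs" "fst a \<noteq> ''D''" for a using p1(2)[OF that(2)] that by simp
        have r1: "t1 regs 0 = gate_kind G" "t1 regs 1 = length gs" "\<And>i. 7 \<le> i \<Longrightarrow> t1 regs i = s regs i"
          "t1 regs 2 = 2" "t1 regs 3 = 0"
          using p1(2)[of regs] by simp_all
        show ?thesis
          apply (simp add: r1 k0 del: One_nat_def)
          apply (rule wp_add_gate[OF p1(1), where G = "GConst True"])
          subgoal by (simp add: r1)
          subgoal by (simp add: r1)
          subgoal by simp
          subgoal by simp
          subgoal by simp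
          subgoal by simp
          subgoal premises p2 for t2
            by (rule Q) (use p2 t1 r1 gg in \<open>simp_all del: One_nat_def\<close>)
          done
      qed
      done
  qed
qed

abbreviation differ :: "expr \<Rightarrow> expr \<Rightarrow> expr" where
  "differ e f \<equiv> Plus (Minus e f) (Minus f e)"

text \<open>Extends the state of entry 0 by fact \<open>i\<close> and that of entry 1 by fact
  \<open>j\<close>. Plain addition can act as a disjunction because the new bit is not yet set when
  this is used.\<close>

abbreviation add_masks :: "nat \<Rightarrow> nat \<Rightarrow> prog" where
  "add_masks i j \<equiv>
     Store stack_state (reg 10) (Plus (Load stack_state (reg 10)) (Load src_mask (Num i))) ;;
     Store stack_state (Plus (reg 10) (Num 1))
       (Plus (Load stack_state (Plus (reg 10) (Num 1))) (Load src_mask (Num j)))"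

text \<open>Entry 0 of the new family guesses the value false, entry 1 the value true.\<close>

definition create_states :: prog where
  "create_states =
     Store stack_gate (Plus (reg 10) (Num 1)) (reg 1) ;;
     Cond (differ (reg 7) (Load (''Z'', ''output'') (Num 0)))
       (Store stack_gate (reg 10) (Plus (reg 1) (Num 1))) Skip ;;
     add_masks 0 1 ;;
     Cond (Minus (reg 0) (Num 2))
       (Cond (Minus (reg 0) (Num 3))
          (Cond (Minus (reg 0) (Num 4)) (add_masks 3 5) (add_masks 4 2))
          (add_masks 2 3))
       Skip ;;
     set_reg 10 (Plus (reg 10) (reg 9))"

text \<open>For NOT, AND and OR, either guess forbids or needs exactly one value, and the needs of a
  fresh vertex are open because it has no arcs. The pairs of numbers are the arguments of
  \<open>add_masks\<close> in \<open>create_states\<close>.\<close>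

fun guess_fact :: "gate \<Rightarrow> bool \<Rightarrow> nat option" where
  "guess_fact (GNot _) b = Some (if b then 3 else 2)"
| "guess_fact (GAnd _) b = Some (if b then 2 else 4)"
| "guess_fact (GOr _) b = Some (if b then 5 else 3)"
| "guess_fact _ b = None"

definition guess_state :: "gate \<Rightarrow> nat \<Rightarrow> bool \<Rightarrow> nat" where
  "guess_state G p b = 2 ^ (p + of_bool b) + (case guess_fact G b of None \<Rightarrow> 0 | Some f \<Rightarrow> 2 ^ (p + f))"

lemma bits_guess_state:
  assumes "\<And>c. gates Z ! u \<noteq> GConst c"
  shows "bits (guess_state (gates Z ! u) (6 * ix a) b) = facts Z ix (Create u a) (\<lambda>_. b)"
proof -
  let ?G = "gates Z ! u" and ?p = "6 * ix a"
  have "facts Z ix (Create u a) (\<lambda>_. b) = (+) ?p ` vertex_facts Z (Create u a) (\<lambda>_. b) u"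
    by (auto simp: facts_def)
  also have "vertex_facts Z (Create u a) (\<lambda>_. b) u = {of_bool b} \<union> set_option (guess_fact ?G b)"
    unfolding set_eq_iff vertex_facts_iff by (cases ?G; cases b) auto
  also have "(+) ?p ` \<dots> = {?p + of_bool b} \<union> (+) ?p ` set_option (guess_fact ?G b)" by auto
  also have "\<dots> = bits (guess_state ?G ?p b)"
  proof (cases "guess_fact ?G b")
    case None
    show ?thesis unfolding guess_state_def None option.case add_0_right bits_exp by simp
  next
    case (Some f)
    then have "f \<noteq> of_bool b" by (cases ?G) auto
    then have "bits (2 ^ (?p + of_bool b) + 2 ^ (?p + f)) =
        bits (Bit_Operations.or (2 ^ (?p + of_bool b)) (2 ^ (?p + f)))"
      by (subst bits_add_disjoint) (auto simp only: bits_exp)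
    then show ?thesis unfolding guess_state_def Some option.case by (simp only: bits_or bits_exp) simp
  qed
  finally show ?thesis by simp
qed

lemma wp_create_states:
  assumes kd: "s regs 0 = gate_kind G" and nc: "\<And>c. G \<noteq> GConst c" and n: "s regs 1 = n"
    and sp: "s regs 10 = b" "s regs 9 = N" and N: "2 \<le> N"
    and out: "s regs 7 = u" "s (''Z'', ''output'') 0 = out"
    and clear: "\<And>e. e < N \<Longrightarrow> s stack_gate (b + e) = 0 \<and> s stack_state (b + e) = 0"
    and mask: "\<And>f. f < 6 \<Longrightarrow> s src_mask f = 2 ^ (p + f)"
    and Q: "\<And>m t. m \<le> 150 \<Longrightarrow>
      (\<And>a. a \<noteq> regs \<Longrightarrow> a \<noteq> stack_gate \<Longrightarrow> a \<noteq> stack_state \<Longrightarrow> t a = s a) \<Longrightarrow>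
      (\<And>i. i \<noteq> 10 \<Longrightarrow> t regs i = s regs i) \<Longrightarrow> t regs 10 = b + N \<Longrightarrow>
      (\<And>q. q < b \<Longrightarrow> t stack_gate q = s stack_gate q \<and> t stack_state q = s stack_state q) \<Longrightarrow>
      t stack_gate b = (if u = out then 0 else Suc n) \<Longrightarrow> t stack_gate (Suc b) = n \<Longrightarrow>
      t stack_state b = guess_state G p False \<Longrightarrow> t stack_state (Suc b) = guess_state G p True \<Longrightarrow>
      (\<And>e. 2 \<le> e \<Longrightarrow> e < N \<Longrightarrow> t stack_gate (b + e) = 0 \<and> t stack_state (b + e) = 0) \<Longrightarrow> Q m t"
  shows "wp create_states s Q"
proof -
  have c: "s stack_gate b = 0" "s stack_state b = 0" "s stack_gate (Suc b) = 0" "s stack_state (Suc b) = 0"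
    using clear[of 0] clear[of 1] N by simp_all
  have m: "s src_mask 0 = 2 ^ p" "s src_mask 1 = 2 ^ (p + 1)" "s src_mask (Suc 0) = 2 ^ (p + 1)"
    "s src_mask 2 = 2 ^ (p + 2)" "s src_mask 3 = 2 ^ (p + 3)"
    "s src_mask 4 = 2 ^ (p + 4)" "s src_mask 5 = 2 ^ (p + 5)"
    using mask[of 0] mask[of 1] mask[of 2] mask[of 3] mask[of 4] mask[of 5] by simp_all
  show ?thesis unfolding create_states_def wp_Seq wp_Store wp_Cond wp_Skip
    using nc
    apply (cases G; cases "u = out")
    apply (simp_all add: sp out c m n kd add.assoc del: One_nat_def)
    apply (rule Q; use sp n clear c in \<open>simp add: guess_state_def\<close>)+
    done
qed

section \<open>Traversing the decomposition\<close>

abbreviation T_op :: expr where "T_op \<equiv> Load (''T'', ''op'') (reg 11)"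
abbreviation T_arg1 :: expr where "T_arg1 \<equiv> Load (''T'', ''arg1'') (reg 11)"
abbreviation T_arg2 :: expr where "T_arg2 \<equiv> Load (''T'', ''arg2'') (reg 11)"

definition create_prog :: prog where
  "create_prog = clear_top ;; load_masks src_mask T_arg2 ;; set_reg 7 T_arg1 ;; create_gates ;; create_states"

definition relabel_prog :: "prog \<Rightarrow> prog" where
  "relabel_prog c = load_masks src_mask T_arg1 ;; load_masks dst_mask T_arg2 ;; map_prog c"

text \<open>The opcode is decoded by truncated subtractions: 0 creates, 1 unites, 2 adds arcs, 3
  relabels.\<close>

definition node_prog :: prog where
  "node_prog =
     Cond T_op
       (Cond (Minus T_op (Num 1))
          (Cond (Minus T_op (Num 2))
             (Cond (differ T_arg1 T_arg2) (relabel_prog (rho_state 6)) Skip)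
             (relabel_prog eta_state))
          union_prog)
       create_prog ;;
     set_reg 11 (Plus (reg 11) (Num 1))"

definition same_input :: "memory \<Rightarrow> memory \<Rightarrow> bool" where
  "same_input s t \<longleftrightarrow> t regs 8 = s regs 8 \<and> t regs 9 = s regs 9 \<and> t regs 14 = s regs 14 \<and>
     t powers = s powers \<and> t label_mask = s label_mask \<and> t accum = s accum \<and>
     (\<forall>f. t (''Z'', f) = s (''Z'', f)) \<and> (\<forall>f. t (''T'', f) = s (''T'', f))"

definition prepared :: "circuit \<Rightarrow> nat set \<Rightarrow> (nat \<Rightarrow> nat) \<Rightarrow> memory \<Rightarrow> bool" where
  "prepared Z L ix s \<longleftrightarrow> powers_ready s \<and> s regs 9 = 2 ^ s regs 8 \<and>
     (\<forall>a \<in> L. s label_mask a = 2 ^ (6 * ix a) \<and> 6 * ix a + 6 \<le> s regs 8) \<and>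
     circuit_in_memory ''Z'' s Z \<and> s accum = (\<lambda>_. 0)"

lemma prepared_same_input: "prepared Z L ix s \<Longrightarrow> same_input s t \<Longrightarrow> prepared Z L ix t"
  by (simp add: prepared_def same_input_def powers_ready_def circuit_in_memory_def)

lemma same_input_trans: "same_input s t \<Longrightarrow> same_input t u \<Longrightarrow> same_input s u"
  by (simp add: same_input_def)

text \<open>An exact count and not only a bound: a union emits three gates for every pair of
  entries, dead or alive.\<close>

fun gate_count :: "nat \<Rightarrow> nat clique_dec \<Rightarrow> nat" where
  "gate_count N (Create u a) = 2"
| "gate_count N (Disj_Union S T) = gate_count N S + gate_count N T + 3 * (N * N)"
| "gate_count N (Eta i j T) = gate_count N T"
| "gate_count N (Rho i j T) = gate_count N T"

text \<open>The effect of processing the subtree \<open>T\<close>, started in \<open>s\<close> with stack pointer \<open>b\<close> and gates \<open>gs\<close>.\<close>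

definition built :: "circuit \<Rightarrow> (nat \<Rightarrow> nat) \<Rightarrow> nat \<Rightarrow> nat \<Rightarrow> memory \<Rightarrow> gate list \<Rightarrow> nat clique_dec \<Rightarrow>
    memory \<Rightarrow> gate list \<Rightarrow> bool" where
  "built Z ix N b s gs T t gs' \<longleftrightarrow> same_input s t \<and> t regs 10 = b + N \<and>
     (\<forall>q < b. t stack_gate q = s stack_gate q \<and> t stack_state q = s stack_state q) \<and>
     D_mem t gs' \<and> dnnf_list0 gs' \<and> (\<exists>hs. gs' = gs @ hs) \<and>
     list_vars gs' = list_vars gs \<union> dec_vars Z T \<and> length gs' = length gs + gate_count N T \<and>
     family Z ix N gs' T (\<lambda>e. t stack_gate (b + e)) (\<lambda>e. t stack_state (b + e))"

lemma family_cong: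
  assumes "\<And>e. e < N \<Longrightarrow> G e = G' e" "\<And>e. e < N \<Longrightarrow> S e = S' e"
  shows "family Z ix N gs T G S \<longleftrightarrow> family Z ix N gs T G' S'"
proof -
  have "(\<exists>e < N. S e = \<sigma> \<and> gate_true gs \<alpha> (G e)) \<longleftrightarrow> (\<exists>e < N. S' e = \<sigma> \<and> gate_true gs \<alpha> (G' e))" for \<alpha> \<sigma>
    using assms by metis
  then show ?thesis using assms by (simp add: family_def family_sound_def)
qed

lemma wp_create_prog:
  assumes prep: "prepared Z L ix s" and D: "D_mem s gs" and gs: "dnnf_list0 gs" and b: "s regs 10 = b"
    and N: "N = s regs 9"
    and arg: "s (''T'', ''arg1'') (s regs 11) = u" "s (''T'', ''arg2'') (s regs 11) = a"
    and a: "a \<in> L" and u: "u < circuit_size Z" and nc: "\<And>c. gates Z ! u \<noteq> GConst c"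
    and fresh: "list_vars gs \<inter> dec_vars Z (Create u a) = {}"
  shows "wp create_prog s (\<lambda>n t. n \<le> N * 50 + 600 \<and> t regs 11 = s regs 11 \<and>
    (\<exists>gs'. built Z ix N b s gs (Create u a) t gs'))"
proof -
  let ?G = "gates Z ! u" and ?p = "6 * ix a"
  have mask: "s label_mask a = 2 ^ ?p" and B: "?p + 6 \<le> s regs 8" and N2: "N = 2 ^ s regs 8"
    using prep a N by (auto simp: prepared_def)
  \<comment> \<open>The block of one label already takes six bits, so entries 0 and 1 exist.\<close>
  have "2 ^ 1 \<le> N" unfolding N2 using B by (intro power_increasing) auto
  then have N2': "2 \<le> N" by simp
  have Z: "s (''Z'', ''kind'') u = gate_kind ?G" "\<And>x. ?G = GVar x \<Longrightarrow> s (''Z'', ''var'') u = x"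
    "s (''Z'', ''output'') 0 = out_gate Z"
    using prep u by (auto simp: prepared_def circuit_in_memory_def Let_def)
  have fr: "x \<notin> list_vars gs" if "?G = GVar x" for x using fresh that by (auto simp: dec_vars_def)
  show ?thesis unfolding create_prog_def wp_Seq[of clear_top]
  proof (rule wp_clear_top[of s b N, OF b N[symmetric]])
    fix n1 t1 assume n1: "n1 \<le> N * 50 + 20"
      and a1: "\<And>a. a \<noteq> regs \<Longrightarrow> a \<noteq> stack_gate \<Longrightarrow> a \<noteq> stack_state \<Longrightarrow> t1 a = s a"
      and r1: "\<And>i. 8 \<le> i \<Longrightarrow> i \<noteq> 12 \<Longrightarrow> t1 regs i = s regs i"
      and q1: "\<And>q. q < b \<Longrightarrow> t1 stack_gate q = s stack_gate q \<and> t1 stack_state q = s stack_state q"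
      and e1: "\<And>e. e < N \<Longrightarrow> t1 stack_gate (b + e) = 0 \<and> t1 stack_state (b + e) = 0"
    show "wp (load_masks src_mask T_arg2 ;; set_reg 7 T_arg1 ;; create_gates ;; create_states) t1
      (\<lambda>n t. n1 + n \<le> N * 50 + 600 \<and> t regs 11 = s regs 11 \<and> (\<exists>gs'. built Z ix N b s gs (Create u a) t gs'))"
      unfolding wp_Seq[of "load_masks src_mask T_arg2"]
    proof (rule wp_load_masks)
      show "t1 label_mask (expr_val T_arg2 t1) = 2 ^ ?p" using a1 r1 arg mask by simp
    next
      fix t2 assume a2: "\<And>a. a \<noteq> src_mask \<Longrightarrow> t2 a = t1 a" and m2: "\<And>f. f < 6 \<Longrightarrow> t2 src_mask f = 2 ^ (?p + f)"
      let ?t2 = "t2(regs := (t2 regs)(7 := u))"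
      have r2: "?t2 regs i = s regs i" if "8 \<le> i" "i \<noteq> 12" for i using a2 r1 that by simp
      have b2: "?t2 a = s a" if "a \<noteq> regs" "a \<noteq> stack_gate" "a \<noteq> stack_state" "a \<noteq> src_mask" for a
        using a2 a1 that by simp
      have D2: "D_mem ?t2 gs" by (rule D_mem_cong[OF D]) (simp add: a1 a2)
      have "wp (create_gates ;; create_states) ?t2 (\<lambda>n t. n + n1 + 100 \<le> N * 50 + 600 \<and> t regs 11 = s regs 11 \<and>
          (\<exists>gs'. built Z ix N b s gs (Create u a) t gs'))"
        unfolding wp_Seq
      proof (rule wp_create_gates[OF D2, where G = ?G])
        show "?G \<noteq> GConst c" for c by (rule nc)
        show "?t2 (''Z'', ''kind'') (?t2 regs 7) = gate_kind ?G" using Z b2[of "(''Z'', ''kind'')"] by simp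
        show "?t2 (''Z'', ''var'') (?t2 regs 7) = x" if "?G = GVar x" for x
          using Z(2)[OF that] b2[of "(''Z'', ''var'')"] by simp
      next
        let ?gs = "gs @ guess_gates ?G (length gs)"
        fix n3 :: nat and t3 assume n3: "n3 \<le> 200" and D3: "D_mem t3 ?gs"
          and a3: "\<And>a. fst a \<noteq> ''D'' \<Longrightarrow> a \<noteq> regs \<Longrightarrow> t3 a = ?t2 a" and r3: "\<And>i. 7 \<le> i \<Longrightarrow> t3 regs i = ?t2 regs i"
          and k3: "t3 regs 0 = gate_kind ?G" "t3 regs 1 = length gs"
        have b3: "t3 a = s a" if "fst a \<noteq> ''D''" "a \<noteq> regs" "a \<noteq> stack_gate" "a \<noteq> stack_state" "a \<noteq> src_mask" for a
          using a3[OF that(1,2)] b2[OF that(2-5)] by simp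
        have r3': "t3 regs i = s regs i" if "8 \<le> i" "i \<noteq> 12" for i using r3[of i] r2[OF that] that by simp
        show "wp create_states t3 (\<lambda>n t. n3 + n + n1 + 100 \<le> N * 50 + 600 \<and> t regs 11 = s regs 11 \<and>
          (\<exists>gs'. built Z ix N b s gs (Create u a) t gs'))"
        proof (rule wp_create_states[of t3 ?G "length gs" b N u "out_gate Z" ?p, OF k3(1) nc k3(2)])
          show "t3 regs 10 = b" "t3 regs 9 = N" using r3' b N by simp_all
          show "2 \<le> N" by fact
          show "t3 regs 7 = u" using r3[of 7] by simp
          show "t3 (''Z'', ''output'') 0 = out_gate Z" using b3 Z(3) by simp
          show "t3 src_mask f = 2 ^ (?p + f)" if "f < 6" for f using m2[OF that] a3 by simp
          show "t3 stack_gate (b + e) = 0 \<and> t3 stack_state (b + e) = 0" if "e < N" for e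
            using e1[OF that] a3 a2 by simp
        next
          fix m :: nat and t
          assume m: "m \<le> 150" and a4: "\<And>a. a \<noteq> regs \<Longrightarrow> a \<noteq> stack_gate \<Longrightarrow> a \<noteq> stack_state \<Longrightarrow> t a = t3 a"
            and r4: "\<And>i. i \<noteq> 10 \<Longrightarrow> t regs i = t3 regs i" "t regs 10 = b + N"
            and q4: "\<And>q. q < b \<Longrightarrow> t stack_gate q = t3 stack_gate q \<and> t stack_state q = t3 stack_state q"
            and g4: "t stack_gate b = (if u = out_gate Z then 0 else Suc (length gs))" "t stack_gate (Suc b) = length gs"
              "t stack_state b = guess_state ?G ?p False" "t stack_state (Suc b) = guess_state ?G ?p True"
              "\<And>e. 2 \<le> e \<Longrightarrow> e < N \<Longrightarrow> t stack_gate (b + e) = 0 \<and> t stack_state (b + e) = 0"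
          have D4: "D_mem t ?gs" by (rule D_mem_cong[OF D3]) (simp add: a4)
          have st: "same_input s t"
            using r3' r4 a4 b3 by (simp add: same_input_def)
          have q: "t stack_gate q = s stack_gate q \<and> t stack_state q = s stack_state q" if "q < b" for q
            using q4[OF that] q1[OF that] a3 a2 by simp
          note gg = guess_gates_correct[OF gs fr]
          have bits: "bits (guess_state ?G ?p c) = facts Z ix (Create u a) (\<lambda>_. c)" for c
            by (rule bits_guess_state[OF nc])
          have less: "guess_state ?G ?p c < N" for c
          proof -
            have "facts Z ix (Create u a) (\<lambda>_. c) \<subseteq> {..<s regs 8}"
              using B by (auto simp: facts_def dest: vertex_facts_less)
            then show ?thesis unfolding N2 less_exp_iff_bits bits .
          qed
          have "family Z ix N ?gs (Create u a) (\<lambda>e. t stack_gate (b + e)) (\<lambda>e. t stack_state (b + e))"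
          proof (rule family_Create[OF gs fr N2'])
            fix e assume "e < N"
            moreover have "e = 0 \<or> e = 1 \<or> 2 \<le> e" by auto
            ultimately show "t stack_state (b + e) < N" using g4 less N2' by auto
          qed (use g4 bits in auto)
          moreover have "length ?gs = length gs + 2" by (cases ?G) (auto simp: guess_gates_def)
          moreover have "list_vars ?gs = list_vars gs \<union> dec_vars Z (Create u a)"
            using gg(2) by (auto simp: dec_vars_def)
          ultimately have "built Z ix N b s gs (Create u a) t ?gs"
            unfolding built_def using st r4(2) q D4 gg(1) by auto
          then show "n3 + m + n1 + 100 \<le> N * 50 + 600 \<and> t regs 11 = s regs 11 \<and>
              (\<exists>gs'. built Z ix N b s gs (Create u a) t gs')"
            using m n1 n3 r4(1)[of 11] r3'[of 11] by auto
        qed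
      qed
      then show "wp (set_reg 7 T_arg1 ;; create_gates ;; create_states) t2
        (\<lambda>n t. n1 + (expr_cost T_arg2 + 38 + n) \<le> N * 50 + 600 \<and> t regs 11 = s regs 11 \<and>
          (\<exists>gs'. built Z ix N b s gs (Create u a) t gs'))"
        unfolding wp_Seq[of "set_reg 7 T_arg1"] wp_Store using arg(1) a1 a2 r1
        by (simp del: One_nat_def) (erule wp_mono, simp)
    qed
  qed
qed

text \<open>Common to adding arcs and relabelling: the gate list and the stack height stay, so the
  effect recorded for \<open>T\<close> since \<open>s0\<close> becomes the effect for
  \<open>T'\<close>.\<close>

lemma wp_relabel_prog:
  assumes prep: "prepared Z L ix s" and N: "N = s regs 9" and bt: "built Z ix N b s0 gs0 T s gs"
    and arg: "s (''T'', ''arg1'') (s regs 11) = i" "s (''T'', ''arg2'') (s regs 11) = j"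
    and ij: "i \<in> L" "j \<in> L"
    and impl: "\<And>t. masks_ready ix i j t \<Longrightarrow> t regs 8 = s regs 8 \<Longrightarrow> implements t c C f k"
    and T': "dec_verts T' = dec_verts T" "gate_count N T' = gate_count N T"
    and fam: "\<And>G S. dnnf_list0 gs \<Longrightarrow> family Z ix N gs T G S \<Longrightarrow> (\<And>e. e < N \<Longrightarrow> f (S e) < N) \<Longrightarrow>
      family Z ix N gs T' (\<lambda>e. k (S e) (G e)) (\<lambda>e. f (S e))"
  shows "wp (relabel_prog c) s (\<lambda>n t. n \<le> N * (C + 40) + 150 \<and> t regs 11 = s regs 11 \<and>
    built Z ix N b s0 gs0 T' t gs)"
proof -
  have si: "same_input s0 s" and sp: "s regs 10 = b + N"
    and qs: "\<And>q. q < b \<Longrightarrow> s stack_gate q = s0 stack_gate q \<and> s stack_state q = s0 stack_state q"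
    and D: "D_mem s gs" and gs: "dnnf_list0 gs" "\<exists>hs. gs = gs0 @ hs"
    and lv: "list_vars gs = list_vars gs0 \<union> dec_vars Z T" and len: "length gs = length gs0 + gate_count N T"
    and F: "family Z ix N gs T (\<lambda>e. s stack_gate (b + e)) (\<lambda>e. s stack_state (b + e))"
    using bt unfolding built_def by blast+
  have mask: "s label_mask i = 2 ^ (6 * ix i)" "s label_mask j = 2 ^ (6 * ix j)"
    and B: "6 * ix i + 6 \<le> s regs 8" "6 * ix j + 6 \<le> s regs 8" and N2: "N = 2 ^ s regs 8" and pr: "powers_ready s"
    using prep ij N by (auto simp: prepared_def)
  have less: "s stack_state (b + e) < N" if "e < N" for e
    using F that by (simp add: family_def family_sound_def)
  show ?thesis unfolding relabel_prog_def wp_Seq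
  proof (rule wp_load_masks[where p = "6 * ix i"])
    show "s label_mask (expr_val T_arg1 s) = 2 ^ (6 * ix i)" using arg mask by simp
    fix t1 assume a1: "\<And>a. a \<noteq> src_mask \<Longrightarrow> t1 a = s a" and m1: "\<And>f. f < 6 \<Longrightarrow> t1 src_mask f = 2 ^ (6 * ix i + f)"
    show "wp (load_masks dst_mask T_arg2) t1 (\<lambda>m t. wp (map_prog c) t (\<lambda>n t. expr_cost T_arg1 + 38 + (m + n) \<le> N * (C + 40) + 150 \<and>
        t regs 11 = s regs 11 \<and> built Z ix N b s0 gs0 T' t gs))"
    proof (rule wp_load_masks[where p = "6 * ix j"])
      show "t1 label_mask (expr_val T_arg2 t1) = 2 ^ (6 * ix j)" using arg mask a1 by simp
      fix t2 assume a2: "\<And>a. a \<noteq> dst_mask \<Longrightarrow> t2 a = t1 a" and m2: "\<And>f. f < 6 \<Longrightarrow> t2 dst_mask f = 2 ^ (6 * ix j + f)"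
      have b2: "t2 a = s a" if "a \<noteq> src_mask" "a \<noteq> dst_mask" for a using a1 a2 that by simp
      have M: "masks_ready ix i j t2"
        unfolding masks_ready_def using pr B m1 m2 a2 b2 by (simp add: powers_ready_def)
      show "wp (map_prog c) t2 (\<lambda>n t. expr_cost T_arg1 + 38 + (expr_cost T_arg2 + 38 + n) \<le> N * (C + 40) + 150 \<and>
        t regs 11 = s regs 11 \<and> built Z ix N b s0 gs0 T' t gs)"
      proof (rule wp_map_prog[OF _ M])
        show "implements t c C f k" if "masks_ready ix i j t" "t regs 8 = t2 regs 8" for t
          using impl that b2 by simp
        show "t2 regs 10 = b + N" "t2 regs 9 = N" "N = 2 ^ t2 regs 8" using b2 sp N N2 by simp_all
        show "t2 stack_state (b + e) < N" if "e < N" for e using less[OF that] b2 by simp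
      next
        fix n t assume n: "n \<le> N * (C + 40) + 20"
          and a3: "\<And>a. a \<noteq> regs \<Longrightarrow> a \<noteq> stack_gate \<Longrightarrow> a \<noteq> stack_state \<Longrightarrow> t a = t2 a"
          and r3: "\<And>r. 8 \<le> r \<Longrightarrow> r \<noteq> 12 \<Longrightarrow> t regs r = t2 regs r"
          and q3: "\<And>q. q < b \<Longrightarrow> t stack_gate q = t2 stack_gate q \<and> t stack_state q = t2 stack_state q"
          and e3: "\<And>e. e < N \<Longrightarrow> t stack_gate (b + e) = k (t2 stack_state (b + e)) (t2 stack_gate (b + e)) \<and>
            t stack_state (b + e) = f (t2 stack_state (b + e)) \<and> f (t2 stack_state (b + e)) < N"
        have "same_input s t" using a3 r3 b2 by (simp add: same_input_def)
        then have si': "same_input s0 t" by (rule same_input_trans[OF si])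
        have Dt: "D_mem t gs" by (rule D_mem_cong[OF D]) (simp add: a3 b2)
        have "family Z ix N gs T' (\<lambda>e. k (s stack_state (b + e)) (s stack_gate (b + e))) (\<lambda>e. f (s stack_state (b + e)))"
          by (rule fam[OF gs(1) F]) (use e3 b2 in simp)
        then have Ft: "family Z ix N gs T' (\<lambda>e. t stack_gate (b + e)) (\<lambda>e. t stack_state (b + e))"
          by (rule iffD1[OF family_cong, rotated 2]) (use e3 b2 in simp_all)
        have "dec_vars Z T' = dec_vars Z T" by (simp add: dec_vars_def T'(1))
        then have "built Z ix N b s0 gs0 T' t gs"
          unfolding built_def using si' r3 b2 sp q3 qs Dt gs lv len Ft T'(2) by simp
        then show "expr_cost T_arg1 + 38 + (expr_cost T_arg2 + 38 + n) \<le> N * (C + 40) + 150 \<and>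
          t regs 11 = s regs 11 \<and> built Z ix N b s0 gs0 T' t gs"
          using n r3 b2 by simp
      qed
    qed
  qed
qed

lemma wp_Eta:
  assumes prep: "prepared Z L ix s" and N: "N = s regs 9" and bt: "built Z ix N b s0 gs0 T s gs"
    and arg: "s (''T'', ''arg1'') (s regs 11) = i" "s (''T'', ''arg2'') (s regs 11) = j"
    and L: "inj_on ix L" "dec_labels (Eta i j T) \<subseteq> L"
  shows "wp (relabel_prog eta_state) s (\<lambda>n t. n \<le> N * (12 * or_cost s + 110) + 150 \<and> t regs 11 = s regs 11 \<and>
    built Z ix N b s0 gs0 (Eta i j T) t gs)"
proof -
  obtain f k where impl: "\<And>t. masks_ready ix i j t \<Longrightarrow> implements t eta_state (6 * or_cost t + 30) f k"
    and f: "\<And>x. bits (f x) = eta_facts ix i j (bits x)"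
    and k: "\<And>x g. k x g = (if eta_rejects ix i j (bits x) then 0 else g)"
    by (rule implements_eta[of ix i j]) blast
  \<comment> \<open>The cost is rounded up to that of relabelling, so that one bound serves both
    kinds of nodes.\<close>
  have "wp (relabel_prog eta_state) s (\<lambda>n t. n \<le> N * ((12 * or_cost s + 70) + 40) + 150 \<and> t regs 11 = s regs 11 \<and>
    built Z ix N b s0 gs0 (Eta i j T) t gs)"
  proof (rule wp_relabel_prog[OF prep N bt arg])
    show "i \<in> L" "j \<in> L" using L(2) by auto
    show "implements t eta_state (12 * or_cost s + 70) f k" if "masks_ready ix i j t" "t regs 8 = s regs 8" for t
      by (rule implements_cost_mono[OF impl[OF that(1)]]) (use that(2) in \<open>simp add: or_cost_def\<close>)
    show "family Z ix N gs (Eta i j T) (\<lambda>e. k (S e) (G e)) (\<lambda>e. f (S e))"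
      if "dnnf_list0 gs" "family Z ix N gs T G S" "\<And>e. e < N \<Longrightarrow> f (S e) < N" for G S
      by (rule family_map[OF that(1,2) _ unforbidden_Eta[OF L] facts_Eta[OF L] f k that(3)]) simp_all
  qed simp_all
  then show ?thesis by (simp add: add.assoc)
qed

lemma wp_Rho:
  assumes prep: "prepared Z L ix s" and N: "N = s regs 9" and bt: "built Z ix N b s0 gs0 T s gs"
    and arg: "s (''T'', ''arg1'') (s regs 11) = i" "s (''T'', ''arg2'') (s regs 11) = j"
    and L: "inj_on ix L" "dec_labels (Rho i j T) \<subseteq> L" and ij: "i \<noteq> j"
  shows "wp (relabel_prog (rho_state 6)) s (\<lambda>n t. n \<le> N * (12 * or_cost s + 110) + 150 \<and> t regs 11 = s regs 11 \<and>
    built Z ix N b s0 gs0 (Rho i j T) t gs)"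
proof -
  have "i \<in> L" "j \<in> L" using L(2) by auto
  then have "ix i \<noteq> ix j" using L(1) ij by (auto dest: inj_onD)
  then obtain f where impl: "\<And>t. masks_ready ix i j t \<Longrightarrow> implements t (rho_state 6) (12 * or_cost t + 70) f (\<lambda>x g. g)"
    and f: "\<And>x. bits (f x) = rho_facts ix i j (bits x)"
    by (rule implements_rho[of ix i j]) blast
  have "wp (relabel_prog (rho_state 6)) s (\<lambda>n t. n \<le> N * ((12 * or_cost s + 70) + 40) + 150 \<and> t regs 11 = s regs 11 \<and>
    built Z ix N b s0 gs0 (Rho i j T) t gs)"
  proof (rule wp_relabel_prog[OF prep N bt arg \<open>i \<in> L\<close> \<open>j \<in> L\<close>])
    show "implements t (rho_state 6) (12 * or_cost s + 70) f (\<lambda>x g. g)" if "masks_ready ix i j t" "t regs 8 = s regs 8" for t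
      by (rule implements_cost_mono[OF impl[OF that(1)]]) (use that(2) in \<open>simp add: or_cost_def\<close>)
    show "family Z ix N gs (Rho i j T) (\<lambda>e. G e) (\<lambda>e. f (S e))"
      if "dnnf_list0 gs" "family Z ix N gs T G S" "\<And>e. e < N \<Longrightarrow> f (S e) < N" for G S
      by (rule family_map[where rej = "\<lambda>_. False" and k = "\<lambda>x g. g", OF that(1,2) _ _ facts_Rho[OF L ij] f _ that(3)])
        (simp_all add: unforbidden_Rho)
  qed simp_all
  then show ?thesis by (simp add: add.assoc)
qed

lemma family_Rho_same: "family Z ix N gs T G S \<Longrightarrow> family Z ix N gs (Rho i i T) G S"
  by (simp add: family_def facts_Rho_same unforbidden_Rho admissible_def dec_vars_def)

text \<open>While the second subtree is processed, the first family rests on the stack below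
  \<open>b + N\<close> and is not overwritten; its gates keep their meaning because gates are only
  appended.\<close>

lemma wp_Disj_Union:
  assumes prep: "prepared Z L ix s" and N: "N = s regs 9"
    and b1: "built Z ix N b s0 gs0 T1 s1 gs1" and b2: "built Z ix N (b + N) s1 gs1 T2 s gs2"
    and disj: "dec_verts T1 \<inter> dec_verts T2 = {}" and V: "dec_vars Z T1 \<inter> dec_vars Z T2 = {}"
  shows "wp union_prog s (\<lambda>n t. n \<le> N * (N * (or_cost s + 300) + 100) + 100 \<and> t regs 11 = s regs 11 \<and>
    (\<exists>gs. built Z ix N b s0 gs0 (Disj_Union T1 T2) t gs))"
proof -
  have B1: "same_input s0 s1"
    "\<And>q. q < b \<Longrightarrow> s1 stack_gate q = s0 stack_gate q \<and> s1 stack_state q = s0 stack_state q"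
    "dnnf_list0 gs1" "\<exists>hs. gs1 = gs0 @ hs"
    "list_vars gs1 = list_vars gs0 \<union> dec_vars Z T1" "length gs1 = length gs0 + gate_count N T1"
    "family Z ix N gs1 T1 (\<lambda>e. s1 stack_gate (b + e)) (\<lambda>e. s1 stack_state (b + e))"
    using b1 unfolding built_def by blast+
  have B2: "same_input s1 s" "s regs 10 = b + N + N"
    "\<And>q. q < b + N \<Longrightarrow> s stack_gate q = s1 stack_gate q \<and> s stack_state q = s1 stack_state q"
    "D_mem s gs2" "dnnf_list0 gs2" "\<exists>hs. gs2 = gs1 @ hs"
    "list_vars gs2 = list_vars gs1 \<union> dec_vars Z T2" "length gs2 = length gs1 + gate_count N T2"
    "family Z ix N gs2 T2 (\<lambda>e. s stack_gate (b + N + e)) (\<lambda>e. s stack_state (b + N + e))"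
    using b2 unfolding built_def by blast+
  have P: "powers_ready s" "N = 2 ^ s regs 8" "s accum = (\<lambda>_. 0)" using prep N by (auto simp: prepared_def)
  let ?V1 = "dec_vars Z T1" and ?V2 = "dec_vars Z T2"
  let ?G1 = "\<lambda>e. s1 stack_gate (b + e)" and ?S1 = "\<lambda>e. s1 stack_state (b + e)"
  let ?G2 = "\<lambda>e. s stack_gate (b + N + e)" and ?S2 = "\<lambda>e. s stack_state (b + N + e)"
  obtain hs where hs: "gs2 = gs1 @ hs" using B2(6) by blast
  have F1: "family Z ix N gs2 T1 ?G1 ?S1" unfolding hs by (rule family_append[OF dnnf_list0D[OF B1(3)] B1(7)])
  have V12: "?V1 \<union> ?V2 = dec_vars Z (Disj_Union T1 T2)" by (auto simp: dec_vars_def)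
  show ?thesis
  proof (rule wp_union_prog[of s b N, OF B2(2) N[symmetric] P(2,1) B2(4,5)])
    show "family_sound N gs2 ?V1 ?G1 ?S1" "family_sound N gs2 ?V2 ?G2 ?S2"
      using F1 B2(9) by (auto simp: family_def)
    show "s stack_gate (b + e) = ?G1 e \<and> s stack_state (b + e) = ?S1 e" if "e < N" for e
      using B2(3)[of "b + e"] that by simp
    show "?V1 \<inter> ?V2 = {}" "s accum = (\<lambda>_. 0)" by fact+
  next
    fix n t gs A assume n: "n \<le> N * (N * (or_cost s + 300) + 100) + 100" and D: "D_mem t gs"
      and inv: "union_inv N gs2 (?V1 \<union> ?V2) ?G1 ?S1 ?G2 ?S2 gs A ({..<N} \<times> {..<N})"
      and len: "length gs = length gs2 + 3 * (N * N)"
      and ar: "\<And>a. fst a \<noteq> ''D'' \<Longrightarrow> a \<noteq> regs \<Longrightarrow> a \<noteq> stack_gate \<Longrightarrow> a \<noteq> stack_state \<Longrightarrow> t a = s a"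
      and rg: "\<And>i. 8 \<le> i \<Longrightarrow> i \<noteq> 10 \<Longrightarrow> i \<noteq> 12 \<Longrightarrow> i \<noteq> 13 \<Longrightarrow> t regs i = s regs i"
      and r10: "t regs 10 = b + N"
      and q: "\<And>q. q < b \<Longrightarrow> t stack_gate q = s stack_gate q \<and> t stack_state q = s stack_state q"
      and e: "\<And>e. e < N \<Longrightarrow> t stack_gate (b + e) = A e \<and> t stack_state (b + e) = e"
    have "same_input s t" using ar rg by (simp add: same_input_def)
    then have si: "same_input s0 t" using B1(1) B2(1) same_input_trans by blast
    have q': "t stack_gate q = s0 stack_gate q \<and> t stack_state q = s0 stack_state q" if "q < b" for q
      using q[OF that] B2(3)[of q] B1(2)[OF that] that by simp
    have "family Z ix N gs (Disj_Union T1 T2) A (\<lambda>e. e)"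
      by (rule family_Disj_Union[OF B2(5) F1 B2(9) disj P(2) inv[unfolded V12]])
    then have F: "family Z ix N gs (Disj_Union T1 T2) (\<lambda>e. t stack_gate (b + e)) (\<lambda>e. t stack_state (b + e))"
      by (rule iffD1[OF family_cong, rotated 2]) (use e in simp_all)
    have "dnnf_list0 gs" "\<exists>hs. gs = gs2 @ hs" "list_vars gs = list_vars gs2"
      using inv unfolding union_inv_def by blast+
    moreover have "\<exists>hs. gs2 = gs0 @ hs" using B1(4) B2(6) by auto
    ultimately have "built Z ix N b s0 gs0 (Disj_Union T1 T2) t gs"
      unfolding built_def V12[symmetric] using si q' r10 D F len B1(5,6) B2(7,8) by auto
    then show "n \<le> N * (N * (or_cost s + 300) + 100) + 100 \<and> t regs 11 = s regs 11 \<and>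
      (\<exists>gs. built Z ix N b s0 gs0 (Disj_Union T1 T2) t gs)"
      using n rg by auto
  qed simp_all
qed

section \<open>Traversal of the postorder\<close>

definition segment :: "memory \<Rightarrow> nat \<Rightarrow> (nat \<times> nat \<times> nat) list \<Rightarrow> bool" where
  "segment s p xs \<longleftrightarrow> (\<forall>l < length xs.
     (s (''T'', ''op'') (p + l), s (''T'', ''arg1'') (p + l), s (''T'', ''arg2'') (p + l)) = xs ! l)"

lemma segment_append: "segment s p (xs @ ys) \<longleftrightarrow> segment s p xs \<and> segment s (p + length xs) ys"
proof
  assume a: "segment s p (xs @ ys)"
  show "segment s p xs \<and> segment s (p + length xs) ys"
    unfolding segment_def
  proof (intro conjI allI impI)
    fix l assume "l < length xs"
    then show "(s (''T'', ''op'') (p + l), s (''T'', ''arg1'') (p + l), s (''T'', ''arg2'') (p + l)) = xs ! l"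
      using a unfolding segment_def by (auto simp: nth_append dest!: spec[of _ l])
  next
    fix l assume "l < length ys"
    then show "(s (''T'', ''op'') (p + length xs + l), s (''T'', ''arg1'') (p + length xs + l),
        s (''T'', ''arg2'') (p + length xs + l)) = ys ! l"
      using a unfolding segment_def by (auto simp: nth_append add.assoc dest!: spec[of _ "length xs + l"])
  qed
next
  assume a: "segment s p xs \<and> segment s (p + length xs) ys"
  show "segment s p (xs @ ys)" unfolding segment_def
  proof (intro allI impI)
    fix l assume l: "l < length (xs @ ys)"
    show "(s (''T'', ''op'') (p + l), s (''T'', ''arg1'') (p + l), s (''T'', ''arg2'') (p + l)) = (xs @ ys) ! l"
    proof (cases "l < length xs")
      case True
      then show ?thesis using a by (simp add: segment_def nth_append)
    next
      case False
      then have "l - length xs < length ys" "length xs + (l - length xs) = l" using l by auto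
      then show ?thesis using a False unfolding segment_def by (auto simp: nth_append add.assoc)
    qed
  qed
qed

lemma segment_single: "segment s p [(x, y, z)] \<longleftrightarrow>
    s (''T'', ''op'') p = x \<and> s (''T'', ''arg1'') p = y \<and> s (''T'', ''arg2'') p = z"
  by (simp add: segment_def)

lemma segment_same_input: "same_input s t \<Longrightarrow> segment t p xs = segment s p xs"
  by (simp add: segment_def same_input_def)

text \<open>A variable occurs at only one position of \<open>Z\<close>, so disjoint vertex sets have
  disjoint variables. All decomposability of the result stems from this.\<close>

lemma dec_vars_disjoint:
  assumes "circuit Z" "dec_verts S \<inter> dec_verts T = {}"
    "dec_verts S \<subseteq> {..<circuit_size Z}" "dec_verts T \<subseteq> {..<circuit_size Z}"
  shows "dec_vars Z S \<inter> dec_vars Z T = {}"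
proof (rule ccontr)
  assume "dec_vars Z S \<inter> dec_vars Z T \<noteq> {}"
  then obtain x u w where u: "u \<in> dec_verts S" "gates Z ! u = GVar x" and w: "w \<in> dec_verts T" "gates Z ! w = GVar x"
    by (auto simp: dec_vars_def)
  then have "u < circuit_size Z" "w < circuit_size Z" using assms(3,4) by auto
  then have "u = w" using assms(1) u(2) w(2) unfolding circuit_def by metis
  then show False using u w assms(2) by auto
qed

lemma built_set_reg: "built Z ix N b s gs T t gs' \<Longrightarrow> built Z ix N b s gs T (t(regs := (t regs)(11 := v))) gs'"
  using D_mem_cong[of t gs' "t(regs := (t regs)(11 := v))"] by (simp add: built_def same_input_def)

abbreviation nodes_left :: expr where
  "nodes_left \<equiv> Minus (Load (''T'', ''size'') (Num 0)) (reg 11)"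

text \<open>\<open>d\<close> is the cost of the tests leading to the branch \<open>c\<close>, and 6
  that of advancing the node counter; the 70 leaves room for these and for the loop test.\<close>

lemma wp_round:
  assumes w: "wp c s (\<lambda>n t. n \<le> C \<and> t regs 11 = s regs 11 \<and> (\<exists>gs'. built Z ix N b s0 gs T t gs'))"
    and left: "s regs 11 < s (''T'', ''size'') 0" and K: "C + 70 \<le> K"
    and disp: "\<And>Q. wp node_prog s Q \<longleftrightarrow> wp c s (\<lambda>n t. Q (d + n + 6) (t(regs := (t regs)(11 := t regs 11 + 1))))"
    and d: "d \<le> 50"
  shows "wp_rounds 1 nodes_left node_prog s (\<lambda>n t. n \<le> K \<and> t regs 11 = s regs 11 + 1 \<and>
    (\<exists>gs'. built Z ix N b s0 gs T t gs'))"
proof -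
  have "wp node_prog s (\<lambda>n t. 6 + n \<le> K \<and> t regs 11 = s regs 11 + 1 \<and> (\<exists>gs'. built Z ix N b s0 gs T t gs'))"
    unfolding disp
    by (rule wp_mono[OF w]) (use K d in \<open>auto intro: built_set_reg\<close>)
  then have "wp node_prog s (\<lambda>m t. wp_rounds 0 nodes_left node_prog t
      (\<lambda>m' t. expr_cost nodes_left + 1 + m + m' \<le> K \<and> t regs 11 = s regs 11 + 1 \<and>
        (\<exists>gs'. built Z ix N b s0 gs T t gs')))"
    by (rule wp_mono) simp
  then show ?thesis using left unfolding One_nat_def wp_rounds.simps(2) by simp
qed

text \<open>Dominated by a union, where each of the \<open>N * N\<close> pairs costs one bitwise
  disjunction, of cost \<open>c\<close>; the other nodes are charged the same.\<close>

definition node_cost :: "nat \<Rightarrow> nat \<Rightarrow> nat" where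
  "node_cost N c = 1000 * (N * N * c)"

lemma node_cost_bounds:
  assumes "1 \<le> N" "1 \<le> c"
  shows "N * 50 + 600 + 70 \<le> node_cost N c" "N * (12 * c + 110) + 150 + 70 \<le> node_cost N c"
    "N * (N * (c + 300) + 100) + 100 + 70 \<le> node_cost N c" "1 + 70 \<le> node_cost N c"
proof -
  let ?X = "N * N * c"
  have a: "1 \<le> ?X" "N \<le> ?X" "N * c \<le> ?X" "N * N \<le> ?X" using assms by (simp_all add: mult.assoc)
  show "N * 50 + 600 + 70 \<le> node_cost N c" "1 + 70 \<le> node_cost N c" unfolding node_cost_def using a by linarith+
  have "N * (12 * c + 110) = 12 * (N * c) + 110 * N" by (simp add: algebra_simps)
  then show "N * (12 * c + 110) + 150 + 70 \<le> node_cost N c" unfolding node_cost_def using a by linarith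
  have "N * (N * (c + 300) + 100) = ?X + 300 * (N * N) + 100 * N" by (simp add: algebra_simps)
  then show "N * (N * (c + 300) + 100) + 100 + 70 \<le> node_cost N c" unfolding node_cost_def using a by linarith
qed

text \<open>Induction on the decomposition although the program has no recursion: in the postorder a
  subtree is a contiguous stretch, processed by \<open>dec_nodes T\<close> consecutive rounds, whose
  net effect is to append gates and to push one family.\<close>

lemma wp_nodes:
  assumes Z: "circuit Z" "constant_free Z" and inj: "inj_on ix L"
  shows "prepared Z L ix s \<Longrightarrow> s regs 9 = N \<Longrightarrow> s regs 10 = b \<Longrightarrow> D_mem s gs \<Longrightarrow> dnnf_list0 gs \<Longrightarrow>
    unions_disjoint T \<Longrightarrow> dec_labels T \<subseteq> L \<Longrightarrow> dec_verts T \<subseteq> {..<circuit_size Z} \<Longrightarrow>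
    list_vars gs \<inter> dec_vars Z T = {} \<Longrightarrow> segment s (s regs 11) (postorder T) \<Longrightarrow>
    s regs 11 + dec_nodes T \<le> s (''T'', ''size'') 0 \<Longrightarrow>
    wp_rounds (dec_nodes T) nodes_left node_prog s (\<lambda>n t. n \<le> dec_nodes T * node_cost N (or_cost s) \<and>
      t regs 11 = s regs 11 + dec_nodes T \<and> (\<exists>gs'. built Z ix N b s gs T t gs'))"
proof (induction T arbitrary: s gs b)
  case (Create u a)
  have pos: "1 \<le> N" "1 \<le> or_cost s" using Create.prems(1,2) by (auto simp: prepared_def or_cost_def)
  have op: "s (''T'', ''op'') (s regs 11) = 0" "s (''T'', ''arg1'') (s regs 11) = u" "s (''T'', ''arg2'') (s regs 11) = a"
    using Create.prems(10) by (auto simp: segment_single)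
  have u: "u < circuit_size Z" "a \<in> L" using Create.prems by auto
  have nc: "gates Z ! u \<noteq> GConst c" for c
    using Z(2) u(1) unfolding constant_free_def circuit_size_def by (metis nth_mem)
  have "wp_rounds 1 nodes_left node_prog s (\<lambda>n t. n \<le> node_cost N (or_cost s) \<and> t regs 11 = s regs 11 + 1 \<and>
    (\<exists>gs'. built Z ix N b s gs (Create u a) t gs'))"
  proof (rule wp_round[where d = 4])
    show "wp create_prog s (\<lambda>n t. n \<le> N * 50 + 600 \<and> t regs 11 = s regs 11 \<and>
        (\<exists>gs'. built Z ix N b s gs (Create u a) t gs'))"
      by (rule wp_create_prog[OF Create.prems(1,4,5,3) Create.prems(2)[symmetric] op(2,3) u(2,1) nc Create.prems(9)])
    show "N * 50 + 600 + 70 \<le> node_cost N (or_cost s)" by (rule node_cost_bounds[OF pos])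
    show "wp node_prog s Q \<longleftrightarrow> wp create_prog s (\<lambda>n t. Q (4 + n + 6) (t(regs := (t regs)(11 := t regs 11 + 1))))" for Q
      unfolding node_prog_def using op by (simp add: wp_simps add.assoc del: One_nat_def)
  qed (use Create.prems(11) in simp_all)
  then show ?case by simp
next
  case (Disj_Union S T)
  let ?K = "node_cost N (or_cost s)"
  have pos: "1 \<le> N" "1 \<le> or_cost s" using Disj_Union.prems(1,2) by (auto simp: prepared_def or_cost_def)
  have verts: "dec_verts S \<subseteq> {..<circuit_size Z}" "dec_verts T \<subseteq> {..<circuit_size Z}"
    and labs: "dec_labels S \<subseteq> L" "dec_labels T \<subseteq> L" and ud: "unions_disjoint S" "unions_disjoint T"
    and disj: "dec_verts S \<inter> dec_verts T = {}" using Disj_Union.prems by auto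
  have V: "dec_vars Z S \<inter> dec_vars Z T = {}" by (rule dec_vars_disjoint[OF Z(1) disj verts])
  have VV: "list_vars gs \<inter> dec_vars Z S = {}" "list_vars gs \<inter> dec_vars Z T = {}"
    using Disj_Union.prems(9) by (auto simp: dec_vars_def)
  have seg: "segment s (s regs 11) (postorder S)" "segment s (s regs 11 + dec_nodes S) (postorder T)"
    "segment s (s regs 11 + dec_nodes S + dec_nodes T) [(1, 0, 0)]"
    using Disj_Union.prems(10) by (simp_all add: segment_append length_postorder add.assoc)
  have sz: "s regs 11 + dec_nodes S + dec_nodes T + 1 \<le> s (''T'', ''size'') 0" using Disj_Union.prems(11) by simp
  have IH: "wp_rounds (dec_nodes S) nodes_left node_prog s (\<lambda>n t. n \<le> dec_nodes S * ?K \<and>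
      t regs 11 = s regs 11 + dec_nodes S \<and> (\<exists>gs'. built Z ix N b s gs S t gs'))"
    by (rule Disj_Union.IH(1)) (use Disj_Union.prems seg ud labs verts VV in auto)
  \<comment> \<open>The rounds split into those of \<open>S\<close>, those of \<open>T\<close> on a
    stack higher by one family, and the one of the union itself.\<close>
  have "wp_rounds (dec_nodes S) nodes_left node_prog s (\<lambda>n1 s1. wp_rounds (dec_nodes T) nodes_left node_prog s1
     (\<lambda>n2 s2. wp_rounds 1 nodes_left node_prog s2 (\<lambda>n3 t. n1 + (n2 + n3) \<le> (dec_nodes S + (dec_nodes T + 1)) * ?K \<and>
      t regs 11 = s regs 11 + (dec_nodes S + (dec_nodes T + 1)) \<and>
      (\<exists>gs'. built Z ix N b s gs (Disj_Union S T) t gs'))))"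
  proof (rule wp_rounds_mono[OF IH], goal_cases)
    case (1 n1 s1)
    then obtain gs1 where n1: "n1 \<le> dec_nodes S * ?K" and r1: "s1 regs 11 = s regs 11 + dec_nodes S"
      and b1: "built Z ix N b s gs S s1 gs1" by auto
    have B1: "same_input s s1" "s1 regs 10 = b + N" "D_mem s1 gs1" "dnnf_list0 gs1"
      "list_vars gs1 = list_vars gs \<union> dec_vars Z S"
      using b1 unfolding built_def by blast+
    have oc1: "or_cost s1 = or_cost s" and s1: "s1 regs 9 = N" "s1 (''T'', ''size'') 0 = s (''T'', ''size'') 0"
      using B1(1) Disj_Union.prems(2) by (simp_all add: or_cost_def same_input_def)
    have p1: "prepared Z L ix s1" by (rule prepared_same_input[OF Disj_Union.prems(1) B1(1)])
    have IH2: "wp_rounds (dec_nodes T) nodes_left node_prog s1 (\<lambda>n t. n \<le> dec_nodes T * node_cost N (or_cost s1) \<and>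
        t regs 11 = s1 regs 11 + dec_nodes T \<and> (\<exists>gs'. built Z ix N (b + N) s1 gs1 T t gs'))"
    proof (rule Disj_Union.IH(2)[OF p1 s1(1) B1(2,3,4) ud(2) labs(2) verts(2)])
      show "list_vars gs1 \<inter> dec_vars Z T = {}" using B1(5) VV(2) V by auto
      show "segment s1 (s1 regs 11) (postorder T)" using seg(2) segment_same_input[OF B1(1)] r1 by simp
      show "s1 regs 11 + dec_nodes T \<le> s1 (''T'', ''size'') 0" using r1 s1 sz by simp
    qed
    show ?case
    proof (rule wp_rounds_mono[OF IH2], goal_cases)
      case (1 n2 s2)
      then obtain gs2 where n2: "n2 \<le> dec_nodes T * ?K" and r2: "s2 regs 11 = s regs 11 + dec_nodes S + dec_nodes T"
        and b2: "built Z ix N (b + N) s1 gs1 T s2 gs2" using r1 oc1 by auto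
      have si2: "same_input s s2" using b2 B1(1) same_input_trans unfolding built_def by blast
      have oc2: "or_cost s2 = or_cost s" and s2: "s2 regs 9 = N" "s2 (''T'', ''size'') 0 = s (''T'', ''size'') 0"
        using si2 Disj_Union.prems(2) by (simp_all add: or_cost_def same_input_def)
      have p2: "prepared Z L ix s2" by (rule prepared_same_input[OF Disj_Union.prems(1) si2])
      have op: "s2 (''T'', ''op'') (s2 regs 11) = 1"
        using seg(3)[folded segment_same_input[OF si2]] r2 by (simp add: segment_single)
      have "wp_rounds 1 nodes_left node_prog s2 (\<lambda>n t. n \<le> ?K \<and> t regs 11 = s2 regs 11 + 1 \<and>
        (\<exists>gs'. built Z ix N b s gs (Disj_Union S T) t gs'))"
      proof (rule wp_round[where d = 10])
        show "wp union_prog s2 (\<lambda>n t. n \<le> N * (N * (or_cost s2 + 300) + 100) + 100 \<and> t regs 11 = s2 regs 11 \<and>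
            (\<exists>gs'. built Z ix N b s gs (Disj_Union S T) t gs'))"
          by (rule wp_Disj_Union[OF p2 s2(1)[symmetric] b1 b2 disj V])
        show "N * (N * (or_cost s2 + 300) + 100) + 100 + 70 \<le> ?K" unfolding oc2 by (rule node_cost_bounds[OF pos])
        show "wp node_prog s2 Q \<longleftrightarrow> wp union_prog s2 (\<lambda>n t. Q (10 + n + 6) (t(regs := (t regs)(11 := t regs 11 + 1))))" for Q
          unfolding node_prog_def using op by (simp add: wp_simps add.assoc del: One_nat_def)
      qed (use r2 s2 sz in simp_all)
      then show ?case
        by (rule wp_rounds_mono) (use n1 n2 r2 in \<open>auto simp: algebra_simps\<close>)
    qed
  qed
  then show ?case by (simp only: wp_rounds_add dec_nodes.simps add.assoc)
next
  case (Eta i j T)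
  let ?K = "node_cost N (or_cost s)"
  have pos: "1 \<le> N" "1 \<le> or_cost s" using Eta.prems(1,2) by (auto simp: prepared_def or_cost_def)
  have seg: "segment s (s regs 11) (postorder T)" "segment s (s regs 11 + dec_nodes T) [(2, i, j)]"
    using Eta.prems(10) by (simp_all add: segment_append length_postorder)
  have IH: "wp_rounds (dec_nodes T) nodes_left node_prog s (\<lambda>n t. n \<le> dec_nodes T * ?K \<and>
      t regs 11 = s regs 11 + dec_nodes T \<and> (\<exists>gs'. built Z ix N b s gs T t gs'))"
    by (rule Eta.IH) (use Eta.prems seg in \<open>auto simp: dec_vars_def\<close>)
  have "wp_rounds (dec_nodes T) nodes_left node_prog s (\<lambda>n1 s1. wp_rounds 1 nodes_left node_prog s1
     (\<lambda>n2 t. n1 + n2 \<le> (dec_nodes T + 1) * ?K \<and> t regs 11 = s regs 11 + (dec_nodes T + 1) \<and>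
      (\<exists>gs'. built Z ix N b s gs (Eta i j T) t gs')))"
  proof (rule wp_rounds_mono[OF IH], goal_cases)
    case (1 n1 s1)
    then obtain gs1 where n1: "n1 \<le> dec_nodes T * ?K" and r1: "s1 regs 11 = s regs 11 + dec_nodes T"
      and b1: "built Z ix N b s gs T s1 gs1" by auto
    have si: "same_input s s1" using b1 unfolding built_def by blast
    have oc: "or_cost s1 = or_cost s" and s1: "s1 regs 9 = N" "s1 (''T'', ''size'') 0 = s (''T'', ''size'') 0"
      using si Eta.prems(2) by (simp_all add: or_cost_def same_input_def)
    have p1: "prepared Z L ix s1" by (rule prepared_same_input[OF Eta.prems(1) si])
    have op: "s1 (''T'', ''op'') (s1 regs 11) = 2" "s1 (''T'', ''arg1'') (s1 regs 11) = i" "s1 (''T'', ''arg2'') (s1 regs 11) = j"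
      using seg(2)[folded segment_same_input[OF si]] r1 by (simp_all add: segment_single)
    have "wp_rounds 1 nodes_left node_prog s1 (\<lambda>n t. n \<le> ?K \<and> t regs 11 = s1 regs 11 + 1 \<and>
        (\<exists>gs'. built Z ix N b s gs (Eta i j T) t gs'))"
    proof (rule wp_round[where d = 16])
      show "wp (relabel_prog eta_state) s1 (\<lambda>n t. n \<le> N * (12 * or_cost s1 + 110) + 150 \<and> t regs 11 = s1 regs 11 \<and>
          (\<exists>gs'. built Z ix N b s gs (Eta i j T) t gs'))"
        by (rule wp_mono[OF wp_Eta[OF p1 s1(1)[symmetric] b1 op(2,3) inj Eta.prems(7)]]) auto
      show "N * (12 * or_cost s1 + 110) + 150 + 70 \<le> ?K" unfolding oc by (rule node_cost_bounds[OF pos])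
      show "wp node_prog s1 Q \<longleftrightarrow> wp (relabel_prog eta_state) s1 (\<lambda>n t. Q (16 + n + 6) (t(regs := (t regs)(11 := t regs 11 + 1))))" for Q
        unfolding node_prog_def using op by (simp add: wp_simps add.assoc del: One_nat_def)
    qed (use r1 s1 Eta.prems(11) in simp_all)
    then show ?case
      by (rule wp_rounds_mono) (use n1 r1 in \<open>auto simp: algebra_simps\<close>)
  qed
  then show ?case by (simp only: wp_rounds_add dec_nodes.simps)
next
  case (Rho i j T)
  let ?K = "node_cost N (or_cost s)"
  have pos: "1 \<le> N" "1 \<le> or_cost s" using Rho.prems(1,2) by (auto simp: prepared_def or_cost_def)
  have seg: "segment s (s regs 11) (postorder T)" "segment s (s regs 11 + dec_nodes T) [(3, i, j)]"
    using Rho.prems(10) by (simp_all add: segment_append length_postorder)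
  have IH: "wp_rounds (dec_nodes T) nodes_left node_prog s (\<lambda>n t. n \<le> dec_nodes T * ?K \<and>
      t regs 11 = s regs 11 + dec_nodes T \<and> (\<exists>gs'. built Z ix N b s gs T t gs'))"
    by (rule Rho.IH) (use Rho.prems seg in \<open>auto simp: dec_vars_def\<close>)
  have "wp_rounds (dec_nodes T) nodes_left node_prog s (\<lambda>n1 s1. wp_rounds 1 nodes_left node_prog s1
     (\<lambda>n2 t. n1 + n2 \<le> (dec_nodes T + 1) * ?K \<and> t regs 11 = s regs 11 + (dec_nodes T + 1) \<and>
      (\<exists>gs'. built Z ix N b s gs (Rho i j T) t gs')))"
  proof (rule wp_rounds_mono[OF IH], goal_cases)
    case (1 n1 s1)
    then obtain gs1 where n1: "n1 \<le> dec_nodes T * ?K" and r1: "s1 regs 11 = s regs 11 + dec_nodes T"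
      and b1: "built Z ix N b s gs T s1 gs1" by auto
    have si: "same_input s s1" using b1 unfolding built_def by blast
    have oc: "or_cost s1 = or_cost s" and s1: "s1 regs 9 = N" "s1 (''T'', ''size'') 0 = s (''T'', ''size'') 0"
      using si Rho.prems(2) by (simp_all add: or_cost_def same_input_def)
    have p1: "prepared Z L ix s1" by (rule prepared_same_input[OF Rho.prems(1) si])
    have op: "s1 (''T'', ''op'') (s1 regs 11) = 3" "s1 (''T'', ''arg1'') (s1 regs 11) = i" "s1 (''T'', ''arg2'') (s1 regs 11) = j"
      using seg(2)[folded segment_same_input[OF si]] r1 by (simp_all add: segment_single)
    have "wp_rounds 1 nodes_left node_prog s1 (\<lambda>n t. n \<le> ?K \<and> t regs 11 = s1 regs 11 + 1 \<and>
        (\<exists>gs'. built Z ix N b s gs (Rho i j T) t gs'))"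
    proof (cases "i = j")
      case True
      have bR: "built Z ix N b s gs (Rho i j T) s1 gs1"
        using b1 family_Rho_same unfolding built_def True by (auto simp: dec_vars_def)
      show ?thesis
      proof (rule wp_round[where d = 32])
        show "wp Skip s1 (\<lambda>n t. n \<le> 1 \<and> t regs 11 = s1 regs 11 \<and> (\<exists>gs'. built Z ix N b s gs (Rho i j T) t gs'))"
          using bR by (auto simp: wp_Skip)
        show "1 + 70 \<le> ?K" by (rule node_cost_bounds[OF pos])
        show "wp node_prog s1 Q \<longleftrightarrow> wp Skip s1 (\<lambda>n t. Q (32 + n + 6) (t(regs := (t regs)(11 := t regs 11 + 1))))" for Q
          unfolding node_prog_def using op True by (simp add: wp_simps add.assoc del: One_nat_def)
      qed (use r1 s1 Rho.prems(11) in simp_all)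
    next
      case False
      show ?thesis
      proof (rule wp_round[where d = 32])
        show "wp (relabel_prog (rho_state 6)) s1 (\<lambda>n t. n \<le> N * (12 * or_cost s1 + 110) + 150 \<and> t regs 11 = s1 regs 11 \<and>
            (\<exists>gs'. built Z ix N b s gs (Rho i j T) t gs'))"
          by (rule wp_mono[OF wp_Rho[OF p1 s1(1)[symmetric] b1 op(2,3) inj Rho.prems(7) False]]) auto
        show "N * (12 * or_cost s1 + 110) + 150 + 70 \<le> ?K" unfolding oc by (rule node_cost_bounds[OF pos])
        show "wp node_prog s1 Q \<longleftrightarrow> wp (relabel_prog (rho_state 6)) s1 (\<lambda>n t. Q (32 + n + 6) (t(regs := (t regs)(11 := t regs 11 + 1))))" for Q
          unfolding node_prog_def using op False by (simp add: wp_simps add.assoc del: One_nat_def)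
      qed (use r1 s1 Rho.prems(11) in simp_all)
    qed
    then show ?case
      by (rule wp_rounds_mono) (use n1 r1 in \<open>auto simp: algebra_simps\<close>)
  qed
  then show ?case by (simp only: wp_rounds_add dec_nodes.simps)
qed

section \<open>Numbering the labels\<close>

text \<open>Cells 8 and 9 hold \<open>c\<close> and \<open>2 ^ c\<close>; counting up by one stores
  the old power, so the table of powers arises on the way.\<close>

definition double :: prog where
  "double = Store powers (reg 8) (reg 9) ;; set_reg 8 (Plus (reg 8) (Num 1)) ;; set_reg 9 (Plus (reg 9) (reg 9))"

text \<open>Labels are arbitrary numbers and are renumbered in the order of appearance, so that the
  number of states depends on the width alone. An entry 0 of \<open>label_mask\<close> means unseen,
  as no power of two is 0. On the way through the six doublings, facts 4 and 5 of the new label are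
  added to the mask of needs in cell 14.\<close>

definition add_label :: "expr \<Rightarrow> prog" where
  "add_label e = Cond (Load label_mask e) Skip
     (Store label_mask e (reg 9) ;; double ;; double ;; double ;; double ;;
      set_reg 14 (Plus (reg 14) (reg 9)) ;; double ;;
      set_reg 14 (Plus (reg 14) (reg 9)) ;; double)"

definition labelled :: "nat set \<Rightarrow> (nat \<Rightarrow> nat) \<Rightarrow> memory \<Rightarrow> bool" where
  "labelled A ix s \<longleftrightarrow> finite A \<and> inj_on ix A \<and> (\<forall>a \<in> A. ix a < card A) \<and>
     s regs 8 = 6 * card A \<and> s regs 9 = 2 ^ (6 * card A) \<and> powers_ready s \<and>
     (\<forall>a. s label_mask a = (if a \<in> A then 2 ^ (6 * ix a) else 0)) \<and>
     bits (s regs 14) = (\<Union>a \<in> A. {6 * ix a + 4, 6 * ix a + 5})"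

definition keeps_input :: "memory \<Rightarrow> memory \<Rightarrow> bool" where
  "keeps_input s t \<longleftrightarrow> (\<forall>a. a \<noteq> regs \<longrightarrow> a \<noteq> powers \<longrightarrow> a \<noteq> label_mask \<longrightarrow> t a = s a) \<and>
     (\<forall>i. i \<noteq> 8 \<longrightarrow> i \<noteq> 9 \<longrightarrow> i \<noteq> 14 \<longrightarrow> t regs i = s regs i)"

lemma keeps_input_trans: "keeps_input s t \<Longrightarrow> keeps_input t u \<Longrightarrow> keeps_input s u"
  unfolding keeps_input_def by simp

definition doubled :: "nat \<Rightarrow> memory \<Rightarrow> bool" where
  "doubled c s \<longleftrightarrow> s regs 8 = c \<and> s regs 9 = 2 ^ c \<and> powers_ready s"

lemma wp_double:
  assumes "doubled c s"
    and Q: "\<And>t. doubled (Suc c) t \<Longrightarrow> t label_mask = s label_mask \<Longrightarrow> t regs 14 = s regs 14 \<Longrightarrow>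
      keeps_input s t \<Longrightarrow> Q 18 t"
  shows "wp double s Q"
proof -
  let ?t = "s(powers := (s powers)(c := 2 ^ c), regs := (s regs)(8 := c + 1, 9 := 2 ^ c + 2 ^ c))"
  have s: "s regs 8 = c" "s regs 9 = 2 ^ c" "\<And>l. l < c \<Longrightarrow> s powers l = 2 ^ l"
    using assms(1) by (auto simp: doubled_def powers_ready_def)
  have "Q 18 ?t"
    by (rule Q) (use s in \<open>auto simp: doubled_def powers_ready_def keeps_input_def less_Suc_eq\<close>)
  then show ?thesis unfolding double_def using s by (simp add: wp_simps del: One_nat_def)
qed

lemma bits_add_exp: "p \<notin> bits x \<Longrightarrow> bits (x + 2 ^ p) = insert p (bits x)"
  using bits_add_disjoint[of x "2 ^ p"] by (simp add: bits_or bits_exp)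

lemma wp_new_label:
  assumes c: "doubled c s" and e: "expr_val e s = a" "expr_cost e = 3"
  shows "wp (Store label_mask e (reg 9) ;; double ;; double ;; double ;; double ;;
      set_reg 14 (Plus (reg 14) (reg 9)) ;; double ;;
      set_reg 14 (Plus (reg 14) (reg 9)) ;; double) s
    (\<lambda>n t. n \<le> 140 \<and> doubled (c + 6) t \<and> t label_mask = (s label_mask)(a := 2 ^ c) \<and>
       t regs 14 = s regs 14 + 2 ^ (c + 4) + 2 ^ (c + 5) \<and> keeps_input s t)"
proof -
  have d: "doubled c (s(label_mask := f))" "doubled b (t(regs := (t regs)(14 := x)))" if "doubled b t" for f t x b
    using c that by (auto simp: doubled_def powers_ready_def)
  have k: "keeps_input s (s(label_mask := f))" for f by (simp add: keeps_input_def)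
  have k': "keeps_input s (t(regs := (t regs)(14 := x)))" if "keeps_input s t" for t x
    using that by (simp add: keeps_input_def)
  have r9: "s regs 9 = 2 ^ c" using c by (simp add: doubled_def)
  show ?thesis unfolding wp_Seq wp_Store[of label_mask] e r9[symmetric]
    apply (rule wp_double[OF d(1)[OF c]])
    subgoal premises p1 for t1
      apply (rule wp_double[OF p1(1)])
      subgoal premises p2 for t2
        apply (rule wp_double[OF p2(1)])
        subgoal premises p3 for t3
          apply (rule wp_double[OF p3(1)])
          subgoal premises p4 for t4
            unfolding wp_Store[of regs "Num 14"] expr_val.simps(1)
            apply (rule wp_double[OF d(2)[OF p4(1)]])
            subgoal premises p5 for t5
              apply (rule wp_double[OF d(2)[OF p5(1)]])
              subgoal premises p6 for t6
              proof -
                note p = p1(2-4) p2(2-4) p3(2-4) p4(2-4) p5(2-4) p6(2-4)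
                have r: "t4 regs 9 = 2 ^ (c + 4)" "t5 regs 9 = 2 ^ (c + 5)"
                  using p4(1) p5(1) by (simp_all add: doubled_def power_add)
                have "keeps_input s t4"
                  using k p1(4) p2(4) p3(4) p4(4) by (blast intro: keeps_input_trans)
                then have "keeps_input s t5" using k' p5(4) by (blast intro: keeps_input_trans)
                then have "keeps_input s t6" using k' p6(4) by (blast intro: keeps_input_trans)
                moreover have "doubled (c + 6) t6" using p6(1) by (simp add: numeral_eq_Suc)
                moreover have "t6 label_mask = (s label_mask)(a := s regs 9)" using p by simp
                moreover have "t6 regs 14 = s regs 14 + 2 ^ (c + 4) + 2 ^ (c + 5)" using p r by simp
                ultimately show ?thesis using e(2) by simp
              qed
              done
            done
          done
        done
      done
    done
qed

lemma wp_add_label: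
  assumes lb: "labelled A ix s" and e: "expr_val e s = a" "expr_cost e = 3"
  shows "wp (add_label e) s (\<lambda>n t. n \<le> 150 \<and> keeps_input s t \<and> (\<exists>ix'. labelled (insert a A) ix' t))"
proof -
  have L: "finite A" "inj_on ix A" "\<And>a. a \<in> A \<Longrightarrow> ix a < card A" "s regs 8 = 6 * card A"
    "s regs 9 = 2 ^ (6 * card A)" "powers_ready s"
    "\<And>a. s label_mask a = (if a \<in> A then 2 ^ (6 * ix a) else 0)"
    "bits (s regs 14) = (\<Union>a \<in> A. {6 * ix a + 4, 6 * ix a + 5})"
    using lb unfolding labelled_def by blast+
  show ?thesis
  proof (cases "a \<in> A")
    case True
    then have "wp (add_label e) s (\<lambda>n t. n \<le> 150 \<and> t = s)"
      unfolding add_label_def using e L(7)[of a] by (simp add: wp_simps)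
    then show ?thesis by (rule wp_mono) (use lb True in \<open>auto simp: keeps_input_def insert_absorb\<close>)
  next
    case False
    define c where "c = 6 * card A"
    have lm: "s label_mask a = 0" using L(7)[of a] False by simp
    have d: "doubled c s" using L(4-6) by (simp add: doubled_def c_def)
    \<comment> \<open>The new label takes the next free number \<open>card A\<close>, hence the six
      positions from \<open>c\<close> on.\<close>
    have new: "labelled (insert a A) (ix(a := card A)) u" (is "labelled _ ?ix _")
      if u: "doubled (c + 6) u" "u label_mask = (s label_mask)(a := 2 ^ c)"
        "u regs 14 = s regs 14 + 2 ^ (c + 4) + 2 ^ (c + 5)" for u
    proof -
      have c': "card (insert a A) = Suc (card A)" using L(1) False by simp
      have lt: "bits (s regs 14) \<subseteq> {..<c}" using L(3) unfolding L(8) c_def by fastforce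
      have 1: "bits (s regs 14 + 2 ^ (c + 4)) = bits (s regs 14) \<union> {c + 4}"
        using lt by (subst bits_add_exp) auto
      have 2: "bits (u regs 14) = bits (s regs 14 + 2 ^ (c + 4)) \<union> {c + 5}"
        unfolding u(3) by (subst bits_add_exp) (use lt in \<open>auto simp: 1\<close>)
      have b: "bits (u regs 14) = (\<Union>b \<in> insert a A. {6 * ?ix b + 4, 6 * ?ix b + 5})"
      proof -
        have "bits (u regs 14) = bits (s regs 14) \<union> {c + 4, c + 5}" using 1 2 by auto
        moreover have "(\<Union>b \<in> A. {6 * ?ix b + 4, 6 * ?ix b + 5}) = (\<Union>b \<in> A. {6 * ix b + 4, 6 * ix b + 5})"
          by (rule SUP_cong) (use False in auto)
        ultimately show ?thesis unfolding L(8) c_def UN_insert by auto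
      qed
      have "inj_on ?ix (insert a A)"
        unfolding inj_on_insert
      proof
        show "inj_on ?ix A" using L(2) by (rule inj_on_cong[THEN iffD1, rotated]) (use False in auto)
        show "?ix a \<notin> ?ix ` (A - {a})"
        proof
          assume "?ix a \<in> ?ix ` (A - {a})"
          then obtain b where "?ix a = ?ix b" "b \<in> A - {a}" by (rule imageE)
          then have "b \<in> A" "ix b = card A" by auto
          then show False using L(3)[of b] by simp
        qed
      qed
      moreover have "\<forall>b \<in> insert a A. ?ix b < card (insert a A)" using L(3) c' False by (auto intro: less_SucI)
      moreover have "u regs 8 = 6 * card (insert a A)" "u regs 9 = 2 ^ (6 * card (insert a A))" "powers_ready u"
        using u(1) unfolding c' doubled_def by (simp_all add: c_def add.commute)
      moreover have "\<forall>b. u label_mask b = (if b \<in> insert a A then 2 ^ (6 * ?ix b) else 0)"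
        using L(7) u(2) by (auto simp: c_def)
      ultimately show ?thesis unfolding labelled_def using b L(1) by blast
    qed
    show ?thesis unfolding add_label_def wp_Cond using lm e
      by simp (rule wp_mono[OF wp_new_label[OF d e]], use new in auto)
  qed
qed

text \<open>A pass of its own, because the number of states has to be known before the first family
  is put on the stack.\<close>

definition label_pass :: prog where
  "label_pass = While nodes_left
     (Cond T_op (Cond (Minus T_op (Num 1)) (add_label T_arg1 ;; add_label T_arg2) Skip) (add_label T_arg2) ;;
      set_reg 11 (Plus (reg 11) (Num 1)))"

fun node_labels :: "nat \<times> nat \<times> nat \<Rightarrow> nat set" where
  "node_labels (x, i, j) = (if x = 0 then {j} else if x = 1 then {} else {i, j})"

lemma node_labels_postorder: "(\<Union>x \<in> set (postorder T). node_labels x) = dec_labels T"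
  by (induction T) auto

lemma wp_label_pass:
  assumes T: "dec_in_memory ''T'' s T" and s0: "s regs 11 = 0" and lb: "labelled {} (\<lambda>_. 0) s"
  shows "wp label_pass s (\<lambda>n t. n \<le> dec_nodes T * 400 + 10 \<and>
    (\<forall>a. a \<noteq> regs \<longrightarrow> a \<noteq> powers \<longrightarrow> a \<noteq> label_mask \<longrightarrow> t a = s a) \<and>
    (\<forall>i. i \<noteq> 8 \<longrightarrow> i \<noteq> 9 \<longrightarrow> i \<noteq> 11 \<longrightarrow> i \<noteq> 14 \<longrightarrow> t regs i = s regs i) \<and>
    (\<exists>ix. labelled (dec_labels T) ix t))"
proof -
  let ?xs = "postorder T"
  define I where "I l t \<longleftrightarrow>
    (\<forall>a. a \<noteq> regs \<longrightarrow> a \<noteq> powers \<longrightarrow> a \<noteq> label_mask \<longrightarrow> t a = s a) \<and>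
    (\<forall>i. i \<noteq> 8 \<longrightarrow> i \<noteq> 9 \<longrightarrow> i \<noteq> 11 \<longrightarrow> i \<noteq> 14 \<longrightarrow> t regs i = s regs i) \<and> t regs 11 = l \<and>
    (\<exists>ix. labelled (\<Union>x \<in> set (take l ?xs). node_labels x) ix t)" for l t
  have lb_cong: "labelled A ix (t(regs := (t regs)(11 := v)))" if "labelled A ix t" for A ix t v
    using that by (simp add: labelled_def powers_ready_def)
  let ?b = "Cond T_op (Cond (Minus T_op (Num 1)) (add_label T_arg1 ;; add_label T_arg2) Skip) (add_label T_arg2)"
  show ?thesis unfolding label_pass_def
  proof (rule wp_While_count[where I = I and k = "dec_nodes T" and C = 400])
    show "I 0 s" using s0 lb by (auto simp: I_def)
    show "expr_val nodes_left t = 0" if "I (dec_nodes T) t" for t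
      using that T by (simp add: I_def dec_in_memory_def)
    fix l t assume l: "l < dec_nodes T" and I: "I l t"
    let ?A = "\<Union>x \<in> set (take l ?xs). node_labels x"
    obtain ix where ar: "\<And>a. a \<noteq> regs \<Longrightarrow> a \<noteq> powers \<Longrightarrow> a \<noteq> label_mask \<Longrightarrow> t a = s a"
      and rg: "\<And>i. i \<noteq> 8 \<Longrightarrow> i \<noteq> 9 \<Longrightarrow> i \<noteq> 11 \<Longrightarrow> i \<noteq> 14 \<Longrightarrow> t regs i = s regs i"
      and r11: "t regs 11 = l" and lt: "labelled ?A ix t" using I unfolding I_def by blast
    obtain x i j where xs: "?xs ! l = (x, i, j)" by (cases "?xs ! l") auto
    have "(s (''T'', ''op'') l, s (''T'', ''arg1'') l, s (''T'', ''arg2'') l) = (x, i, j)"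
      using T l xs unfolding dec_in_memory_def by metis
    then have sx: "s (''T'', ''op'') l = x" "s (''T'', ''arg1'') l = i" "s (''T'', ''arg2'') l = j" by simp_all
    have val: "expr_val T_op u = x" "expr_val T_arg1 u = i" "expr_val T_arg2 u = j" if "keeps_input t u" for u
      using that sx ar r11 by (simp_all add: keeps_input_def)
    have kt: "keeps_input t t" by (simp add: keeps_input_def)
    have ins: "(\<Union>x \<in> set (take (Suc l) ?xs). node_labels x) = ?A \<union> node_labels (x, i, j)"
      using l xs by (auto simp: take_Suc_conv_app_nth length_postorder)
    have "wp ?b t (\<lambda>n u. n \<le> 350 \<and> keeps_input t u \<and> (\<exists>ix. labelled (?A \<union> node_labels (x, i, j)) ix u))"
    proof -
      consider "x = 0" | "x = 1" | "2 \<le> x" by linarith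
      then show ?thesis
      proof cases
        case 1
        have "wp (add_label T_arg2) t (\<lambda>n u. n \<le> 150 \<and> keeps_input t u \<and> (\<exists>ix'. labelled (insert j ?A) ix' u))"
          by (rule wp_add_label[OF lt val(3)[OF kt]]) simp
        then show ?thesis unfolding wp_Cond val[OF kt] using 1
          by (simp del: expr_val.simps UN_simps UN_extend_simps) (erule wp_mono, auto)
      next
        case 2
        then show ?thesis unfolding wp_Cond wp_Skip using val(1)[OF kt] lt kt by auto
      next
        case 3
        have "wp (add_label T_arg1) t (\<lambda>n u. n \<le> 150 \<and> keeps_input t u \<and> (\<exists>ix'. labelled (insert i ?A) ix' u))"
          by (rule wp_add_label[OF lt val(2)[OF kt]]) simp
        then have "wp (add_label T_arg1 ;; add_label T_arg2) t (\<lambda>n u. n \<le> 300 \<and> keeps_input t u \<and>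
            (\<exists>ix'. labelled (insert j (insert i ?A)) ix' u))"
          unfolding wp_Seq
        proof (rule wp_mono, elim conjE exE)
          fix n :: nat and u ix' assume n: "n \<le> 150" and ku: "keeps_input t u" and lu: "labelled (insert i ?A) ix' u"
          have "wp (add_label T_arg2) u (\<lambda>n u'. n \<le> 150 \<and> keeps_input u u' \<and>
              (\<exists>ix'. labelled (insert j (insert i ?A)) ix' u'))"
            by (rule wp_add_label[OF lu val(3)[OF ku]]) simp
          then show "wp (add_label T_arg2) u (\<lambda>n' u'. n + n' \<le> 300 \<and> keeps_input t u' \<and>
              (\<exists>ix'. labelled (insert j (insert i ?A)) ix' u'))"
            by (rule wp_mono) (use n keeps_input_trans[OF ku] in auto)
        qed
        moreover have "?A \<union> node_labels (x, i, j) = insert j (insert i ?A)" using 3 by auto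
        moreover have "expr_val (Minus T_op (Num 1)) t \<noteq> 0" "expr_val T_op t \<noteq> 0"
          using 3 val(1)[OF kt] by simp_all
        ultimately show ?thesis unfolding wp_Cond by (simp only: if_True not_False_eq_True) (erule wp_mono, simp)
      qed
    qed
    then have "wp (?b ;; set_reg 11 (Plus (reg 11) (Num 1))) t (\<lambda>n u. n + expr_cost nodes_left + 1 \<le> 400 \<and> I (Suc l) u)"
      unfolding wp_Seq[of ?b]
    proof (rule wp_mono, elim conjE exE)
      fix n :: nat and u ix' assume n: "n \<le> 350" and ku: "keeps_input t u"
        and lu: "labelled (?A \<union> node_labels (x, i, j)) ix' u"
      have ku': "\<And>a. a \<noteq> regs \<Longrightarrow> a \<noteq> powers \<Longrightarrow> a \<noteq> label_mask \<Longrightarrow> u a = t a"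
        "\<And>i. i \<noteq> 8 \<Longrightarrow> i \<noteq> 9 \<Longrightarrow> i \<noteq> 14 \<Longrightarrow> u regs i = t regs i"
        using ku unfolding keeps_input_def by blast+
      have "I (Suc l) (u(regs := (u regs)(11 := u regs 11 + 1)))" (is "I _ ?u")
        unfolding I_def ins
      proof (intro conjI allI impI)
        show "?u a = s a" if "a \<noteq> regs" "a \<noteq> powers" "a \<noteq> label_mask" for a using that ku'(1) ar by simp
        show "?u regs i = s regs i" if "i \<noteq> 8" "i \<noteq> 9" "i \<noteq> 11" "i \<noteq> 14" for i using that ku'(2) rg by simp
        show "?u regs 11 = Suc l" using ku'(2) r11 by simp
        show "\<exists>ix. labelled (?A \<union> node_labels (x, i, j)) ix ?u" using lb_cong[OF lu] by blast
      qed
      then show "wp (set_reg 11 (Plus (reg 11) (Num 1))) u (\<lambda>n' u. n + n' + expr_cost nodes_left + 1 \<le> 400 \<and> I (Suc l) u)"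
        unfolding wp_Store using n by (simp del: One_nat_def)
    qed
    moreover have "expr_val nodes_left t \<noteq> 0" using T l ar r11 by (simp add: dec_in_memory_def)
    ultimately show "expr_val nodes_left t \<noteq> 0 \<and>
        wp (?b ;; set_reg 11 (Plus (reg 11) (Num 1))) t (\<lambda>n u. n + expr_cost nodes_left + 1 \<le> 400 \<and> I (Suc l) u)" by blast
  next
    fix n t assume n: "n \<le> dec_nodes T * 400 + expr_cost nodes_left + 1" and I: "I (dec_nodes T) t"
    have "take (dec_nodes T) ?xs = ?xs" by (simp add: length_postorder)
    then have "\<exists>ix. labelled (dec_labels T) ix t" using I unfolding I_def by (simp add: node_labels_postorder)
    then show "n \<le> dec_nodes T * 400 + 10 \<and>
      (\<forall>a. a \<noteq> regs \<longrightarrow> a \<noteq> powers \<longrightarrow> a \<noteq> label_mask \<longrightarrow> t a = s a) \<and>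
      (\<forall>i. i \<noteq> 8 \<longrightarrow> i \<noteq> 9 \<longrightarrow> i \<noteq> 11 \<longrightarrow> i \<noteq> 14 \<longrightarrow> t regs i = s regs i) \<and>
      (\<exists>ix. labelled (dec_labels T) ix t)" using n I unfolding I_def by (intro conjI) simp_all
  qed
qed

section \<open>The output gate\<close>

text \<open>The copy of \<open>g\<close> avoids a gate with two equal inputs: \<open>g\<close> and
  the accumulated \<open>a\<close> may coincide, for instance when both are gate 0.\<close>

lemma disjoin_gate:
  assumes gs: "dnnf_list0 gs" and g: "g < length gs" and a: "a < length gs"
  defines "gs' \<equiv> gs @ [GOr [g], GOr [a, length gs]]"
  shows "dnnf_list0 gs'" "list_vars gs' = list_vars gs"
    "gate_true gs' \<alpha> (Suc (length gs)) \<longleftrightarrow> gate_true gs \<alpha> a \<or> gate_true gs \<alpha> g"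
proof -
  let ?h = "gs @ [GOr [g]]"
  have eq: "gs' = ?h @ [GOr [a, length gs]]" by (simp add: gs'_def)
  have ok: "dnnf_list0 ?h" by (rule dnnf_list0_snoc[OF gs]) (use g in \<open>simp add: appendable_def\<close>)
  have in': "i < length ?h" if "i \<in> set (gate_inputs (GOr [a, length gs]))" for i using that a by auto
  show "dnnf_list0 gs'" unfolding eq
    by (rule dnnf_list0_snoc[OF ok]) (use a in \<open>auto simp: appendable_def\<close>)
  show "list_vars gs' = list_vars gs" unfolding eq list_vars_snoc by simp
  have "gate_true ?h \<alpha> (length gs) = gate_fun \<alpha> (gate_true gs \<alpha>) (GOr [g])"
    by (rule gate_true_snoc[OF dnnf_list0D[OF gs]]) (use g in simp)
  moreover have "gate_true gs' \<alpha> (length ?h) = gate_fun \<alpha> (gate_true ?h \<alpha>) (GOr [a, length gs])"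
    unfolding eq by (rule gate_true_snoc[OF dnnf_list0D[OF ok] in'])
  ultimately show "gate_true gs' \<alpha> (Suc (length gs)) \<longleftrightarrow> gate_true gs \<alpha> a \<or> gate_true gs \<alpha> g"
    using gate_true_append[OF dnnf_list0D[OF gs] a, of "[GOr [g]]" \<alpha>] by auto
qed

definition disjoin_prog :: prog where
  "disjoin_prog =
     set_reg 2 (Num 5) ;; set_reg 3 (Num 1) ;; set_reg 5 (Load stack_gate (reg 12)) ;; add_gate ;;
     set_reg 3 (Num 2) ;; set_reg 5 (reg 13) ;; set_reg 6 (Minus D_size (Num 1)) ;; add_gate ;;
     set_reg 13 (Minus D_size (Num 1))"

lemma wp_disjoin_prog:
  assumes D: "D_mem s gs"
    and Q: "\<And>n t. n \<le> 150 \<Longrightarrow> D_mem t (gs @ [GOr [s stack_gate (s regs 12)], GOr [s regs 13, length gs]]) \<Longrightarrow>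
      (\<And>a. fst a \<noteq> ''D'' \<Longrightarrow> a \<noteq> regs \<Longrightarrow> t a = s a) \<Longrightarrow>
      (\<And>i. 8 \<le> i \<Longrightarrow> i \<noteq> 13 \<Longrightarrow> t regs i = s regs i) \<Longrightarrow> t regs 13 = Suc (length gs) \<Longrightarrow> Q n t"
  shows "wp disjoin_prog s Q"
proof -
  let ?g = "s stack_gate (s regs 12)"
  have size: "t (''D'', ''size'') 0 = length hs" if "D_mem t hs" for t hs using that by (simp add: D_mem_def)
  show ?thesis unfolding disjoin_prog_def wp_Seq wp_Store
    apply (simp del: One_nat_def)
    apply (rule wp_add_gate[where gs = gs and G = "GOr [?g]"])
    subgoal by (rule D_mem_cong[OF D]) simp
    subgoal by simp
    subgoal by simp
    subgoal by simp
    subgoal by simp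
    subgoal by simp
    subgoal by simp
    subgoal premises p1 for t1
    proof -
      have a1: "t1 a = s a" if "a \<noteq> regs" "fst a \<noteq> ''D''" for a using p1(2)[OF that(2)] that by simp
      have r1: "t1 regs i = s regs i" if "8 \<le> i" for i using p1(2)[of regs] that by simp
      have v1: "t1 regs 2 = 5" using p1(2)[of regs] by simp
      show ?thesis
        apply (rule wp_add_gate[where gs = "gs @ [GOr [?g]]" and G = "GOr [s regs 13, length gs]"])
        subgoal by (rule D_mem_cong[OF p1(1)]) simp
        subgoal by (simp add: v1)
        subgoal by simp
        subgoal by simp
        subgoal by simp
        subgoal by (simp add: r1)
        subgoal by (simp add: size[OF p1(1)])
        subgoal premises p2 for t2
        proof (rule Q)
          have a2: "t2 a = s a" if "a \<noteq> regs" "fst a \<noteq> ''D''" for a using p2(2)[OF that(2)] that a1 by simp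
          have r2: "t2 regs i = s regs i" if "8 \<le> i" for i using p2(2)[of regs] that r1 by simp
          let ?u = "t2(regs := (t2 regs)(13 := t2 (''D'', ''size'') 0 - 1))"
          show "D_mem ?u (gs @ [GOr [?g], GOr [s regs 13, length gs]])"
            by (rule D_mem_cong[of t2]) (use p2(1) in simp_all)
          show "?u a = s a" if "fst a \<noteq> ''D''" "a \<noteq> regs" for a using that a2 by simp
          show "?u regs i = s regs i" if "8 \<le> i" "i \<noteq> 13" for i using that r2 by simp
          show "?u regs 13 = Suc (length gs)" using size[OF p2(1)] by simp
        qed simp
        done
    qed
    done
qed

text \<open>A state is accepted if it shares no bit with the mask of all needs in cell 14, which is
  tested by comparing disjunction and sum. Cell 13 starts with gate 0, the empty disjunction; the
  root family begins at the bottom of the stack, so cell 12 is also the stack index.\<close>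

definition final_prog :: prog where
  "final_prog =
     set_reg 12 (Num 0) ;; set_reg 13 (Num 0) ;;
     While (Minus (reg 9) (reg 12))
       (set_reg 2 (Load stack_state (reg 12)) ;; set_reg 3 (reg 14) ;; or_prog ;;
        Cond (differ (reg 5) (Plus (Load stack_state (reg 12)) (reg 14))) Skip disjoin_prog ;;
        set_reg 12 (Plus (reg 12) (Num 1))) ;;
     Store (''D'', ''output'') (Num 0) (reg 13)"

lemma wp_final_prog:
  assumes D: "D_mem s gs" and gs: "dnnf_list0 gs" and pr: "powers_ready s"
    and N: "s regs 9 = N" "N = 2 ^ s regs 8" and M: "s regs 14 < N"
    and F: "family_sound N gs V (s stack_gate) (s stack_state)"
  shows "wp final_prog s (\<lambda>n t. n \<le> N * (or_cost s + 250) + 30 \<and>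
    (\<exists>gs'. D_mem t gs' \<and> dnnf_list0 gs' \<and> list_vars gs' = list_vars gs \<and> length gs' \<le> length gs + 2 * N \<and>
      t (''D'', ''output'') 0 < length gs' \<and>
      (\<forall>\<alpha>. gate_true gs' \<alpha> (t (''D'', ''output'') 0) \<longleftrightarrow>
        (\<exists>e < N. bits (s stack_state e) \<inter> bits (s regs 14) = {} \<and> gate_true gs \<alpha> (s stack_gate e)))))"
proof -
  define I where "I n t \<longleftrightarrow>
    (\<exists>gs'. D_mem t gs' \<and> dnnf_list0 gs' \<and> (\<exists>hs. gs' = gs @ hs) \<and> list_vars gs' = list_vars gs \<and>
      length gs' \<le> length gs + 2 * n \<and> t regs 13 < length gs' \<and>
      (\<forall>\<alpha>. gate_true gs' \<alpha> (t regs 13) \<longleftrightarrow>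
        (\<exists>e < n. bits (s stack_state e) \<inter> bits (s regs 14) = {} \<and> gate_true gs \<alpha> (s stack_gate e)))) \<and>
    (\<forall>a. fst a \<noteq> ''D'' \<longrightarrow> a \<noteq> regs \<longrightarrow> t a = s a) \<and>
    (\<forall>i. 8 \<le> i \<longrightarrow> i \<noteq> 12 \<longrightarrow> i \<noteq> 13 \<longrightarrow> t regs i = s regs i) \<and> t regs 12 = n" for n t
  let ?e = "Minus (reg 9) (reg 12)"
  let ?c = "differ (reg 5) (Plus (Load stack_state (reg 12)) (reg 14))"
  let ?b = "set_reg 2 (Load stack_state (reg 12)) ;; set_reg 3 (reg 14) ;; or_prog ;;
        Cond ?c Skip disjoin_prog ;; set_reg 12 (Plus (reg 12) (Num 1))"
  have step: "expr_val ?e t \<noteq> 0 \<and> wp ?b t (\<lambda>m u. m + expr_cost ?e + 1 \<le> or_cost s + 250 \<and> I (Suc n) u)"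
    if n: "n < N" and I: "I n t" for n t
  proof -
    from I obtain gs' hs where D': "D_mem t gs'" and gs': "dnnf_list0 gs'" and hs: "gs' = gs @ hs"
      and lv: "list_vars gs' = list_vars gs" and len: "length gs' \<le> length gs + 2 * n" and r13: "t regs 13 < length gs'"
      and sem: "\<And>\<alpha>. gate_true gs' \<alpha> (t regs 13) \<longleftrightarrow>
        (\<exists>e < n. bits (s stack_state e) \<inter> bits (s regs 14) = {} \<and> gate_true gs \<alpha> (s stack_gate e))"
      and ar: "\<And>a. fst a \<noteq> ''D'' \<Longrightarrow> a \<noteq> regs \<Longrightarrow> t a = s a"
      and rg: "\<And>i. 8 \<le> i \<Longrightarrow> i \<noteq> 12 \<Longrightarrow> i \<noteq> 13 \<Longrightarrow> t regs i = s regs i" and r12: "t regs 12 = n"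
      unfolding I_def by blast
    have st: "t stack_state n = s stack_state n" "t stack_gate n = s stack_gate n" using ar by simp_all
    have less: "s stack_state n < N" "s stack_gate n < length gs" using F n by (auto simp: family_sound_def)
    have r: "t regs 8 = s regs 8" "t regs 9 = N" "t regs 14 = s regs 14" using rg N by simp_all
    let ?t = "t(regs := (t regs)(2 := s stack_state n, 3 := s regs 14))"
    have "wp or_prog ?t (\<lambda>m u. wp (Cond ?c Skip disjoin_prog) u (\<lambda>m' u'. 5 + (4 + (m + m')) + 20 \<le> or_cost s + 250 \<and>
        I (Suc n) (u'(regs := (u' regs)(12 := Suc n))) \<and> u' regs 12 = n))"
    proof (rule wp_or_prog)
      show "powers_ready ?t" using pr ar r by (simp add: powers_ready_def)
      show "?t regs 2 < 2 ^ ?t regs 8" "?t regs 3 < 2 ^ ?t regs 8" using less M N r by simp_all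
    next
      fix m u assume m: "m \<le> 71 * ?t regs 8 + 12" and fr: "frame ?t u"
        and r5: "u regs 5 = Bit_Operations.or (?t regs 2) (?t regs 3)"
      have ua: "u a = t a" if "a \<noteq> regs" for a using frame_array[OF fr that] that by simp
      have ur: "u regs i = t regs i" if "8 \<le> i" for i using fr that by (simp add: frame_def)
      have Du: "D_mem u gs'" by (rule D_mem_cong[OF D']) (simp add: ua)
      have test: "expr_val ?c u = 0 \<longleftrightarrow> bits (s stack_state n) \<inter> bits (s regs 14) = {}"
        unfolding or_eq_add_iff[symmetric] using r5 ua ur r st r12 by auto
      have old: "gate_true gs' \<alpha> (s stack_gate n) = gate_true gs \<alpha> (s stack_gate n)" for \<alpha>
        unfolding hs by (rule gate_true_append[OF dnnf_list0D[OF gs] less(2)])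
      show "wp (Cond ?c Skip disjoin_prog) u (\<lambda>m' u'. 5 + (4 + (m + m')) + 20 \<le> or_cost s + 250 \<and>
        I (Suc n) (u'(regs := (u' regs)(12 := Suc n))) \<and> u' regs 12 = n)"
      proof (cases "bits (s stack_state n) \<inter> bits (s regs 14) = {}")
        case False
        let ?u = "u(regs := (u regs)(12 := Suc n))"
        have "I (Suc n) ?u" unfolding I_def
        proof (rule conjI, rule exI[of _ gs'], intro conjI allI impI)
          show "D_mem ?u gs'" by (rule D_mem_cong[OF Du]) simp
          show "?u regs 13 < length gs'" using r13 ur by simp
          show "\<exists>hs. gs' = gs @ hs" using hs by blast
          fix \<alpha>
          show "gate_true gs' \<alpha> (?u regs 13) \<longleftrightarrow>
            (\<exists>e < Suc n. bits (s stack_state e) \<inter> bits (s regs 14) = {} \<and> gate_true gs \<alpha> (s stack_gate e))"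
            using sem[of \<alpha>] ur False by (auto simp: less_Suc_eq)
        qed (use gs' lv len ua ur ar rg in auto)
        moreover have "u regs 12 = n" using ur r12 by simp
        ultimately show ?thesis unfolding wp_Cond wp_Skip using False test m r(1)
          by (simp add: or_cost_def del: One_nat_def)
      next
        case True
        let ?gs = "gs' @ [GOr [s stack_gate n], GOr [t regs 13, length gs']]"
        have ln: "s stack_gate n < length gs'" using less(2) by (simp add: hs)
        note dj = disjoin_gate[OF gs' ln r13]
        have "wp disjoin_prog u (\<lambda>m' u'. m' \<le> 150 \<and> I (Suc n) (u'(regs := (u' regs)(12 := Suc n))) \<and> u' regs 12 = n)"
        proof (rule wp_disjoin_prog[OF Du])
          fix m' :: nat and u'
          assume m': "m' \<le> 150" and Du': "D_mem u' (gs' @ [GOr [u stack_gate (u regs 12)], GOr [u regs 13, length gs']])"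
            and ua': "\<And>a. fst a \<noteq> ''D'' \<Longrightarrow> a \<noteq> regs \<Longrightarrow> u' a = u a"
            and ur': "\<And>i. 8 \<le> i \<Longrightarrow> i \<noteq> 13 \<Longrightarrow> u' regs i = u regs i" and r13': "u' regs 13 = Suc (length gs')"
          let ?u = "u'(regs := (u' regs)(12 := Suc n))"
          have "u stack_gate (u regs 12) = s stack_gate n" "u regs 13 = t regs 13" using ua ur st r12 by simp_all
          then have Dg: "D_mem u' ?gs" using Du' by simp
          have "I (Suc n) ?u" unfolding I_def
          proof (rule conjI, rule exI[of _ ?gs], intro conjI allI impI)
            show "D_mem ?u ?gs" by (rule D_mem_cong[OF Dg]) simp
            show "dnnf_list0 ?gs" by (rule dj(1))
            show "list_vars ?gs = list_vars gs" using dj(2) lv by simp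
            show "length ?gs \<le> length gs + 2 * Suc n" using len by simp
            show "?u regs 13 < length ?gs" using r13' by simp
            show "\<exists>hs. ?gs = gs @ hs" using hs by simp
            fix \<alpha>
            show "gate_true ?gs \<alpha> (?u regs 13) \<longleftrightarrow>
              (\<exists>e < Suc n. bits (s stack_state e) \<inter> bits (s regs 14) = {} \<and> gate_true gs \<alpha> (s stack_gate e))"
              using dj(3)[where \<alpha> = \<alpha>] sem[of \<alpha>] old[of \<alpha>] True r13' by (auto simp: less_Suc_eq)
          qed (use ua ur ua' ur' ar rg in auto)
          then show "m' \<le> 150 \<and> I (Suc n) ?u \<and> u' regs 12 = n" using m' ur' ur r12 by simp
        qed
        then show ?thesis unfolding wp_Cond using True test m r(1)
          by (simp add: or_cost_def del: One_nat_def) (erule wp_mono, simp)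
      qed
    qed
    then have "wp ?b t (\<lambda>m u. m + expr_cost ?e + 1 \<le> or_cost s + 250 \<and> I (Suc n) u)"
      unfolding wp_Seq wp_Store using r12 st r(3)
      by (simp del: One_nat_def) (erule wp_mono, erule wp_mono, simp)
    moreover have "expr_val ?e t \<noteq> 0" using r r12 n by simp
    ultimately show ?thesis by blast
  qed
  have init: "I 0 (s(regs := (s regs)(12 := 0, 13 := 0)))"
  proof -
    have "D_mem (s(regs := (s regs)(12 := 0, 13 := 0))) gs" by (rule D_mem_cong[OF D]) simp
    moreover have "\<exists>hs. gs = gs @ hs" by simp
    ultimately show ?thesis unfolding I_def using gs gate_0[OF gs] by auto
  qed
  have exit: "expr_val ?e t = 0" if "I N t" for t using that N by (simp add: I_def)
  show ?thesis unfolding final_prog_def wp_Seq[of "set_reg 12 (Num 0)"] wp_Seq[of "set_reg 13 (Num 0)"]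
      wp_Seq[of "While ?e ?b"] wp_Store
  proof (rule wp_While_count[where I = I and k = N and C = "or_cost s + 250"], goal_cases)
    case 1
    then show ?case using init by simp
  next
    case (2 n t)
    then show ?case by (rule step)
  next
    case (3 t)
    then show ?case by (rule exit)
  next
    case (4 n t)
    then obtain gs' where gs': "D_mem t gs'" "dnnf_list0 gs'" "list_vars gs' = list_vars gs"
      "length gs' \<le> length gs + 2 * N" "t regs 13 < length gs'"
      "\<forall>\<alpha>. gate_true gs' \<alpha> (t regs 13) \<longleftrightarrow>
        (\<exists>e < N. bits (s stack_state e) \<inter> bits (s regs 14) = {} \<and> gate_true gs \<alpha> (s stack_gate e))"
      unfolding I_def by blast
    have "D_mem (t((''D'', ''output'') := f)) gs'" for f
      using gs'(1) by (simp add: D_mem_def)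
    then show ?case using gs'(2-6) 4(1) by (auto intro!: exI[of _ gs'])
  qed
qed

section \<open>The whole program\<close>

text \<open>Cell 9 starts with \<open>2 ^ 0\<close>, for no labels at all. The gate emitted before
  the main loop has kind 1: it is gate 0, the constant false.\<close>

definition compile_prog :: prog where
  "compile_prog =
     set_reg 9 (Num 1) ;; label_pass ;; set_reg 11 (Num 0) ;;
     set_reg 2 (Num 1) ;; set_reg 3 (Num 0) ;; add_gate ;;
     While nodes_left node_prog ;; final_prog"

lemma dec_labels_finite: "finite (dec_labels T)" and dec_labels_nonempty: "dec_labels T \<noteq> {}"
  by (induction T) auto

text \<open>A binary tree with \<open>m\<close> leaves has \<open>m - 1\<close> unions; the extra
  summand on the left turns this into an estimate that adds up over unions.\<close>

lemma gate_count_bound: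
  "unions_disjoint T \<Longrightarrow> gate_count N T + 3 * (N * N) \<le> (2 + 3 * (N * N)) * card (dec_verts T)"
proof (induction T)
  case (Disj_Union S T)
  have "card (dec_verts S \<union> dec_verts T) = card (dec_verts S) + card (dec_verts T)"
    using Disj_Union.prems by (intro card_Un_disjoint finite_dec_verts) simp
  then show ?case using Disj_Union by (simp add: distrib_left)
qed auto

text \<open>\<open>426 * dec_width T + 30\<close> is \<open>or_cost\<close> for states of
  \<open>6 * dec_width T\<close> bits, as \<open>426 = 6 * 71\<close>.\<close>

lemma compile_correct:
  assumes Z: "circuit Z" "constant_free Z" and T: "clique_decomposition T (circuit_dag Z)"
    and s: "initial_memory Z T s" and N: "N = 2 ^ (6 * dec_width T)"
  shows "wp compile_prog s (\<lambda>n t. n \<le> 3000 * (dec_nodes T * (N * N * (426 * dec_width T + 30))) \<and>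
    (\<exists>D. circuit_in_memory ''D'' t D \<and> dnnf_of D Z \<and> circuit_size D \<le> 8 * (N * N * circuit_size Z)))"
proof -
  let ?L = "dec_labels T" and ?oc = "426 * dec_width T + 30"
  have sz: "s (p, f) = (\<lambda>_. 0)" if "p \<noteq> ''Z''" "p \<noteq> ''T''" for p f
    using s that by (simp add: initial_memory_def)
  have ZT: "circuit_in_memory ''Z'' s Z" "dec_in_memory ''T'' s T" using s by (simp_all add: initial_memory_def)
  have T': "unions_disjoint T" "dec_verts T = {..<circuit_size Z}"
    using T by (simp_all add: clique_decomposition_def circuit_dag_def)
  have nodes: "1 \<le> dec_nodes T" by (cases T) auto
  have N1: "1 \<le> N" by (simp add: N)
  let ?s1 = "s(regs := (s regs)(9 := 1))"
  have lb1: "labelled {} (\<lambda>_. 0) ?s1"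
    by (simp add: labelled_def powers_ready_def sz bits_0)
  have dm1: "dec_in_memory ''T'' ?s1 T" using ZT(2) by (simp add: dec_in_memory_def)
  let ?P = "\<lambda>t. \<exists>D. circuit_in_memory ''D'' t D \<and> dnnf_of D Z \<and> circuit_size D \<le> 8 * (N * N * circuit_size Z)"
  let ?K = "node_cost N ?oc"
  let ?F = "N * (?oc + 250) + 30"
  let ?rest = "set_reg 11 (Num 0) ;; set_reg 2 (Num 1) ;; set_reg 3 (Num 0) ;; add_gate ;;
     While nodes_left node_prog ;; final_prog"
  have "wp label_pass ?s1 (\<lambda>n1 t1. wp ?rest t1 (\<lambda>n2 t. 3 + (n1 + n2) \<le>
      dec_nodes T * 400 + 100 + dec_nodes T * ?K + ?F \<and> ?P t))"
  proof (rule wp_mono[OF wp_label_pass[OF dm1 _ lb1]])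
    show "?s1 regs 11 = 0" using sz by simp
    fix n1 t1 assume a: "n1 \<le> dec_nodes T * 400 + 10 \<and>
      (\<forall>a. a \<noteq> regs \<longrightarrow> a \<noteq> powers \<longrightarrow> a \<noteq> label_mask \<longrightarrow> t1 a = ?s1 a) \<and>
      (\<forall>i. i \<noteq> 8 \<longrightarrow> i \<noteq> 9 \<longrightarrow> i \<noteq> 11 \<longrightarrow> i \<noteq> 14 \<longrightarrow> t1 regs i = ?s1 regs i) \<and>
      (\<exists>ix. labelled ?L ix t1)"
    then obtain ix where n1: "n1 \<le> dec_nodes T * 400 + 10"
      and ar1: "\<And>a. a \<noteq> regs \<Longrightarrow> a \<noteq> powers \<Longrightarrow> a \<noteq> label_mask \<Longrightarrow> t1 a = s a"
      and rg1: "\<And>i. i \<noteq> 8 \<Longrightarrow> i \<noteq> 9 \<Longrightarrow> i \<noteq> 11 \<Longrightarrow> i \<noteq> 14 \<Longrightarrow> t1 regs i = 0"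
      and lb: "labelled ?L ix t1"
      by (auto simp: sz)
    have L: "inj_on ix ?L" "\<And>a. a \<in> ?L \<Longrightarrow> ix a < card ?L" "t1 regs 8 = 6 * card ?L"
      "t1 regs 9 = 2 ^ (6 * card ?L)" "powers_ready t1"
      "\<And>a. t1 label_mask a = (if a \<in> ?L then 2 ^ (6 * ix a) else 0)"
      "bits (t1 regs 14) = (\<Union>a \<in> ?L. {6 * ix a + 4, 6 * ix a + 5})"
      using lb unfolding labelled_def by blast+
    let ?t1 = "t1(regs := (t1 regs)(11 := 0, 2 := 1, 3 := 0))"
    have D0: "D_mem ?t1 []" by (simp add: D_mem_def ar1 sz)
    have "wp add_gate ?t1 (\<lambda>m t. wp (While nodes_left node_prog ;; final_prog) t (\<lambda>n2 t. 3 + (n1 + (3 + (3 + (3 + (m + n2))))) \<le>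
      dec_nodes T * 400 + 100 + dec_nodes T * ?K + ?F \<and> ?P t))"
    proof (rule wp_add_gate[OF D0, where G = "GConst False"])
      fix t2 assume D2: "D_mem t2 ([] @ [GConst False])" and a2: "\<And>a. fst a \<noteq> ''D'' \<Longrightarrow> t2 a = ?t1 a"
      let ?gs = "[GConst False]"
      have gs: "dnnf_list0 ?gs"
        using dnnf_list.snoc[OF dnnf_list.Nil, of "GConst False"] by (simp add: appendable_def dnnf_list0_def)
      have w2: "t2 regs 8 = 6 * dec_width T" "t2 regs 9 = N" "t2 regs 10 = 0" "t2 regs 11 = 0" "t2 regs 14 = t1 regs 14"
        using a2[of regs] L(3,4) rg1 by (simp_all add: N dec_width_def)
      have b2: "t2 a = s a" if "fst a \<noteq> ''D''" "a \<noteq> regs" "a \<noteq> powers" "a \<noteq> label_mask" for a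
        using a2[OF that(1)] ar1[OF that(2-4)] that by simp
      have oc: "or_cost t2 = ?oc" using w2 by (simp add: or_cost_def)
      have prep: "prepared Z ?L ix t2"
        unfolding prepared_def
      proof (intro conjI ballI)
        show "powers_ready t2" using L(5) a2[of powers] w2(1) L(3) by (simp add: powers_ready_def dec_width_def)
        show "t2 regs 9 = 2 ^ t2 regs 8" using w2 by (simp add: N)
        show "circuit_in_memory ''Z'' t2 Z" using ZT(1) b2 by (simp add: circuit_in_memory_def)
        show "t2 accum = (\<lambda>_. 0)" using b2 sz by simp
        fix a assume a: "a \<in> ?L"
        show "t2 label_mask a = 2 ^ (6 * ix a)" using L(6) a a2 by simp
        show "6 * ix a + 6 \<le> t2 regs 8" using L(2)[OF a] w2(1) by (simp add: dec_width_def)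
      qed
      have T2: "t2 (''T'', ''size'') 0 = dec_nodes T" using b2 ZT(2) by (simp add: dec_in_memory_def)
      have rounds: "wp_rounds (dec_nodes T) nodes_left node_prog t2 (\<lambda>n t. n \<le> dec_nodes T * node_cost N (or_cost t2) \<and>
        t regs 11 = t2 regs 11 + dec_nodes T \<and> (\<exists>gs'. built Z ix N 0 t2 ?gs T t gs'))"
      proof (rule wp_nodes[OF Z L(1) prep w2(2,3) _ gs T'(1) subset_refl])
        show "D_mem t2 ?gs" using D2 by simp
        show "dec_verts T \<subseteq> {..<circuit_size Z}" using T'(2) by simp
        show "list_vars ?gs \<inter> dec_vars Z T = {}" by (simp add: list_vars_def)
        show "segment t2 (t2 regs 11) (postorder T)"
          using ZT(2) b2 w2(4) by (simp add: segment_def dec_in_memory_def length_postorder)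
        show "t2 regs 11 + dec_nodes T \<le> t2 (''T'', ''size'') 0" using w2 T2 by simp
      qed
      show "wp (While nodes_left node_prog ;; final_prog) t2 (\<lambda>n2 t. 3 + (n1 + (3 + (3 + (3 + (47 + n2))))) \<le>
        dec_nodes T * 400 + 100 + dec_nodes T * ?K + ?F \<and> ?P t)"
        unfolding wp_Seq
      proof (rule wp_While_rounds[OF wp_rounds_mono[OF rounds]], elim conjE exE, intro conjI)
        fix n3 t3 gs3 assume n3: "n3 \<le> dec_nodes T * node_cost N (or_cost t2)" and r3: "t3 regs 11 = t2 regs 11 + dec_nodes T"
          and bt: "built Z ix N 0 t2 ?gs T t3 gs3"
        have si: "same_input t2 t3" and D3: "D_mem t3 gs3" and gs3: "dnnf_list0 gs3"
          and lv: "list_vars gs3 = dec_vars Z T" and len: "length gs3 = 1 + gate_count N T"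
          and F: "family Z ix N gs3 T (t3 stack_gate) (t3 stack_state)"
          using bt unfolding built_def by (auto simp: list_vars_def)
        have r: "t3 regs 8 = t2 regs 8" "t3 regs 9 = N" "t3 regs 14 = t1 regs 14" "t3 (''T'', ''size'') 0 = dec_nodes T"
          using si w2 T2 by (simp_all add: same_input_def)
        show "expr_val nodes_left t3 = 0" using r r3 w2 by simp
        have pr: "powers_ready t3" using prepared_same_input[OF prep si] by (simp add: prepared_def)
        have M: "t3 regs 14 < N"
        proof -
          have "bits (t1 regs 14) \<subseteq> {..<6 * dec_width T}"
            unfolding L(7) dec_width_def using L(2) by fastforce
          then show ?thesis unfolding r N less_exp_iff_bits .
        qed
        have oc3: "or_cost t3 = ?oc" using oc r by (simp add: or_cost_def)
        have Fs: "family_sound N gs3 (dec_vars Z T) (t3 stack_gate) (t3 stack_state)"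
          using F by (simp add: family_def)
        have N3: "N = 2 ^ t3 regs 8" using r w2 N by simp
        show "wp final_prog t3 (\<lambda>n4 t. 3 + (n1 + (3 + (3 + (3 + (47 + (n3 + (expr_cost nodes_left + 1) + n4)))))) \<le>
          dec_nodes T * 400 + 100 + dec_nodes T * ?K + ?F \<and> ?P t)"
        proof (rule wp_mono[OF wp_final_prog[OF D3 gs3 pr r(2) N3 M Fs]], elim conjE exE)
          fix n4 t gs' assume n4: "n4 \<le> N * (or_cost t3 + 250) + 30" and D': "D_mem t gs'" and gs': "dnnf_list0 gs'"
            and lv': "list_vars gs' = list_vars gs3" and len': "length gs' \<le> length gs3 + 2 * N"
            and out: "t (''D'', ''output'') 0 < length gs'"
            and sem: "\<forall>\<alpha>. gate_true gs' \<alpha> (t (''D'', ''output'') 0) \<longleftrightarrow>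
              (\<exists>e < N. bits (t3 stack_state e) \<inter> bits (t3 regs 14) = {} \<and> gate_true gs3 \<alpha> (t3 stack_gate e))"
          let ?D = "\<lparr>gates = gs', out_gate = t (''D'', ''output'') 0\<rparr>"
          have mem: "circuit_in_memory ''D'' t ?D" by (rule D_mem_imp_circuit_in_memory[OF D' refl])
          have fun_eq: "circuit_fun ?D \<alpha> = circuit_fun Z \<alpha>" for \<alpha>
          proof -
            have "circuit_fun ?D \<alpha> \<longleftrightarrow> (\<exists>\<sigma>. bits \<sigma> \<inter> bits (t1 regs 14) = {} \<and>
                (\<exists>e < N. t3 stack_state e = \<sigma> \<and> gate_true gs3 \<alpha> (t3 stack_gate e)))"
              unfolding circuit_fun_list using sem r(3) by auto
            also have "\<dots> \<longleftrightarrow> (\<exists>\<sigma>. bits \<sigma> \<inter> bits (t1 regs 14) = {} \<and>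
                (\<exists>v. admissible Z \<alpha> T v \<and> unforbidden Z T v \<and> facts Z ix T v = bits \<sigma>))"
              using F unfolding family_def by simp
            \<comment> \<open>Every set of facts has a code, so the code can be eliminated.\<close>
            also have "\<dots> \<longleftrightarrow> (\<exists>v. admissible Z \<alpha> T v \<and> unforbidden Z T v \<and> facts Z ix T v \<inter> bits (t1 regs 14) = {})"
              using facts_code by metis
            also have "\<dots> \<longleftrightarrow> (\<exists>v. admissible Z \<alpha> T v \<and> unforbidden Z T v \<and>
                (\<forall>a \<in> ?L. \<forall>b \<in> {4, 5}. 6 * ix a + b \<notin> facts Z ix T v))"
              unfolding L(7) by (intro ex_cong1 conj_cong refl) auto
            also have "\<dots> \<longleftrightarrow> circuit_fun Z \<alpha>"
              by (rule circuit_fun_iff_guess[OF Z T L(1) subset_refl, symmetric])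
            finally show ?thesis .
          qed
          have vars: "circuit_vars ?D \<subseteq> circuit_vars Z"
          proof -
            have "circuit_vars ?D = dec_vars Z T" using lv lv' by (simp add: circuit_vars_def list_vars_def)
            also have "\<dots> \<subseteq> circuit_vars Z"
              unfolding dec_vars_def circuit_vars_def T'(2) circuit_size_def by (auto simp: in_set_conv_nth intro: sym)
            finally show ?thesis .
          qed
          have dn: "dnnf_of ?D Z"
            unfolding dnnf_of_def using dnnf_list_imp_dnnf[OF dnnf_list0D[OF gs'] out] vars fun_eq by blast
          \<comment> \<open>One constant gate, two gates per vertex, \<open>3 * (N * N)\<close> per
            union and at most \<open>2 * N\<close> for the output: the coefficients 1, 2, 3 and 2
            add up to 8.\<close>
          have size: "circuit_size ?D \<le> 8 * (N * N * circuit_size Z)"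
          proof -
            have Z1: "1 \<le> circuit_size Z" using Z(1) by (auto simp: circuit_def)
            have "gate_count N T + 3 * (N * N) \<le> (2 + 3 * (N * N)) * circuit_size Z"
              using gate_count_bound[OF T'(1), of N] T'(2) by simp
            also have "\<dots> = 2 * circuit_size Z + 3 * (N * N * circuit_size Z)" by (simp add: distrib_right)
            finally have 1: "gate_count N T \<le> 2 * circuit_size Z + 3 * (N * N * circuit_size Z)" by linarith
            have 2: "circuit_size Z \<le> N * N * circuit_size Z" "N \<le> N * N * circuit_size Z" "1 \<le> N * N * circuit_size Z"
              using N1 Z1 by (simp_all add: mult.assoc)
            have "circuit_size ?D \<le> 1 + gate_count N T + 2 * N" using len len' by (simp add: circuit_size_def)
            then show ?thesis using 1 2 by linarith
          qed
          show "3 + (n1 + (3 + (3 + (3 + (47 + (n3 + (expr_cost nodes_left + 1) + n4)))))) \<le>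
            dec_nodes T * 400 + 100 + dec_nodes T * ?K + ?F \<and> ?P t"
            using n1 n3 n4 mem dn size unfolding oc oc3 by auto
        qed
      qed
    qed (simp_all)
    then show "wp ?rest t1 (\<lambda>n2 t. 3 + (n1 + n2) \<le> dec_nodes T * 400 + 100 + dec_nodes T * ?K + ?F \<and> ?P t)"
      unfolding wp_Seq wp_Store by (simp del: One_nat_def)
  qed
  then have "wp compile_prog s (\<lambda>n t. n \<le> dec_nodes T * 400 + 100 + dec_nodes T * ?K + ?F \<and> ?P t)"
    unfolding compile_prog_def wp_Seq[of "set_reg 9 (Num 1)"] wp_Seq[of label_pass] wp_Store by (simp del: One_nat_def)
  then show ?thesis
  proof (rule wp_mono)
    fix n t assume n: "n \<le> dec_nodes T * 400 + 100 + dec_nodes T * ?K + ?F \<and> ?P t"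
    let ?X = "N * N * ?oc"
    \<comment> \<open>Every summand of the time is compared with \<open>dec_nodes T * ?X\<close>;
      the coefficients 400, 100, 1000, 1, 250 and 30 sum to less than 3000.\<close>
    have X: "1 \<le> ?X" "N \<le> ?X" "N * ?oc \<le> ?X" using N1 by (simp_all add: mult.assoc)
    have Y: "?X \<le> dec_nodes T * ?X" "dec_nodes T \<le> dec_nodes T * ?X" using nodes X(1) by simp_all
    have K: "dec_nodes T * ?K = 1000 * (dec_nodes T * ?X)" by (simp add: node_cost_def)
    have F: "?F = N * ?oc + 250 * N + 30" by (simp add: distrib_left)
    have "n \<le> 3000 * (dec_nodes T * ?X)"
      using conjunct1[OF n] unfolding K F using X Y by linarith
    then show "n \<le> 3000 * (dec_nodes T * ?X) \<and> ?P t" using n by blast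
  qed
qed

section \<open>Existence of decompositions and memory images\<close>

lemma ex_edgeless_decomposition:
  assumes "finite V" "V \<noteq> {}"
  shows "\<exists>T. unions_disjoint T \<and> dec_verts T = V \<and> dec_arcs T = {} \<and> (\<forall>u \<in> V. dec_label T u = u)"
  using assms
proof (induction V rule: finite_ne_induct)
  case (singleton x)
  then show ?case by (intro exI[of _ "Create x x"]) simp
next
  case (insert x V)
  then obtain T where T: "unions_disjoint T" "dec_verts T = V" "dec_arcs T = {}" "\<forall>u \<in> V. dec_label T u = u"
    by blast
  then show ?case using insert.hyps by (intro exI[of _ "Disj_Union (Create x x) T"]) auto
qed

text \<open>If every vertex is its own label, \<open>Eta u w\<close> adds the single arc from
  \<open>u\<close> to \<open>w\<close>. The width is of no concern here: existence ensures that the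
  minimum in \<open>cliquewidth\<close> is attained.\<close>

lemma ex_clique_decomposition:
  fixes G :: "nat pair_pre_digraph"
  assumes "finite (pverts G)" "pverts G \<noteq> {}" "parcs G \<subseteq> pverts G \<times> pverts G"
  shows "\<exists>T. clique_decomposition T G"
proof -
  have "finite (parcs G)" using assms finite_subset by auto
  have "\<exists>T. unions_disjoint T \<and> dec_verts T = pverts G \<and> dec_arcs T = A \<and> (\<forall>u \<in> pverts G. dec_label T u = u)"
    if "finite A" "A \<subseteq> pverts G \<times> pverts G" for A
    using that
  proof (induction A rule: finite_induct)
    case empty
    then show ?case using ex_edgeless_decomposition[OF assms(1,2)] by simp
  next
    case (insert e A)
    obtain u w where e: "e = (u, w)" by (cases e)
    then have uw: "u \<in> pverts G" "w \<in> pverts G" using insert.prems by auto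
    from insert obtain T where T: "unions_disjoint T" "dec_verts T = pverts G" "dec_arcs T = A"
      "\<forall>u \<in> pverts G. dec_label T u = u" by auto
    have "{(a, b). a \<in> dec_verts T \<and> b \<in> dec_verts T \<and> dec_label T a = u \<and> dec_label T b = w} = {(u, w)}"
      using T uw by auto
    then show ?case using T e by (intro exI[of _ "Eta u w T"]) simp
  qed
  from this[OF \<open>finite (parcs G)\<close> assms(3)] show ?thesis
    unfolding clique_decomposition_def by metis
qed

text \<open>The mere existence of a DNNF is also obtained by running the program, which takes some
  memory image of the input.\<close>

lemma ex_initial_memory: "\<exists>s. initial_memory Z T s"
proof -
  let ?in = "\<lambda>g. gate_inputs (gates Z ! g)"
  \<comment> \<open>A common stride larger than every degree: gate \<open>g\<close> owns the wire
    cells from \<open>g * m\<close> on, and division by \<open>m\<close> recovers gate and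
    wire.\<close>
  obtain m where m: "length (?in g) < m" if "g < circuit_size Z" for g
  proof -
    have "finite ((\<lambda>g. length (?in g)) ` {..<circuit_size Z})" by simp
    then show ?thesis using that unfolding finite_nat_set_iff_bounded by blast
  qed
  define s :: memory where "s a i = (
    if a = (''Z'', ''size'') then circuit_size Z else
    if a = (''Z'', ''output'') then out_gate Z else
    if a = (''Z'', ''kind'') then gate_kind (gates Z ! i) else
    if a = (''Z'', ''var'') then (case gates Z ! i of GVar x \<Rightarrow> x | _ \<Rightarrow> 0) else
    if a = (''Z'', ''degree'') then length (?in i) else
    if a = (''Z'', ''offset'') then i * m else
    if a = (''Z'', ''wire'') then ?in (i div m) ! (i mod m) else
    if a = (''T'', ''size'') then dec_nodes T else
    if a = (''T'', ''op'') then fst (postorder T ! i) else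
    if a = (''T'', ''arg1'') then fst (snd (postorder T ! i)) else
    if a = (''T'', ''arg2'') then snd (snd (postorder T ! i)) else 0)" for a i
  have "s (''Z'', ''wire'') (s (''Z'', ''offset'') g + l) = ?in g ! l"
    if "g < circuit_size Z" "l < length (?in g)" for g l
  proof -
    have "l < m" using m[OF that(1)] that(2) by simp
    then have "(g * m + l) div m = g" "(g * m + l) mod m = l" by simp_all
    then show ?thesis by (simp add: s_def)
  qed
  then have "circuit_in_memory ''Z'' s Z"
    unfolding circuit_in_memory_def Let_def by (simp add: s_def)
  moreover have "dec_in_memory ''T'' s T" by (simp add: dec_in_memory_def s_def)
  moreover have "s (p, f) = (\<lambda>_. 0)" if "p \<noteq> ''Z''" "p \<noteq> ''T''" for p f
    using that by (simp add: s_def fun_eq_iff)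
  ultimately show ?thesis unfolding initial_memory_def by blast
qed

text \<open>\<open>N * N\<close> is \<open>2 ^ (12 * k)\<close>, and the linear factor is absorbed
  by one more power \<open>2 ^ k\<close>; \<open>456 = 426 + 30\<close>.\<close>

lemma state_count_bound:
  fixes k :: nat
  defines "N \<equiv> 2 ^ (6 * k)"
  shows "N * N \<le> 9 ^ (18 * k)" "N * N * (426 * k + 30) \<le> 456 * 9 ^ (18 * k)"
proof -
  have NN: "N * N = 2 ^ (12 * k)" by (simp add: N_def flip: power_add)
  have mono: "(2::nat) ^ a \<le> 9 ^ (18 * k)" if "a \<le> 18 * k" for a
    using power_mono[of "2 :: nat" 9 a] power_increasing[OF that, of "9 :: nat"] by linarith
  show "N * N \<le> 9 ^ (18 * k)" unfolding NN by (rule mono) simp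
  have "k < 2 ^ k" "(1::nat) \<le> 2 ^ k" by (simp_all add: less_exp)
  then have "426 * k + 30 \<le> 456 * 2 ^ k" by linarith
  then have "N * N * (426 * k + 30) \<le> N * N * (456 * 2 ^ k)" by (rule mult_le_mono2)
  also have "\<dots> = 456 * 2 ^ (13 * k)" unfolding NN by (simp flip: power_add)
  also have "\<dots> \<le> 456 * 9 ^ (18 * k)" using mono[of "13 * k"] by simp
  finally show "N * N * (426 * k + 30) \<le> 456 * 9 ^ (18 * k)" .
qed

text \<open>\<open>1368000 = 3000 * 456\<close>. The time still counts the nodes of the
  decomposition, the size does not.\<close>

lemma compile_bounds:
  assumes Z: "circuit Z" "constant_free Z" and T: "clique_decomposition T (circuit_dag Z)"
    and s: "initial_memory Z T s" and k: "dec_width T = k"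
  shows "\<exists>n t D. exec compile_prog s n t \<and> n \<le> 1368000 * (9 ^ (18 * k) * dec_nodes T) \<and>
    circuit_in_memory ''D'' t D \<and> dnnf_of D Z \<and> circuit_size D \<le> 8 * (9 ^ (18 * k) * k\<^sup>2 * circuit_size Z)"
proof -
  let ?N = "2 ^ (6 * dec_width T) :: nat"
  from compile_correct[OF Z T s refl] obtain n t D where e: "exec compile_prog s n t"
    and n: "n \<le> 3000 * (dec_nodes T * (?N * ?N * (426 * dec_width T + 30)))"
    and D: "circuit_in_memory ''D'' t D" "dnnf_of D Z" and size: "circuit_size D \<le> 8 * (?N * ?N * circuit_size Z)"
    unfolding wp_def by blast
  note b = state_count_bound[of "dec_width T", unfolded k]
  have "n \<le> 3000 * (dec_nodes T * (456 * 9 ^ (18 * k)))"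
    using n mult_le_mono2[OF b(2), of "dec_nodes T"] unfolding k by linarith
  then have n': "n \<le> 1368000 * (9 ^ (18 * k) * dec_nodes T)" by (simp add: mult_ac)
  \<comment> \<open>Even a single vertex uses a label; therefore the factor \<open>k\<^sup>2\<close>
    may be inserted.\<close>
  have "1 \<le> k" using dec_labels_finite dec_labels_nonempty[of T] unfolding k[symmetric] dec_width_def
    by (simp add: Suc_le_eq card_gt_0_iff)
  then have "1 \<le> k\<^sup>2" by simp
  have "?N * ?N * circuit_size Z \<le> 9 ^ (18 * k) * circuit_size Z" using b(1) unfolding k by (rule mult_le_mono1)
  also have "\<dots> \<le> 9 ^ (18 * k) * k\<^sup>2 * circuit_size Z" using \<open>1 \<le> k\<^sup>2\<close> by simp
  finally have "circuit_size D \<le> 8 * (9 ^ (18 * k) * k\<^sup>2 * circuit_size Z)" using size by linarith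
  then show ?thesis using e n' D by blast
qed

text \<open>A decomposition may contain any number of redundant arc and relabelling nodes, all of
  which the program visits; hence the time is stated for decompositions of bounded size. The program
  is fixed before the factor \<open>c\<close>, on which only the constant \<open>C\<close>
  depends.\<close>

theorem theorem4:
  shows "(\<exists>C :: nat. \<forall>Z k. circuit Z \<and> constant_free Z \<and> cliquewidth (circuit_dag Z) = k \<longrightarrow>
            (\<exists>D. dnnf_of D Z \<and> circuit_size D \<le> C * (9 ^ (18 * k) * k\<^sup>2 * circuit_size Z)))
       \<and> (\<exists>A :: prog. \<forall>c :: nat. \<exists>C :: nat. \<forall>Z T k s.
            circuit Z \<and> constant_free Z \<and>
            clique_decomposition T (circuit_dag Z) \<and> dec_width T = k \<and>
            dec_nodes T \<le> c * (k\<^sup>2 * circuit_size Z) \<and> initial_memory Z T s \<longrightarrow>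
            (\<exists>n t D. exec A s n t \<and> n \<le> C * (9 ^ (18 * k) * k\<^sup>2 * circuit_size Z) \<and>
               circuit_in_memory ''D'' t D \<and> dnnf_of D Z \<and>
               circuit_size D \<le> C * (9 ^ (18 * k) * k\<^sup>2 * circuit_size Z)))"
proof
  show "\<exists>C :: nat. \<forall>Z k. circuit Z \<and> constant_free Z \<and> cliquewidth (circuit_dag Z) = k \<longrightarrow>
    (\<exists>D. dnnf_of D Z \<and> circuit_size D \<le> C * (9 ^ (18 * k) * k\<^sup>2 * circuit_size Z))"
  proof (intro exI[of _ "8 :: nat"] allI impI, elim conjE)
    fix Z k assume Z: "circuit Z" "constant_free Z" and k: "cliquewidth (circuit_dag Z) = k"
    have "\<exists>T. clique_decomposition T (circuit_dag Z)"
    proof (rule ex_clique_decomposition)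
      show "finite (pverts (circuit_dag Z))" "pverts (circuit_dag Z) \<noteq> {}"
        using Z(1) by (auto simp: circuit_dag_def circuit_def)
      have "pair_wf_digraph (circuit_dag Z)" using Z(1) by (simp add: circuit_def)
      then show "parcs (circuit_dag Z) \<subseteq> pverts (circuit_dag Z) \<times> pverts (circuit_dag Z)"
        using pair_wf_digraph.in_arcsD1 pair_wf_digraph.in_arcsD2 by fast
    qed
    then have "\<exists>k T. clique_decomposition T (circuit_dag Z) \<and> dec_width T = k" by blast
    then have "\<exists>T. clique_decomposition T (circuit_dag Z) \<and> dec_width T = k"
      unfolding k[symmetric] cliquewidth_def by (rule LeastI_ex)
    then obtain T where T: "clique_decomposition T (circuit_dag Z)" "dec_width T = k" by blast
    obtain s where "initial_memory Z T s" using ex_initial_memory by blast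
    then show "\<exists>D. dnnf_of D Z \<and> circuit_size D \<le> 8 * (9 ^ (18 * k) * k\<^sup>2 * circuit_size Z)"
      using compile_bounds[OF Z T(1) _ T(2)] by blast
  qed
next
  show "\<exists>A :: prog. \<forall>c :: nat. \<exists>C :: nat. \<forall>Z T k s.
      circuit Z \<and> constant_free Z \<and>
      clique_decomposition T (circuit_dag Z) \<and> dec_width T = k \<and>
      dec_nodes T \<le> c * (k\<^sup>2 * circuit_size Z) \<and> initial_memory Z T s \<longrightarrow>
      (\<exists>n t D. exec A s n t \<and> n \<le> C * (9 ^ (18 * k) * k\<^sup>2 * circuit_size Z) \<and>
         circuit_in_memory ''D'' t D \<and> dnnf_of D Z \<and>
         circuit_size D \<le> C * (9 ^ (18 * k) * k\<^sup>2 * circuit_size Z))"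
  proof (rule exI[of _ compile_prog], rule allI)
    fix c :: nat
    \<comment> \<open>The time bound is multiplied by \<open>c\<close> for the number of nodes; the
      summand 8 serves the size, also if \<open>c = 0\<close>.\<close>
    let ?C = "1368000 * c + 8"
    show "\<exists>C :: nat. \<forall>Z T k s.
      circuit Z \<and> constant_free Z \<and>
      clique_decomposition T (circuit_dag Z) \<and> dec_width T = k \<and>
      dec_nodes T \<le> c * (k\<^sup>2 * circuit_size Z) \<and> initial_memory Z T s \<longrightarrow>
      (\<exists>n t D. exec compile_prog s n t \<and> n \<le> C * (9 ^ (18 * k) * k\<^sup>2 * circuit_size Z) \<and>
         circuit_in_memory ''D'' t D \<and> dnnf_of D Z \<and>
         circuit_size D \<le> C * (9 ^ (18 * k) * k\<^sup>2 * circuit_size Z))"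
    proof (rule exI[of _ ?C], intro allI impI, elim conjE)
      fix Z T k s
      assume Z: "circuit Z" "constant_free Z" and T: "clique_decomposition T (circuit_dag Z)" "dec_width T = k"
        and nodes: "dec_nodes T \<le> c * (k\<^sup>2 * circuit_size Z)" and s: "initial_memory Z T s"
      let ?X = "9 ^ (18 * k) * k\<^sup>2 * circuit_size Z"
      obtain n t D where e: "exec compile_prog s n t" and n: "n \<le> 1368000 * (9 ^ (18 * k) * dec_nodes T)"
        and D: "circuit_in_memory ''D'' t D" "dnnf_of D Z" and size: "circuit_size D \<le> 8 * ?X"
        using compile_bounds[OF Z T(1) s T(2)] by blast
      have "9 ^ (18 * k) * dec_nodes T \<le> 9 ^ (18 * k) * (c * (k\<^sup>2 * circuit_size Z))"
        using nodes by (rule mult_le_mono2)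
      also have "\<dots> = c * ?X" by (simp add: mult_ac)
      finally have "n \<le> 1368000 * (c * ?X)" using n by linarith
      then have "n \<le> ?C * ?X" by (simp add: distrib_right)
      moreover have "circuit_size D \<le> ?C * ?X" using size by (simp add: distrib_right)
      ultimately show "\<exists>n t D. exec compile_prog s n t \<and> n \<le> ?C * ?X \<and>
          circuit_in_memory ''D'' t D \<and> dnnf_of D Z \<and> circuit_size D \<le> ?C * ?X"
        using e D by blast
    qed
  qed
qed

end
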